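(* Let $f:\mathbb{R}\to\mathbb{R}$ be locally Lipschitz continuous with $f(0)=0$ and $xf(x)>0$ for all $x\neq 0$. Suppose that there exists an odd function $\phi$ on $\mathbb{R}$ such that $\lim_{x\to 0} f(x)/\phi(x)=1$, that $f\in \mathrm{RV}_0(\beta)$ for some $\beta>1$, and that $\lim_{x\to 0^+} f(x)/x=0$. Let $\sigma:[0,\infty)\to\mathbb{R}$ be continuous, and let $X$ be the continuous adapted solution of $$dX(t)=-f(X(t))\,dt+\sigma(t)\,dB(t),\quad t\ge 0;\qquad X(0)=\xi,$$ with $\xi\in\mathbb{R}$ deterministic. Let $h>0$ and define, for $\epsilon>0$, $$S_f(\epsilon,h)=\sum_{n=0}^\infty\Psi\left(\frac{\epsilon}{\theta(n)}\right),\qquad \theta^2(n)=\frac{\int_{nh}^{(n+1)h}\sigma^2(s)\,ds}{\left((f\circ F^{-1})(nh)\right)^2},\quad \theta(n)\ge 0.$$ Let $A$ be the event $$A=\left\{\omega:\ \lim_{t\to\infty}\frac{X(t,\omega)}{F^{-1}(t)}=\lambda(\omega),\ \lim_{t\to\infty}\frac{\frac{X(t+h,\omega)-X(t,\omega)}{h}}{(f\circ F^{-1})(t)}=-\lambda(\omega)\ \text{ for some }\lambda(\omega)\in\{-1,0,1\}\right\}.$$ Then the following are equivalent: (a) $S_f(\epsilon,h)<+\infty$ for all $\epsilon>0$; (b) $\mathbb{P}[A]>0$; (c) $\mathbb{P}[A]=1$.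
   Context: $B$ is a one-dimensional standard Brownian motion on a complete probability space $(\Omega,\mathcal{F},\mathbb{P})$, with filtration $(\mathcal{F}^B(t))_{t\ge0}$ the natural filtration generated by $B$. A function $f$ which is positive and measurable on $(0,\infty)$ is regularly varying at $0$ with index $\beta\in\mathbb{R}$, written $f\in\mathrm{RV}_0(\beta)$, if $\lim_{x\to0^+} f(\lambda x)/f(x)=\lambda^\beta$ for every $\lambda>0$ (for $f$ defined on $\mathbb{R}$ this refers to its restriction to $(0,\infty)$). Define $F(x)=\int_x^1 \frac{1}{f(u)}\,du$ for $x>0$. $F$ is strictly decreasing; since $\beta>1$, $F(x)\to\infty$ as $x\to0^+$. $F^{-1}$ denotes the inverse function of $F$; $F^{-1}(t)>0$ is defined for all $t\ge 0$ and tends to $0$ as $t\to\infty$. $\Psi(x)=\frac{1}{\sqrt{2\pi}}\int_x^\infty e^{-y^2/2}\,dy$ is the complementary standard normal distribution function; $\Psi(\epsilon/\theta(n))$ is interpreted as $0$ if $\theta(n)=0$. *)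

theory Defs
  imports "HOL-Probability.Probability"
begin

section \<open>Regular variation at zero\<close>

definition regularly_varying_0 :: "(real \<Rightarrow> real) \<Rightarrow> real \<Rightarrow> bool" where
  "regularly_varying_0 f \<beta> \<longleftrightarrow>
     (\<forall>x>0. f x > 0) \<and>
     f \<in> borel_measurable (restrict_space borel {0<..}) \<and>
     (\<forall>c>0. ((\<lambda>x. f (c * x) / f x) \<longlongrightarrow> c powr \<beta>) (at_right 0))"

section \<open>The deterministic quantities\<close>

text \<open>The interval integral is oriented, so the definition also gives the right (negative) values
  for x > 1.\<close>

definition F_fun :: "(real \<Rightarrow> real) \<Rightarrow> real \<Rightarrow> real" where
  "F_fun f x = (LBINT u=ereal x..ereal 1. 1 / f u)"

definition F_inv :: "(real \<Rightarrow> real) \<Rightarrow> real \<Rightarrow> real" where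
  "F_inv f = inv_into {0<..} (F_fun f)"

definition Psi :: "real \<Rightarrow> real" where
  "Psi x = 1 / sqrt (2 * pi) * (LBINT y:{x..}. exp (- (y\<^sup>2) / 2))"

definition theta :: "(real \<Rightarrow> real) \<Rightarrow> (real \<Rightarrow> real) \<Rightarrow> real \<Rightarrow> nat \<Rightarrow> real" where
  "theta f \<sigma> h n =
     sqrt (integral {real n * h..(real n + 1) * h} (\<lambda>s. (\<sigma> s)\<^sup>2) / (f (F_inv f (real n * h)))\<^sup>2)"

text \<open>The case distinction is needed because division by zero is zero in HOL, whereas a term with
  vanishing theta has to contribute nothing to the sum.\<close>

definition S_sum :: "(real \<Rightarrow> real) \<Rightarrow> (real \<Rightarrow> real) \<Rightarrow> real \<Rightarrow> real \<Rightarrow> ennreal" where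
  "S_sum f \<sigma> \<epsilon> h =
     (\<Sum>n. if theta f \<sigma> h n = 0 then 0 else ennreal (Psi (\<epsilon> / theta f \<sigma> h n)))"

section \<open>Brownian motion and its filtration\<close>

text \<open>Processes are indexed by \<^typ>\<open>real\<close>; only their values at times at least 0 matter.\<close>

definition natural_filtration :: "'a measure \<Rightarrow> (real \<Rightarrow> 'a \<Rightarrow> real) \<Rightarrow> real \<Rightarrow> 'a measure" where
  "natural_filtration M B t =
     sigma (space M) {B s -` U \<inter> space M | s U. 0 \<le> s \<and> s \<le> t \<and> U \<in> sets borel}"

definition completed_filtration :: "'a measure \<Rightarrow> (real \<Rightarrow> 'a \<Rightarrow> real) \<Rightarrow> real \<Rightarrow> 'a measure" where
  "completed_filtration M B t =
     sigma (space M) (sets (natural_filtration M B t) \<union> null_sets M)"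

definition brownian_motion :: "'a measure \<Rightarrow> (real \<Rightarrow> 'a \<Rightarrow> real) \<Rightarrow> bool" where
  "brownian_motion M B \<longleftrightarrow>
     prob_space M \<and>
     (\<forall>t\<ge>0. B t \<in> borel_measurable M) \<and>
     (AE \<omega> in M. B 0 \<omega> = 0) \<and>
     (AE \<omega> in M. continuous_on {0..} (\<lambda>t. B t \<omega>)) \<and>
     (\<forall>s t. 0 \<le> s \<and> s < t \<longrightarrow>
        distributed M lborel (\<lambda>\<omega>. B t \<omega> - B s \<omega>) (normal_density 0 (sqrt (t - s))) \<and>
        prob_space.indep_set M (sets (natural_filtration M B s))
          {(\<lambda>\<omega>. B t \<omega> - B s \<omega>) -` U \<inter> space M | U. U \<in> sets borel})"

section \<open>The Ito integral\<close>

text \<open>The triple m, p, c stands for the simple process that equals \<open>c i\<close> on the time interval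
  \<open>{p i<..p (Suc i)}\<close> for \<open>i < m\<close>, and 0 elsewhere.\<close>

definition simple_process ::
    "'a measure \<Rightarrow> (real \<Rightarrow> 'a measure) \<Rightarrow> nat \<Rightarrow> (nat \<Rightarrow> real) \<Rightarrow> (nat \<Rightarrow> 'a \<Rightarrow> real) \<Rightarrow> bool" where
  "simple_process M G m p c \<longleftrightarrow>
     0 \<le> p 0 \<and> (\<forall>i<m. p i < p (Suc i)) \<and>
     (\<forall>i<m. c i \<in> borel_measurable (G (p i)) \<and> (\<exists>K. \<forall>\<omega>\<in>space M. \<bar>c i \<omega>\<bar> \<le> K))"

definition simple_value ::
    "nat \<Rightarrow> (nat \<Rightarrow> real) \<Rightarrow> (nat \<Rightarrow> 'a \<Rightarrow> real) \<Rightarrow> real \<Rightarrow> 'a \<Rightarrow> real" where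
  "simple_value m p c s \<omega> = (\<Sum>i<m. c i \<omega> * indicator {p i<..p (Suc i)} s)"

definition simple_integral ::
    "(real \<Rightarrow> 'a \<Rightarrow> real) \<Rightarrow> nat \<Rightarrow> (nat \<Rightarrow> real) \<Rightarrow> (nat \<Rightarrow> 'a \<Rightarrow> real) \<Rightarrow> real \<Rightarrow> 'a \<Rightarrow> real" where
  "simple_integral B m p c t \<omega> = (\<Sum>i<m. c i \<omega> * (B (min (p (Suc i)) t) \<omega> - B (min (p i) t) \<omega>))"

text \<open>\<open>is_ito_integral M G B H t Y\<close>: the random variable \<open>Y\<close> is a version of the Ito integral of
  the process \<open>H\<close> over \<open>[0, t]\<close>, defined by the usual extension from simple processes in the
  square-mean sense. By the Ito isometry \<open>Y\<close> is unique up to null sets. Convergence of the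
  integrands to \<open>H\<close> makes \<open>H\<close> adapted up to null sets.\<close>

definition is_ito_integral ::
    "'a measure \<Rightarrow> (real \<Rightarrow> 'a measure) \<Rightarrow> (real \<Rightarrow> 'a \<Rightarrow> real) \<Rightarrow> (real \<Rightarrow> 'a \<Rightarrow> real) \<Rightarrow> real \<Rightarrow>
     ('a \<Rightarrow> real) \<Rightarrow> bool" where
  "is_ito_integral M G B H t Y \<longleftrightarrow>
     (\<lambda>(s, \<omega>). indicator {0..t} s * H s \<omega>) \<in> borel_measurable (lborel \<Otimes>\<^sub>M M) \<and>
     Y \<in> borel_measurable M \<and>
     (\<exists>m p c.
        (\<forall>k. simple_process M G (m k) (p k) (c k)) \<and>
        (\<lambda>k. \<integral>\<^sup>+\<omega>. (\<integral>\<^sup>+s\<in>{0..t}. ennreal ((simple_value (m k) (p k) (c k) s \<omega> - H s \<omega>)\<^sup>2) \<partial>lborel) \<partial>M)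
          \<longlonglongrightarrow> 0 \<and>
        (\<lambda>k. \<integral>\<^sup>+\<omega>. ennreal ((simple_integral B (m k) (p k) (c k) t \<omega> - Y \<omega>)\<^sup>2) \<partial>M)
          \<longlonglongrightarrow> 0)"

section \<open>The stochastic differential equation\<close>

text \<open>Continuous adapted solutions of dX(t) = -f(X(t)) dt + \<sigma>(t) dB(t), X(0) = \<xi>; the process \<open>J\<close>
  is a continuous version of the stochastic integral of \<open>\<sigma>\<close>.\<close>

definition sde_solution ::
    "'a measure \<Rightarrow> (real \<Rightarrow> 'a \<Rightarrow> real) \<Rightarrow> (real \<Rightarrow> real) \<Rightarrow> (real \<Rightarrow> real) \<Rightarrow> real \<Rightarrow>
     (real \<Rightarrow> 'a \<Rightarrow> real) \<Rightarrow> bool" where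
  "sde_solution M B f \<sigma> \<xi> X \<longleftrightarrow>
     (\<forall>t\<ge>0. X t \<in> borel_measurable (completed_filtration M B t)) \<and>
     (AE \<omega> in M. continuous_on {0..} (\<lambda>t. X t \<omega>)) \<and>
     (AE \<omega> in M. X 0 \<omega> = \<xi>) \<and>
     (\<exists>J. (\<forall>t\<ge>0. is_ito_integral M (completed_filtration M B) B (\<lambda>s \<omega>. \<sigma> s) t (J t)) \<and>
          (AE \<omega> in M. continuous_on {0..} (\<lambda>t. J t \<omega>)) \<and>
          (AE \<omega> in M. \<forall>t\<ge>0. X t \<omega> = \<xi> - integral {0..t} (\<lambda>s. f (X s \<omega>)) + J t \<omega>))"

definition event_A ::
    "'a measure \<Rightarrow> (real \<Rightarrow> real) \<Rightarrow> real \<Rightarrow> (real \<Rightarrow> 'a \<Rightarrow> real) \<Rightarrow> 'a set" where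
  "event_A M f h X =
     {\<omega> \<in> space M. \<exists>l \<in> {-1, 0, 1 :: real}.
        ((\<lambda>t. X t \<omega> / F_inv f t) \<longlongrightarrow> l) at_top \<and>
        ((\<lambda>t. ((X (t + h) \<omega> - X t \<omega>) / h) / f (F_inv f t)) \<longlongrightarrow> - l) at_top}"

end

theory Submission
  imports Defs "HOL-Real_Asymp.Real_Asymp"
begin

text \<open>
Write \<open>a(t) = F\<^sup>-\<^sup>1(t)\<close>, the solution of \<open>a' = - f(a)\<close> with \<open>a(0) = 1\<close>, and let \<open>J\<close> be the stochastic
integral of \<open>\<sigma>\<close>. Everything rests on the increments of \<open>J\<close> over the intervals \<open>[n h, (n + 1) h]\<close>. They are
independent, centred and Gaussian, and \<open>S_f(\<epsilon>, h)\<close> is the sum of the probabilities that the \<open>n\<close>-th of them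
is at least \<open>\<epsilon> f(a(n h))\<close>.

If some \<open>S_f(\<epsilon>, h)\<close> diverges, then by the second Borel-Cantelli lemma almost surely infinitely many increments
reach \<open>\<epsilon> f(a(n h))\<close> (\<open>increments_infinitely_often\<close>). On the event \<open>A\<close> this is impossible: there
\<open>X(t) \<sim> \<lambda> a(t)\<close>, so by regular variation the drift contributes \<open>- \<lambda> h f(a(t))\<close> to \<open>X(t + h) - X(t)\<close>
up to \<open>o(f(a(t)))\<close>, which is already the whole increment on \<open>A\<close>
(\<open>integral_path_noise_increment\<close>). Hence \<open>A\<close> has probability zero.

If all \<open>S_f(\<epsilon>, h)\<close> converge, Levy's maximal inequality bounds the tails of the oscillation of \<open>J\<close> over the
intervals by multiples of the tails of the increments, and the first Borel-Cantelli lemma makes the oscillation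
\<open>o(f(a(n h)))\<close> almost surely (\<open>oscillation_borel_cantelli\<close>). From here on the argument is pathwise. Since
\<open>\<Sum>f(a(n h))\<close> is comparable with the telescoping sum of \<open>a(n h) - a((n + 1) h)\<close>, the path of \<open>J\<close>
converges, and its difference \<open>\<delta>(t)\<close> from the limit is \<open>o(a(t))\<close> (\<open>noise_limit\<close>). Thus \<open>y = X - \<delta>\<close> is
a differentiable solution of \<open>y' = - f(y + \<delta>)\<close>. The ratio \<open>z = y / a\<close> satisfies
\<open>z' = (f(a) / a) (z - f(a (z + \<delta> / a)) / f(a))\<close>,
and regular variation turns this, in the time scale \<open>- ln a\<close>, into an asymptotically autonomous scalar equation
with vector field \<open>z - sgn z * \<bar>z\<bar> powr \<beta>\<close>. A level at which this field is nonzero can eventually be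
crossed in one direction only, so \<open>z\<close> has a limit, possibly infinite; superlinear growth excludes an infinite
limit, and a finite one must be a zero of the field, that is one of \<open>-1, 0, 1\<close>
(\<open>perturbed_ode_ratio_limit\<close>).

Independence and normality of the increments of \<open>J\<close> come from the isometry for step processes, which
identifies \<open>J\<close> with the mean square limit of sums of Brownian increments with deterministic weights, whose
characteristic functions on events of the past are explicit (\<open>J_increment_law\<close>).\<close>

section \<open>Regular variation: local uniformity and Potter bounds\<close>

text \<open>The uniform convergence theorem for slowly varying functions, in additive form. The closed sets of
those shifts \<open>u\<close> for which the increment is small beyond \<open>n\<close> cover the line, so by Baire's theorem one of
them contains an interval, and differences of shifts from that interval fill a neighbourhood of zero.\<close>

lemma uniform_additive_convergence:
  fixes k :: "real \<Rightarrow> real"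
  assumes cont: "continuous_on UNIV k"
    and lim: "\<And>u. ((\<lambda>x. k (x + u) - k x) \<longlongrightarrow> 0) at_top"
    and "\<epsilon> > 0"
  obtains \<delta> X where "\<delta> > 0" "\<And>x v. x \<ge> X \<Longrightarrow> \<bar>v\<bar> \<le> \<delta> \<Longrightarrow> \<bar>k (x + v) - k x\<bar> \<le> \<epsilon>"
proof -
  define E where "E n = {u. \<forall>x\<ge>real n. \<bar>k (x + u) - k x\<bar> \<le> \<epsilon> / 2}" for n
  have closed: "closed (E n)" for n
  proof -
    have "E n = (\<Inter>x\<in>{real n..}. {u. \<bar>k (x + u) - k x\<bar> \<le> \<epsilon> / 2})"
      by (auto simp: E_def)
    moreover have "closed {u. \<bar>k (x + u) - k x\<bar> \<le> \<epsilon> / 2}" for x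
      by (intro closed_Collect_le continuous_intros continuous_on_compose2[OF cont]) auto
    ultimately show ?thesis by auto
  qed
  have cover: "(\<Union>n. E n) = UNIV"
  proof -
    have "\<exists>n. u \<in> E n" for u
    proof -
      have "\<forall>\<^sub>F x in at_top. \<bar>k (x + u) - k x\<bar> < \<epsilon> / 2"
        using tendstoD[OF lim, of "\<epsilon> / 2"] \<open>\<epsilon> > 0\<close> by (simp add: dist_real_def)
      then obtain X where X: "\<And>x. x \<ge> X \<Longrightarrow> \<bar>k (x + u) - k x\<bar> < \<epsilon> / 2"
        unfolding eventually_at_top_linorder by blast
      obtain n :: nat where "X \<le> real n" using real_arch_simple by blast
      then have "u \<in> E n" unfolding E_def using X by (auto intro: less_imp_le)
      then show ?thesis ..
    qed
    then show ?thesis by auto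
  qed
  have "\<exists>n. interior (E n) \<noteq> {}"
  proof (rule ccontr)
    assume "\<not> ?thesis"
    then have "euclidean interior_of \<Union>(range E) = {}"
      using closed by (intro Baire_category_alt) (auto simp: completely_metrizable_space_euclidean)
    with cover show False by simp
  qed
  then obtain n c where "c \<in> interior (E n)" by blast
  then obtain d where d: "d > 0" "cball c d \<subseteq> E n"
    unfolding mem_interior_cball by blast
  show thesis
  proof (rule that[OF \<open>d > 0\<close>, of "real n + c"])
    fix x v :: real assume x: "real n + c \<le> x" and v: "\<bar>v\<bar> \<le> d"
    have "c + v \<in> E n" "c \<in> E n"
      using d v by (auto simp: dist_real_def subset_eq)
    then have "\<forall>y\<ge>real n. \<bar>k (y + (c + v)) - k y\<bar> \<le> \<epsilon> / 2" "\<forall>y\<ge>real n. \<bar>k (y + c) - k y\<bar> \<le> \<epsilon> / 2"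
      unfolding E_def by blast+
    from this[THEN spec, of "x - c"] x have "\<bar>k (x + v) - k (x - c)\<bar> \<le> \<epsilon> / 2" "\<bar>k x - k (x - c)\<bar> \<le> \<epsilon> / 2"
      by (simp_all add: algebra_simps)
    then show "\<bar>k (x + v) - k x\<bar> \<le> \<epsilon>" by linarith
  qed
qed

locale regular_variation =
  fixes f :: "real \<Rightarrow> real" and \<beta> :: real
  assumes continuous_f: "continuous_on {0<..} f"
    and rv: "regularly_varying_0 f \<beta>"
begin

lemma f_pos: "x > 0 \<Longrightarrow> f x > 0"
  using rv unfolding regularly_varying_0_def by blast

text \<open>With \<open>x = - ln a\<close> and \<open>a powr \<beta>\<close> divided out, regular variation of \<open>f\<close> at zero says
that the increments of this function over any fixed distance vanish at infinity.\<close>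

definition log_scale :: "real \<Rightarrow> real" where
  "log_scale x = ln (f (exp (- x))) + \<beta> * x"

lemma f_ratio: 
  assumes "a > 0" "u > 0"
  shows "f (a * u) / f a = exp (log_scale (- ln a + - ln u) - log_scale (- ln a)) * u powr \<beta>"
proof -
  have "exp (ln a + ln u) = a * u" using assms by (simp add: exp_add)
  then have "log_scale (- ln a + - ln u) - log_scale (- ln a) = ln (f (a * u)) - ln (f a) - \<beta> * ln u"
    using assms unfolding log_scale_def by (simp add: algebra_simps)
  then show ?thesis
    using assms f_pos[of a] f_pos[of "a * u"] by (simp add: exp_diff powr_def)
qed

lemma continuous_log_scale: "continuous_on UNIV log_scale"
  unfolding log_scale_def
  using f_pos[OF exp_gt_zero]
  by (intro continuous_intros continuous_on_compose2[OF continuous_f]) (auto simp: less_imp_neq[THEN not_sym])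

lemma log_scale_increment: "((\<lambda>x. log_scale (x + u) - log_scale x) \<longlongrightarrow> 0) at_top"
proof -
  have lim: "((\<lambda>x. f (exp (- u) * x) / f x) \<longlongrightarrow> exp (- u) powr \<beta>) (at_right 0)"
    using rv unfolding regularly_varying_0_def by simp
  have "filterlim (\<lambda>x::real. exp (- x)) (at_right 0) at_top"
    by (auto simp: filterlim_at intro!: eventuallyI filterlim_compose[OF exp_at_bot] filterlim_uminus_at_bot_at_top)
  from filterlim_compose[OF lim this]
  have "((\<lambda>x. f (exp (- x) * exp (- u)) / f (exp (- x))) \<longlongrightarrow> exp (- u) powr \<beta>) at_top"
    by (simp add: mult.commute)
  then have "((\<lambda>x. exp (log_scale (x + u) - log_scale x) * exp (- u) powr \<beta>) \<longlongrightarrow> exp (- u) powr \<beta>) at_top"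
    by (simp add: f_ratio)
  then have "((\<lambda>x. exp (log_scale (x + u) - log_scale x) * exp (- u) powr \<beta> / exp (- u) powr \<beta>) 
      \<longlongrightarrow> exp (- u) powr \<beta> / exp (- u) powr \<beta>) at_top"
    by (rule tendsto_divide) auto
  then have "((\<lambda>x. ln (exp (log_scale (x + u) - log_scale x))) \<longlongrightarrow> ln 1) at_top"
    by (intro tendsto_ln) auto
  then show ?thesis by simp
qed

text \<open>Regular variation along moving arguments: the multiplier \<open>u\<close> may itself vary, which is where local
uniformity is needed.\<close>

lemma f_ratio_tendsto_pos:
  assumes a: "filterlim a (at_right 0) F" and u: "(u \<longlongrightarrow> c) F" and "c > 0"
  shows "((\<lambda>t. f (a t * u t) / f (a t)) \<longlongrightarrow> c powr \<beta>) F"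
proof -
  define x where "x t = - ln (a t)" for t
  have x: "filterlim x at_top F"
    unfolding x_def filterlim_uminus_at_top[symmetric] 
    using filterlim_compose[OF ln_at_0 a] by (simp add: filterlim_uminus_at_top)
  have lnu: "((\<lambda>t. ln c - ln (u t)) \<longlongrightarrow> 0) F"
    using tendsto_diff[OF tendsto_const tendsto_ln[OF u], of "ln c"] \<open>c > 0\<close> by simp
  have 1: "((\<lambda>t. log_scale (x t - ln c) - log_scale (x t)) \<longlongrightarrow> 0) F"
    using filterlim_compose[OF log_scale_increment[of "- ln c"] x] by simp
  have 2: "((\<lambda>t. log_scale (x t - ln c + (ln c - ln (u t))) - log_scale (x t - ln c)) \<longlongrightarrow> 0) F"
  proof (rule tendstoI)
    fix e :: real assume "e > 0"
    from uniform_additive_convergence[OF continuous_log_scale log_scale_increment, of "e / 2"]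
    obtain d X where d: "d > 0" 
      "\<And>x v. x \<ge> X \<Longrightarrow> \<bar>v\<bar> \<le> d \<Longrightarrow> \<bar>log_scale (x + v) - log_scale x\<bar> \<le> e / 2"
      using \<open>e > 0\<close> by (metis half_gt_zero)
    have "\<forall>\<^sub>F t in F. x t \<ge> X + ln c" using x by (simp add: filterlim_at_top)
    moreover have "\<forall>\<^sub>F t in F. \<bar>ln c - ln (u t)\<bar> < d"
      using tendstoD[OF lnu \<open>d > 0\<close>] by (simp add: dist_real_def)
    ultimately show "\<forall>\<^sub>F t in F. dist (log_scale (x t - ln c + (ln c - ln (u t))) - log_scale (x t - ln c)) 0 < e"
    proof eventually_elim
      case (elim t)
      then show ?case using d(2)[of "x t - ln c" "ln c - ln (u t)"] \<open>e > 0\<close> by (simp add: dist_real_def)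
    qed
  qed
  have "((\<lambda>t. exp (log_scale (x t - ln (u t)) - log_scale (x t)) * u t powr \<beta>) \<longlongrightarrow> exp 0 * c powr \<beta>) F"
    using tendsto_add[OF 1 2] \<open>c > 0\<close> by (intro tendsto_intros u) auto
  moreover have "\<forall>\<^sub>F t in F. exp (log_scale (x t - ln (u t)) - log_scale (x t)) * u t powr \<beta> 
      = f (a t * u t) / f (a t)"
  proof -
    have "\<forall>\<^sub>F t in F. a t > 0" using a by (auto simp: filterlim_at eventually_conj_iff)
    moreover have "\<forall>\<^sub>F t in F. u t > 0" using order_tendstoD(1)[OF u \<open>c > 0\<close>] .
    ultimately show ?thesis by eventually_elim (simp add: f_ratio x_def)
  qed
  ultimately show ?thesis by (simp add: tendsto_cong)
qed

text \<open>Steps of a fixed length \<open>d\<close> change \<open>log_scale\<close> by at most \<open>\<eta> d\<close> each, and the remainder of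
length below \<open>d\<close> by at most 1, which becomes the constant \<open>exp 1\<close>. Unlike the previous lemma this controls
\<open>f(a u) / f(a)\<close> uniformly down to \<open>u = 0\<close>.\<close>

lemma potter_bound:
  assumes "\<eta> > 0"
  obtains a0 where "a0 > 0" 
    "\<And>a u. 0 < a \<Longrightarrow> a < a0 \<Longrightarrow> 0 < u \<Longrightarrow> u \<le> 1 \<Longrightarrow> f (a * u) \<le> exp 1 * u powr (\<beta> - \<eta>) * f a"
proof -
  obtain d X where d: "d > 0" 
    "\<And>x v. x \<ge> X \<Longrightarrow> \<bar>v\<bar> \<le> d \<Longrightarrow> \<bar>log_scale (x + v) - log_scale x\<bar> \<le> 1"
    using uniform_additive_convergence[OF continuous_log_scale log_scale_increment, of 1] by (metis zero_less_one)
  have "\<forall>\<^sub>F x in at_top. \<bar>log_scale (x + d) - log_scale x\<bar> < \<eta> * d"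
    using tendstoD[OF log_scale_increment[of d], of "\<eta> * d"] assms \<open>d > 0\<close> by (simp add: dist_real_def)
  then obtain Y where Y: "\<And>x. x \<ge> Y \<Longrightarrow> \<bar>log_scale (x + d) - log_scale x\<bar> < \<eta> * d"
    unfolding eventually_at_top_linorder by blast
  have step: "log_scale (x + real n * d) - log_scale x \<le> real n * (\<eta> * d)" if "x \<ge> Y" for x n
  proof (induction n)
    case (Suc n)
    have "x + real n * d \<ge> Y" using that \<open>d > 0\<close> by (simp add: add_increasing2)
    from Y[OF this] have "log_scale (x + real n * d + d) - log_scale (x + real n * d) \<le> \<eta> * d" by linarith
    with Suc show ?case by (simp add: algebra_simps)
  qed simp
  have main: "log_scale (x + w) - log_scale x \<le> \<eta> * w + 1" if "x \<ge> max X Y" "w \<ge> 0" for x w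
  proof -
    define n where "n = nat \<lfloor>w / d\<rfloor>"
    have n: "real n * d \<le> w" "w < real n * d + d"
    proof -
      have "real n \<le> w / d" "w / d < real n + 1" unfolding n_def using that \<open>d > 0\<close>
        by (auto simp: of_nat_nat) 
      then show "real n * d \<le> w" "w < real n * d + d" using \<open>d > 0\<close>
        by (simp_all add: field_simps)
    qed
    have "log_scale (x + real n * d + (w - real n * d)) - log_scale (x + real n * d) \<le> 1"
      using d(2)[of "x + real n * d" "w - real n * d"] n that \<open>d > 0\<close> by (simp add: add_increasing2)
    moreover have "real n * (\<eta> * d) \<le> \<eta> * w"
      using mult_left_mono[OF n(1), of \<eta>] assms by (simp add: algebra_simps)
    ultimately show ?thesis using step[of x n] that by simp
  qed
  show thesis
  proof (rule that[of "exp (- max X Y)"])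
    fix a u :: real assume a: "0 < a" "a < exp (- max X Y)" and u: "0 < u" "u \<le> 1"
    have "ln a < - max X Y" using a by (metis ln_exp ln_less_cancel_iff exp_gt_zero)
    then have "log_scale (- ln a + - ln u) - log_scale (- ln a) \<le> \<eta> * (- ln u) + 1"
      using u by (intro main) auto
    then have "f (a * u) / f a \<le> exp (\<eta> * (- ln u) + 1) * u powr \<beta>"
      unfolding f_ratio[OF a(1) u(1)] by (intro mult_right_mono) auto
    also have "\<dots> = exp 1 * u powr (\<beta> - \<eta>)"
      using u by (simp add: powr_def exp_add[symmetric] algebra_simps)
    finally show "f (a * u) \<le> exp 1 * u powr (\<beta> - \<eta>) * f a"
      using f_pos[OF a(1)] by (simp add: field_simps)
  qed simp
qed

end

locale odd_regular_variation = regular_variation +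
  assumes zero: "f 0 = 0"
    and beta: "\<beta> > 1"
    and odd_ratio: "((\<lambda>x. f (- x) / f x) \<longlongrightarrow> -1) (at_right 0)"
begin

text \<open>The odd extension of the power function, the limit of \<open>f(a c) / f(a)\<close> for real \<open>c\<close> of either
sign.\<close>

definition spow :: "real \<Rightarrow> real" where
  "spow c = sgn c * \<bar>c\<bar> powr \<beta>"

lemma f_ratio_tendsto_neg:
  assumes a: "filterlim a (at_right 0) F" and u: "(u \<longlongrightarrow> c) F" and "c < 0"
  shows "((\<lambda>t. f (a t * u t) / f (a t)) \<longlongrightarrow> - (\<bar>c\<bar> powr \<beta>)) F"
proof -
  have apos: "\<forall>\<^sub>F t in F. a t > 0" using a by (auto simp: filterlim_at eventually_conj_iff)
  have upos: "\<forall>\<^sub>F t in F. u t < 0" using order_tendstoD(2)[OF u \<open>c < 0\<close>] .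
  have a0: "(a \<longlongrightarrow> 0) F" using a by (auto simp: filterlim_at)
  have "filterlim (\<lambda>t. a t * - u t) (at_right 0) F"
    unfolding filterlim_at
  proof
    show "\<forall>\<^sub>F t in F. a t * - u t \<in> {0<..} \<and> a t * - u t \<noteq> 0"
      using apos upos by eventually_elim (simp add: mult_pos_neg)
    show "((\<lambda>t. a t * - u t) \<longlongrightarrow> 0) F"
      using tendsto_mult[OF a0 tendsto_minus[OF u]] by simp
  qed
  from filterlim_compose[OF odd_ratio this]
  have "((\<lambda>t. f (a t * u t) / f (a t * - u t) * (f (a t * - u t) / f (a t))) \<longlongrightarrow> -1 * \<bar>c\<bar> powr \<beta>) F"
    using f_ratio_tendsto_pos[OF a tendsto_minus[OF u]] \<open>c < 0\<close> by (intro tendsto_mult) auto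
  moreover have "\<forall>\<^sub>F t in F. f (a t * u t) / f (a t * - u t) * (f (a t * - u t) / f (a t)) = f (a t * u t) / f (a t)"
    using apos upos
  proof eventually_elim
    case (elim t)
    have "f (a t * - u t) > 0" by (rule f_pos) (use elim in \<open>auto simp: mult_pos_neg\<close>)
    then show ?case by simp
  qed
  ultimately show ?thesis by (simp only: mult_minus1) (rule Lim_transform_eventually)
qed

text \<open>Asymptotic oddness makes the values of \<open>f\<close> at \<open>x\<close> and \<open>\<bar>x\<bar>\<close> comparable, so that
bounds on the positive side carry over.\<close>

lemma f_abs_bound:
  obtains x0 where "x0 > 0" "\<And>x. \<bar>x\<bar> < x0 \<Longrightarrow> x \<noteq> 0 \<Longrightarrow> \<bar>f x\<bar> \<le> 2 * f \<bar>x\<bar> \<and> f \<bar>x\<bar> \<le> 2 * (sgn x * f x)"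
proof -
  have "\<forall>\<^sub>F x in at_right 0. dist (f (- x) / f x) (-1) < 1 / 2"
    using tendstoD[OF odd_ratio, of "1/2"] by simp
  then obtain b where b: "b > 0" "\<And>x. 0 < x \<Longrightarrow> x < b \<Longrightarrow> dist (f (- x) / f x) (-1) < 1 / 2"
    unfolding eventually_at_right_field by auto
  show thesis
  proof (rule that[OF \<open>b > 0\<close>])
    fix x assume x: "\<bar>x\<bar> < b" "x \<noteq> 0"
    show "\<bar>f x\<bar> \<le> 2 * f \<bar>x\<bar> \<and> f \<bar>x\<bar> \<le> 2 * (sgn x * f x)"
    proof (cases "x > 0")
      case True
      then show ?thesis using f_pos[of x] by simp
    next
      case False
      then have "- x > 0" using x by simp
      have "dist (f x / f (- x)) (-1) < 1 / 2" using b(2)[of "- x"] x \<open>- x > 0\<close> by simp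
      then have "\<bar>f x / f (- x) + 1\<bar> < 1 / 2" by (simp add: dist_real_def)
      then have "- 3 / 2 < f x / f (- x)" "f x / f (- x) < - 1 / 2" by linarith+
      then have "- 3 / 2 * f (- x) < f x" "f x < - 1 / 2 * f (- x)" 
        using f_pos[OF \<open>- x > 0\<close>] by (simp_all add: field_simps)
      then show ?thesis using \<open>- x > 0\<close> f_pos[OF \<open>- x > 0\<close>] by (auto simp: sgn_if abs_if)
    qed
  qed
qed

lemma f_ratio_tendsto_zero:
  assumes a: "filterlim a (at_right 0) F" and u: "(u \<longlongrightarrow> 0) F"
  shows "((\<lambda>t. f (a t * u t) / f (a t)) \<longlongrightarrow> 0) F"
proof -
  obtain x0 where x0: "x0 > 0" "\<And>x. \<bar>x\<bar> < x0 \<Longrightarrow> x \<noteq> 0 \<Longrightarrow> \<bar>f x\<bar> \<le> 2 * f \<bar>x\<bar>"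
    using f_abs_bound by metis
  obtain a0 where a0: "a0 > 0" 
    "\<And>a u. 0 < a \<Longrightarrow> a < a0 \<Longrightarrow> 0 < u \<Longrightarrow> u \<le> 1 \<Longrightarrow> f (a * u) \<le> exp 1 * u powr (\<beta> - 1) * f a"
    using potter_bound[of 1] by (metis zero_less_one)
  have apos: "\<forall>\<^sub>F t in F. a t > 0" using a by (auto simp: filterlim_at eventually_conj_iff)
  have al: "(a \<longlongrightarrow> 0) F" using a by (auto simp: filterlim_at)
  have asm: "\<forall>\<^sub>F t in F. a t < min a0 x0" 
    by (rule order_tendstoD(2)[OF al]) (use x0 a0 in auto)
  have usm: "\<forall>\<^sub>F t in F. \<bar>u t\<bar> < 1" using tendstoD[OF u, of 1] by (simp add: dist_real_def)
  have "\<forall>\<^sub>F t in F. norm (f (a t * u t) / f (a t)) \<le> 2 * exp 1 * \<bar>u t\<bar> powr (\<beta> - 1)"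
    using apos asm usm
  proof eventually_elim
    case (elim t)
    show ?case
    proof (cases "u t = 0")
      case True then show ?thesis using zero by simp
    next
      case False
      have "\<bar>a t * u t\<bar> < x0" using elim mult_strict_mono[of "a t" x0 "\<bar>u t\<bar>" 1] x0 by (simp add: abs_mult)
      then have "\<bar>f (a t * u t)\<bar> \<le> 2 * f \<bar>a t * u t\<bar>" using x0 False elim by auto
      also have "\<bar>a t * u t\<bar> = a t * \<bar>u t\<bar>" using elim by (simp add: abs_mult)
      also have "f (a t * \<bar>u t\<bar>) \<le> exp 1 * \<bar>u t\<bar> powr (\<beta> - 1) * f (a t)"
        using a0(2)[of "a t" "\<bar>u t\<bar>"] elim False by auto
      finally show ?thesis using f_pos[of "a t"] elim by (simp add: field_simps)
    qed
  qed
  moreover have "((\<lambda>t. 2 * exp 1 * \<bar>u t\<bar> powr (\<beta> - 1)) \<longlongrightarrow> 0) F"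
    using beta u by (auto intro!: tendsto_mult_right_zero tendsto_zero_powrI[where b="\<beta> - 1"] tendsto_rabs_zero)
  ultimately show ?thesis by (rule Lim_null_comparison)
qed

lemma f_ratio_tendsto:
  assumes "filterlim a (at_right 0) F" and "(u \<longlongrightarrow> c) F"
  shows "((\<lambda>t. f (a t * u t) / f (a t)) \<longlongrightarrow> spow c) F"
  using f_ratio_tendsto_pos[OF assms] f_ratio_tendsto_neg[OF assms] f_ratio_tendsto_zero[OF assms(1)] assms(2)
  by (cases c "0 :: real" rule: linorder_cases) (auto simp: spow_def)

text \<open>Potter's bound read backwards, from the larger argument \<open>a \<bar>v\<bar>\<close> to the smaller one \<open>a\<close>. As
\<open>\<beta> > 1\<close>, it makes \<open>f(a v) / f(a)\<close> grow faster than \<open>v\<close>, as long as \<open>a v\<close> stays near zero.\<close>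

lemma f_ratio_superlinear:
  obtains x0 K where "x0 > 0" "K > 0"
    "\<And>a v. a > 0 \<Longrightarrow> \<bar>v\<bar> \<ge> K \<Longrightarrow> a * \<bar>v\<bar> < x0 \<Longrightarrow> f (a * v) / f a * sgn v \<ge> 4 * \<bar>v\<bar>"
proof -
  obtain x0 where x0: "x0 > 0" "\<And>x. \<bar>x\<bar> < x0 \<Longrightarrow> x \<noteq> 0 \<Longrightarrow> f \<bar>x\<bar> \<le> 2 * (sgn x * f x)"
    using f_abs_bound by metis
  \<comment> \<open>Half of the excess of the index over 1 is given away in the Potter bound, the other half yields growth.\<close>
  define \<eta> where "\<eta> = (\<beta> - 1) / 2"
  have "\<eta> > 0" using beta by (simp add: \<eta>_def)
  obtain a0 where a0: "a0 > 0" 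
    "\<And>a u. 0 < a \<Longrightarrow> a < a0 \<Longrightarrow> 0 < u \<Longrightarrow> u \<le> 1 \<Longrightarrow> f (a * u) \<le> exp 1 * u powr (\<beta> - \<eta>) * f a"
    using potter_bound[OF \<open>\<eta> > 0\<close>] by metis
  have "filterlim (\<lambda>v::real. v powr \<eta>) at_top at_top" using \<open>\<eta> > 0\<close>
    by real_asymp
  then have "\<forall>\<^sub>F v :: real in at_top. v powr \<eta> \<ge> 8 * exp 1" by (simp add: filterlim_at_top)
  then obtain K where K: "\<And>v::real. v \<ge> K \<Longrightarrow> v powr \<eta> \<ge> 8 * exp 1" 
    unfolding eventually_at_top_linorder by blast
  show thesis
  proof (rule that[of "min x0 a0" "max 1 K"])
    fix a v :: real assume av: "a > 0" "\<bar>v\<bar> \<ge> max 1 K" "a * \<bar>v\<bar> < min x0 a0"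
    have v1: "\<bar>v\<bar> \<ge> 1" "v \<noteq> 0" using av by auto
    have "f (a * \<bar>v\<bar> * (1 / \<bar>v\<bar>)) \<le> exp 1 * (1 / \<bar>v\<bar>) powr (\<beta> - \<eta>) * f (a * \<bar>v\<bar>)"
      using av v1 by (intro a0(2)) auto
    then have "f a \<le> exp 1 * (1 / \<bar>v\<bar>) powr (\<beta> - \<eta>) * f (a * \<bar>v\<bar>)" using v1 by simp
    also have "(1 / \<bar>v\<bar>) powr (\<beta> - \<eta>) = 1 / (\<bar>v\<bar> * \<bar>v\<bar> powr \<eta>)"
    proof -
      have "\<beta> - \<eta> = 1 + \<eta>" by (simp add: \<eta>_def field_simps)
      then show ?thesis using v1 by (simp add: powr_divide powr_add)
    qed
    finally have "f a * (\<bar>v\<bar> * \<bar>v\<bar> powr \<eta>) \<le> exp 1 * f (a * \<bar>v\<bar>)"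
      using v1 by (simp add: field_simps)
    moreover have "f a * (\<bar>v\<bar> * (8 * exp 1)) \<le> f a * (\<bar>v\<bar> * \<bar>v\<bar> powr \<eta>)"
      using K[of "\<bar>v\<bar>"] av f_pos[of a] by (intro mult_left_mono) auto
    ultimately have "f a * (\<bar>v\<bar> * (8 * exp 1)) \<le> exp 1 * f (a * \<bar>v\<bar>)" by (rule order_trans[rotated])
    moreover have "f a * (\<bar>v\<bar> * (8 * exp 1)) = exp 1 * (f a * \<bar>v\<bar> * 8)" by simp
    ultimately have "exp 1 * (f a * \<bar>v\<bar> * 8) \<le> exp 1 * f (a * \<bar>v\<bar>)" by simp
    then have "f a * \<bar>v\<bar> * 8 \<le> f \<bar>a * v\<bar>" using av by (simp add: abs_mult)
    also have "\<dots> \<le> 2 * (sgn (a * v) * f (a * v))"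
      using x0(2)[of "a * v"] av v1 by (auto simp: abs_mult)
    also have "sgn (a * v) = sgn v" using av by (simp add: sgn_mult)
    finally show "f (a * v) / f a * sgn v \<ge> 4 * \<bar>v\<bar>"
      using f_pos[of a] av by (simp add: field_simps)
  qed (use x0 a0 in auto)
qed

end

section \<open>The decay rate of the unperturbed equation\<close>

locale decay_rate = odd_regular_variation +
  assumes continuous: "continuous_on UNIV f"
    and sign: "\<And>x. x \<noteq> 0 \<Longrightarrow> x * f x > 0"
    and sublinear: "((\<lambda>x. f x / x) \<longlongrightarrow> 0) (at_right 0)"
begin

abbreviation rate :: "real \<Rightarrow> real" where "rate \<equiv> F_inv f"

lemma F_fun_deriv:
  assumes "x > 0"
  shows "(F_fun f has_real_derivative - (1 / f x)) (at x)"
proof -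
  define a b where "a = min x 1 / 2" and "b = max x 1 + 1"
  have ab: "0 < a" "a < x" "x < b" "a \<le> 1" "1 \<le> b" using assms by (auto simp: a_def b_def min_def max_def)
  have "continuous_on {a..b} (\<lambda>u. 1 / f u)"
    using ab f_pos by (intro continuous_intros continuous_on_subset[OF continuous]) (auto simp: less_imp_neq[THEN not_sym])
  then have "((\<lambda>u. LBINT y=ereal 1..ereal u. 1 / f y) has_vector_derivative 1 / f x) (at x within {a..b})"
    using ab by (intro interval_integral_FTC2) auto
  then have "((\<lambda>u. LBINT y=ereal 1..ereal u. 1 / f y) has_real_derivative 1 / f x) (at x)"
    using ab at_within_Icc_at[of a x b] by (simp add: has_real_derivative_iff_has_vector_derivative)
  then have "((\<lambda>u. - (LBINT y=ereal 1..ereal u. 1 / f y)) has_real_derivative - (1 / f x)) (at x)"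
    by (rule DERIV_minus)
  moreover have "(\<lambda>u. - (LBINT y=ereal 1..ereal u. 1 / f y)) = F_fun f"
    unfolding F_fun_def by (subst interval_integral_endpoints_reverse) simp
  ultimately show ?thesis by simp
qed

lemma F_fun_decreasing:
  assumes "0 < x" "x < y" shows "F_fun f y < F_fun f x"
proof (rule DERIV_neg_imp_decreasing[where f = "F_fun f", OF \<open>x < y\<close>])
  fix z assume "x \<le> z"
  then have "z > 0" using assms by simp
  then show "\<exists>d. (F_fun f has_real_derivative d) (at z) \<and> d < 0"
    using F_fun_deriv f_pos by (intro exI[of _ "- (1 / f z)"]) auto
qed

lemma F_fun_inj: "inj_on (F_fun f) {0<..}"
  by (rule linorder_inj_onI) (use F_fun_decreasing in \<open>force+\<close>)

text \<open>Near zero \<open>f u \<le> u\<close>, so \<open>F\<close> grows at least like \<open>- ln\<close> there.\<close>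

lemma F_fun_unbounded:
  obtains x where "0 < x" "x < 1" "F_fun f x \<ge> t"
proof -
  have "\<forall>\<^sub>F x in at_right 0. dist (f x / x) 0 < 1" by (rule tendstoD[OF sublinear]) simp
  then obtain b where b: "b > 0" "\<And>x. 0 < x \<Longrightarrow> x < b \<Longrightarrow> dist (f x / x) 0 < 1"
    unfolding eventually_at_right_field by auto
  define c where "c = min (b / 2) (1 / 2)"
  have c: "0 < c" "c < b" "c < 1" using b by (auto simp: c_def)
  have le: "f x \<le> x" if "0 < x" "x < b" for x
    using b(2)[OF that] that f_pos[of x] by (simp add: dist_real_def field_simps)
  have grow: "F_fun f c + ln c \<le> F_fun f x + ln x" if "0 < x" "x \<le> c" for x
  proof (rule DERIV_nonpos_imp_nonincreasing[OF \<open>x \<le> c\<close>])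
    fix y assume "x \<le> y" "y \<le> c"
    then have y: "0 < y" "y < b" using that c by auto
    have "((\<lambda>x. F_fun f x + ln x) has_real_derivative - (1 / f y) + 1 / y) (at y)"
      by (intro DERIV_add F_fun_deriv DERIV_ln_divide y)
    moreover have "- (1 / f y) + 1 / y \<le> 0" using le[OF y] f_pos[OF y(1)] y by (simp add: frac_le)
    ultimately show "\<exists>z. ((\<lambda>x. F_fun f x + ln x) has_real_derivative z) (at y) \<and> z \<le> 0" by blast
  qed
  define x where "x = min c (exp (F_fun f c + ln c - t))"
  have x: "0 < x" "x \<le> c" using c by (auto simp: x_def)
  have "ln x \<le> F_fun f c + ln c - t"
    using x by (metis exp_gt_zero ln_exp ln_le_cancel_iff min.cobounded2 x_def)
  then have "t \<le> F_fun f x" using grow[OF x] by simp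
  with x c show thesis by (intro that[of x]) auto
qed

lemma F_inv_F_fun: "x > 0 \<Longrightarrow> rate (F_fun f x) = x"
  unfolding F_inv_def by (rule inv_into_f_f[OF F_fun_inj]) auto

lemma F_fun_1: "F_fun f 1 = 0"
  unfolding F_fun_def by (simp add: interval_lebesgue_integral_def einterval_same set_lebesgue_integral_def)

lemma F_fun_onto:
  assumes "t \<ge> 0" shows "t \<in> F_fun f ` {0<..}"
proof -
  obtain x where x: "0 < x" "x < 1" "F_fun f x \<ge> t" by (rule F_fun_unbounded)
  have "continuous_on {x..1} (F_fun f)"
    using x by (auto intro!: continuous_at_imp_continuous_on DERIV_isCont[OF F_fun_deriv])
  then obtain y where "x \<le> y" "y \<le> 1" "F_fun f y = t"
    using IVT2'[of "F_fun f" 1 t x] x assms F_fun_1 by auto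
  then show ?thesis using x by force
qed

lemma rate_pos: "t \<ge> 0 \<Longrightarrow> rate t > 0"
  using inv_into_into[OF F_fun_onto] unfolding F_inv_def by fastforce

lemma F_fun_rate: "t \<ge> 0 \<Longrightarrow> F_fun f (rate t) = t"
  unfolding F_inv_def by (rule f_inv_into_f[OF F_fun_onto])

lemma rate_decreasing: "0 \<le> s \<Longrightarrow> s \<le> t \<Longrightarrow> rate t \<le> rate s"
  by (metis F_fun_decreasing F_fun_rate leD leI order_trans rate_pos)

lemma rate_deriv:
  assumes "t > 0"
  shows "(rate has_real_derivative - f (rate t)) (at t)"
proof -
  have r: "rate t > 0" using assms rate_pos by simp
  have "isCont rate (F_fun f (rate t))"
  proof (rule isCont_inverse_function[where d = "rate t / 2" and f = "F_fun f" and x = "rate t"])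
    fix z assume "\<bar>z - rate t\<bar> \<le> rate t / 2"
    then have "z > 0" using r by linarith
    then show "rate (F_fun f z) = z" "isCont (F_fun f) z"
      by (auto intro: F_inv_F_fun DERIV_isCont[OF F_fun_deriv])
  qed (use r in simp)
  then have "isCont rate t" using F_fun_rate assms by simp
  then have "(rate has_real_derivative inverse (- (1 / f (rate t)))) (at t)"
    using assms r f_pos[OF r] F_fun_rate
    by (intro DERIV_inverse_function[OF F_fun_deriv, where a = 0 and b = "t + 1"]) auto
  then show ?thesis by simp
qed

lemma rate_at_right_0: "filterlim rate (at_right 0) at_top"
  unfolding filterlim_at
proof
  show "\<forall>\<^sub>F t in at_top. rate t \<in> {0<..} \<and> rate t \<noteq> 0"
    using eventually_ge_at_top[of "0::real"] by eventually_elim (use rate_pos in force)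
  show "(rate \<longlongrightarrow> 0) at_top"
  proof (rule order_tendstoI)
    fix e :: real assume "e < 0"
    show "\<forall>\<^sub>F t in at_top. e < rate t"
      using eventually_ge_at_top[of "0::real"] by eventually_elim (use rate_pos \<open>e < 0\<close> in force)
  next
    fix e :: real assume "0 < e"
    have "rate t < e" if "t > max 0 (F_fun f e)" for t
      using that F_fun_decreasing[of e "rate t"] F_fun_rate[of t] \<open>0 < e\<close> 
      by (cases "rate t" e rule: linorder_cases) auto
    then show "\<forall>\<^sub>F t in at_top. rate t < e"
      unfolding eventually_at_top_dense by blast
  qed
qed

lemma rate_log_deriv_tendsto: "((\<lambda>t. f (rate t) / rate t) \<longlongrightarrow> 0) at_top"
  by (rule filterlim_compose[OF sublinear rate_at_right_0])

lemma rate_log_increment: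
  assumes "0 < s" "s \<le> t" and c: "\<And>u. s \<le> u \<Longrightarrow> u \<le> t \<Longrightarrow> f (rate u) / rate u \<le> c"
  shows "ln (rate s) - ln (rate t) \<le> c * (t - s)"
proof -
  have "ln (rate s) + c * s \<le> ln (rate t) + c * t"
  proof (rule DERIV_nonneg_imp_nondecreasing[OF \<open>s \<le> t\<close>])
    fix u assume u: "s \<le> u" "u \<le> t"
    then have "u > 0" using assms by simp
    have "((\<lambda>u. ln (rate u) + c * u) has_real_derivative (1 / rate u * - f (rate u) + c * 1)) (at u)"
      using rate_pos[of u] \<open>u > 0\<close> 
      by (intro DERIV_add DERIV_chain2[OF DERIV_ln_divide rate_deriv] DERIV_cmult DERIV_ident) auto
    moreover have "1 / rate u * - f (rate u) + c * 1 \<ge> 0" using c[OF u] by simp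
    ultimately show "\<exists>y. ((\<lambda>u. ln (rate u) + c * u) has_real_derivative y) (at u) \<and> 0 \<le> y" by blast
  qed
  then show ?thesis by (simp add: algebra_simps)
qed

text \<open>The logarithmic derivative \<open>- f(a) / a\<close> of the rate vanishes at infinity, so shifting time by a bounded
amount does not change the rate asymptotically.\<close>

lemma rate_ratio_tendsto_1:
  assumes p: "filterlim p at_top F" and s: "\<forall>\<^sub>F t in F. \<bar>s t - p t\<bar> \<le> d"
  shows "((\<lambda>t. rate (s t) / rate (p t)) \<longlongrightarrow> 1) F"
proof -
  have "((\<lambda>t. ln (rate (s t)) - ln (rate (p t))) \<longlongrightarrow> 0) F"
  proof (rule tendstoI)
    fix e :: real assume "e > 0"
    define c where "c = e / (1 + \<bar>d\<bar>)"
    have "c > 0" using \<open>e > 0\<close> by (simp add: c_def)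
    have "\<forall>\<^sub>F u in at_top. f (rate u) / rate u < c" 
      by (rule order_tendstoD(2)[OF rate_log_deriv_tendsto \<open>c > 0\<close>])
    then obtain T where T: "\<And>u. u \<ge> T \<Longrightarrow> f (rate u) / rate u < c"
      unfolding eventually_at_top_linorder by blast
    have "\<forall>\<^sub>F t in F. p t \<ge> max T 0 + 1 + \<bar>d\<bar>" using p by (simp add: filterlim_at_top)
    with s show "\<forall>\<^sub>F t in F. dist (ln (rate (s t)) - ln (rate (p t))) 0 < e"
    proof eventually_elim
      case (elim t)
      define lo hi where "lo = min (s t) (p t)" and "hi = max (s t) (p t)"
      have lohi: "0 < lo" "T \<le> lo" "lo \<le> hi" "hi - lo \<le> \<bar>d\<bar>" 
        using elim by (auto simp: lo_def hi_def)
      have "ln (rate lo) - ln (rate hi) \<le> c * (hi - lo)"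
        by (rule rate_log_increment) (use lohi T in \<open>auto intro: less_imp_le\<close>)
      also have "\<dots> \<le> c * \<bar>d\<bar>" using lohi \<open>c > 0\<close> by simp
      also have "\<dots> < e" using \<open>e > 0\<close> by (simp add: c_def field_simps)
      finally have "ln (rate lo) - ln (rate hi) < e" .
      moreover have "ln (rate hi) \<le> ln (rate lo)"
        using rate_decreasing[of lo hi] rate_pos[of hi] rate_pos[of lo] lohi by simp
      ultimately show ?case by (auto simp: dist_real_def lo_def hi_def min_def max_def split: if_splits)
    qed
  qed
  then have "((\<lambda>t. exp (ln (rate (s t)) - ln (rate (p t)))) \<longlongrightarrow> exp 0) F" by (rule tendsto_exp)
  moreover have "\<forall>\<^sub>F t in F. exp (ln (rate (s t)) - ln (rate (p t))) = rate (s t) / rate (p t)"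
  proof -
    have "\<forall>\<^sub>F t in F. p t \<ge> \<bar>d\<bar>" using p by (simp add: filterlim_at_top)
    with s show ?thesis
    proof eventually_elim
      case (elim t)
      then have "s t \<ge> 0" "p t \<ge> 0" by auto
      then show ?case using rate_pos by (simp add: exp_diff)
    qed
  qed
  ultimately show ?thesis by (simp add: tendsto_cong)
qed

lemma spow_fixed: "l \<in> {-1, 0, 1} \<Longrightarrow> spow l = l"
  using beta by (auto simp: spow_def)

lemma spow_eq_iff: "spow l = l \<longleftrightarrow> l \<in> {-1, 0, 1}"
proof
  assume l: "spow l = l"
  show "l \<in> {-1, 0, 1}"
  proof (cases "l = 0")
    case False
    then have "sgn l * \<bar>l\<bar> powr \<beta> = sgn l * \<bar>l\<bar>" using l by (simp add: spow_def sgn_mult_abs)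
    then have "\<bar>l\<bar> powr \<beta> = \<bar>l\<bar> powr 1" using False by (simp add: sgn_0_0)
    then have "ln (\<bar>l\<bar> powr \<beta>) = ln (\<bar>l\<bar> powr 1)" by simp
    then have "\<beta> * ln \<bar>l\<bar> = 1 * ln \<bar>l\<bar>" using False by (simp only: ln_powr)
    then have "ln \<bar>l\<bar> = 0" using beta by simp
    then have "\<bar>l\<bar> = 1" using False by (metis abs_ge_zero ln_eq_zero_iff order_le_less zero_less_abs_iff)
    then show ?thesis by auto
  qed simp
qed (rule spow_fixed)

text \<open>A path asymptotic to \<open>l\<close> times the rate has drift asymptotic to \<open>spow l\<close> times \<open>f \<circ> rate\<close>,
also when drift and rate are taken at different times of bounded distance.\<close>

lemma f_along_rate:
  assumes x: "((\<lambda>t. x t / rate t) \<longlongrightarrow> l) at_top"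
    and p: "filterlim p at_top F" and s: "\<forall>\<^sub>F t in F. \<bar>s t - p t\<bar> \<le> d"
  shows "((\<lambda>t. f (x (s t)) / f (rate (p t))) \<longlongrightarrow> spow l) F"
proof -
  have large: "\<forall>\<^sub>F t in F. p t \<ge> \<bar>d\<bar> + \<bar>K\<bar>" for K using p by (simp add: filterlim_at_top)
  have s_top: "filterlim s at_top F"
    unfolding filterlim_at_top
  proof 
    fix K :: real show "\<forall>\<^sub>F t in F. s t \<ge> K"
      using large[of K] s by eventually_elim linarith
  qed
  have "((\<lambda>t. x (s t) / rate (s t) * (rate (s t) / rate (p t))) \<longlongrightarrow> l * 1) F"
    by (intro tendsto_mult rate_ratio_tendsto_1[OF p s] filterlim_compose[OF x s_top])
  from f_ratio_tendsto[OF filterlim_compose[OF rate_at_right_0 p] this]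
  have "((\<lambda>t. f (rate (p t) * (x (s t) / rate (s t) * (rate (s t) / rate (p t)))) / f (rate (p t))) \<longlongrightarrow> spow l) F"
    by simp
  moreover have "\<forall>\<^sub>F t in F. rate (p t) * (x (s t) / rate (s t) * (rate (s t) / rate (p t))) = x (s t)"
    using large[of 0] s
  proof eventually_elim
    case (elim t)
    then have "s t \<ge> 0" "p t \<ge> 0" by auto
    then show ?case using rate_pos[of "s t"] rate_pos[of "p t"] by simp
  qed
  ultimately show ?thesis
    by (elim Lim_transform_eventually) (auto elim: eventually_mono)
qed

lemma f_rate_ratio_tendsto_1:
  assumes p: "filterlim p at_top F" and s: "\<forall>\<^sub>F t in F. \<bar>s t - p t\<bar> \<le> d"
  shows "((\<lambda>t. f (rate (s t)) / f (rate (p t))) \<longlongrightarrow> 1) F"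
proof -
  have "((\<lambda>t. rate t / rate t) \<longlongrightarrow> 1) at_top"
  proof (rule tendsto_eventually)
    show "\<forall>\<^sub>F t in at_top. rate t / rate t = 1"
      using eventually_ge_at_top[of "0::real"] by eventually_elim (use rate_pos in force)
  qed
  from f_along_rate[OF this p s] show ?thesis by (simp add: spow_fixed)
qed

end

section \<open>Small perturbations of the decaying equation\<close>

lemma upward_barrier:
  fixes z :: "real \<Rightarrow> real"
  assumes cont: "continuous_on {t1..} z"
    and der: "\<And>t. t \<ge> t1 \<Longrightarrow> z t = c \<Longrightarrow> \<exists>D>0. (z has_real_derivative D) (at t)"
    and start: "z t1 \<ge> c" and "t \<ge> t1"
  shows "z t \<ge> c"
proof (rule ccontr)
  assume "\<not> z t \<ge> c"
  then have zt: "z t < c" by simp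
  \<comment> \<open>At the last time before t at which z is at least c, it equals c and increases, a contradiction.\<close>
  define S where "S = {t1..t} \<inter> z -` {c..}"
  have "closed S"
    unfolding S_def by (rule continuous_closed_preimage) (auto intro: continuous_on_subset[OF cont])
  moreover have "t1 \<in> S" "bdd_above S" using start \<open>t \<ge> t1\<close> by (auto simp: S_def)
  ultimately have "Sup S \<in> S" by (intro closed_contains_Sup) auto
  define s where "s = Sup S"
  have s: "t1 \<le> s" "s \<le> t" "c \<le> z s" using \<open>Sup S \<in> S\<close> by (auto simp: S_def s_def)
  have after: "z u < c" if "s < u" "u \<le> t" for u
  proof (rule ccontr)
    assume "\<not> z u < c"
    then have "u \<in> S" using that s by (auto simp: S_def)
    then have "u \<le> s" unfolding s_def using \<open>bdd_above S\<close> by (rule cSup_upper)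
    then show False using that by simp
  qed
  have "s < t" using s zt by (cases "s = t") auto
  have "z s = c"
  proof (rule ccontr)
    assume "z s \<noteq> c"
    then have "c < z s" using s by simp
    then obtain u where "s \<le> u" "u \<le> t" "z u = (c + z s) / 2"
      using IVT2'[of z t "(c + z s) / 2" s] zt s continuous_on_subset[OF cont, of "{s..t}"] by auto
    moreover have "u \<noteq> s" using calculation \<open>c < z s\<close> by auto
    ultimately show False using after[of u] \<open>c < z s\<close> by auto
  qed
  then obtain D where "D > 0" "(z has_real_derivative D) (at s)" using der s by blast
  then obtain d where d: "d > 0" "\<And>h. h > 0 \<Longrightarrow> h < d \<Longrightarrow> z s < z (s + h)"
    using DERIV_pos_inc_right by blast
  define h where "h = min (d / 2) (t - s)"
  have "h > 0" "h < d" "s + h \<le> t" using d \<open>s < t\<close> by (auto simp: h_def)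
  then show False using after[of "s + h"] d(2)[of h] \<open>z s = c\<close> by simp
qed

lemma downward_barrier:
  fixes z :: "real \<Rightarrow> real"
  assumes cont: "continuous_on {t1..} z"
    and der: "\<And>t. t \<ge> t1 \<Longrightarrow> z t = c \<Longrightarrow> \<exists>D<0. (z has_real_derivative D) (at t)"
    and start: "z t1 \<le> c" and "t \<ge> t1"
  shows "z t \<le> c"
proof -
  have "- z t \<ge> - c"
  proof (rule upward_barrier[where z = "\<lambda>t. - z t"])
    fix t assume "t \<ge> t1" "- z t = - c"
    then obtain D where "D < 0" "(z has_real_derivative D) (at t)" using der by auto
    then show "\<exists>D>0. ((\<lambda>t. - z t) has_real_derivative D) (at t)"
      by (intro exI[of _ "- D"]) (auto intro: DERIV_minus)
  qed (use assms in \<open>auto intro: continuous_intros\<close>)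
  then show ?thesis by simp
qed

lemma one_way_crossing:
  fixes z z' :: "real \<Rightarrow> real"
  assumes der: "\<And>t. t \<ge> T \<Longrightarrow> (z has_real_derivative z' t) (at t)"
    and dir: "(\<forall>t\<ge>T. z t = c \<longrightarrow> z' t > 0) \<or> (\<forall>t\<ge>T. z t = c \<longrightarrow> z' t < 0)"
  shows "(\<forall>\<^sub>F t in at_top. z t \<ge> c) \<or> (\<forall>\<^sub>F t in at_top. z t \<le> c)"
proof -
  have cont: "continuous_on {t1..} z" if "t1 \<ge> T" for t1
    using that by (auto intro!: continuous_at_imp_continuous_on DERIV_isCont[OF der])
  have "(\<exists>t1\<ge>T. \<forall>t\<ge>t1. z t \<ge> c) \<or> (\<exists>t1\<ge>T. \<forall>t\<ge>t1. z t \<le> c)"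
    using dir
  proof
    assume up: "\<forall>t\<ge>T. z t = c \<longrightarrow> z' t > 0"
    have "\<exists>D>0. (z has_real_derivative D) (at t)" if "T \<le> t" "z t = c" for t
      using up der that by blast
    then have "z t \<ge> c" if "T \<le> t1" "z t1 \<ge> c" "t1 \<le> t" for t1 t
      by (rule upward_barrier[OF cont[OF that(1)] _ that(2,3)]) (use that(1) in auto)
    then show ?thesis by (metis linear order_refl)
  next
    assume down: "\<forall>t\<ge>T. z t = c \<longrightarrow> z' t < 0"
    have "\<exists>D<0. (z has_real_derivative D) (at t)" if "T \<le> t" "z t = c" for t
      using down der that by blast
    then have "z t \<le> c" if "T \<le> t1" "z t1 \<le> c" "t1 \<le> t" for t1 t
      by (rule downward_barrier[OF cont[OF that(1)] _ that(2,3)]) (use that(1) in auto)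
    then show ?thesis by (metis linear order_refl)
  qed
  then show ?thesis unfolding eventually_at_top_linorder by blast
qed

text \<open>As long as \<open>y\<close> stays above \<open>\<eta>\<close>, it decreases, so that \<open>y + \<delta>\<close> ranges in a compact subset of
the half-line, where \<open>g\<close> is bounded away from zero. Hence \<open>y\<close> decreases at least linearly and must reach
\<open>\<eta>\<close>; having done so it cannot cross \<open>\<eta>\<close> upwards.\<close>

lemma perturbed_ode_eventually_below:
  fixes g y \<delta> :: "real \<Rightarrow> real"
  assumes g: "continuous_on UNIV g" "\<And>x. x > 0 \<Longrightarrow> g x > 0"
    and der: "\<And>t. t > 0 \<Longrightarrow> (y has_real_derivative - g (y t + \<delta> t)) (at t)"
    and \<delta>: "(\<delta> \<longlongrightarrow> 0) at_top" and "\<eta> > 0"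
  shows "\<forall>\<^sub>F t in at_top. y t \<le> \<eta>"
proof -
  have "\<forall>\<^sub>F t in at_top. \<bar>\<delta> t\<bar> < \<eta> / 2" using tendstoD[OF \<delta>, of "\<eta> / 2"] \<open>\<eta> > 0\<close> by (simp add: dist_real_def)
  then obtain T' where T': "\<And>t. t \<ge> T' \<Longrightarrow> \<bar>\<delta> t\<bar> < \<eta> / 2" unfolding eventually_at_top_linorder by blast
  define T where "T = max T' 1"
  have T: "T > 0" "\<And>t. t \<ge> T \<Longrightarrow> \<bar>\<delta> t\<bar> < \<eta> / 2" using T' by (auto simp: T_def)
  have cont: "continuous_on {t1..} y" if "t1 \<ge> T" for t1
    using that T by (auto intro!: continuous_at_imp_continuous_on DERIV_isCont[OF der])
  have "\<exists>t1\<ge>T. y t1 \<le> \<eta>"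
  proof (rule ccontr)
    assume "\<not> ?thesis"
    then have above: "y t > \<eta>" if "t \<ge> T" for t using that by force
    have dec: "y t \<le> y T" if "t \<ge> T" for t
    proof (rule DERIV_nonpos_imp_nonincreasing[OF that])
      fix s assume s: "T \<le> s"
      have "y s + \<delta> s > 0" using above[OF s] T(2)[OF s] \<open>\<eta> > 0\<close> unfolding abs_less_iff by linarith
      with g(2) show "\<exists>D. (y has_real_derivative D) (at s) \<and> D \<le> 0"
        using s T by (intro exI[of _ "- g (y s + \<delta> s)"]) (auto intro!: der less_imp_le)
    qed
    have ne: "{\<eta> / 2..y T + \<eta> / 2} \<noteq> {}" using above[of T] \<open>\<eta> > 0\<close> by simp
    obtain p where p: "p \<in> {\<eta> / 2..y T + \<eta> / 2}" "\<And>x. x \<in> {\<eta> / 2..y T + \<eta> / 2} \<Longrightarrow> g p \<le> g x"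
      using continuous_attains_inf[OF _ ne continuous_on_subset[OF g(1)]] by (metis compact_Icc subset_UNIV)
    define m where "m = g p"
    have "m > 0" unfolding m_def using p(1) \<open>\<eta> > 0\<close> by (intro g(2)) simp
    have drop: "y t + m * t \<le> y T + m * T" if "t \<ge> T" for t
    proof (rule DERIV_nonpos_imp_nonincreasing[OF that])
      fix s assume s: "T \<le> s"
      have "y s + \<delta> s \<in> {\<eta> / 2..y T + \<eta> / 2}" 
        using above[OF s] T(2)[OF s] dec[OF s] unfolding atLeastAtMost_iff abs_less_iff by linarith
      then have "m \<le> g (y s + \<delta> s)" unfolding m_def by (rule p(2))
      moreover have "((\<lambda>t. y t + m * t) has_real_derivative - g (y s + \<delta> s) + m * 1) (at s)"
        using s T by (intro DERIV_add DERIV_cmult DERIV_ident der) auto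
      ultimately show "\<exists>D. ((\<lambda>t. y t + m * t) has_real_derivative D) (at s) \<and> D \<le> 0"
        by (intro exI conjI) (assumption, simp)
    qed
    have "y T > 0" using above[of T] \<open>\<eta> > 0\<close> by simp
    then have "T + y T / m \<ge> T" using \<open>m > 0\<close> by simp
    moreover have "m * (T + y T / m) = m * T + y T" using \<open>m > 0\<close> by (simp add: field_simps)
    ultimately show False using drop[of "T + y T / m"] above[of "T + y T / m"] \<open>\<eta> > 0\<close> by simp
  qed
  then obtain t1 where t1: "t1 \<ge> T" "y t1 \<le> \<eta>" by blast
  have "y t \<le> \<eta>" if "t \<ge> t1" for t
  proof (rule downward_barrier[OF cont[OF t1(1)] _ t1(2) that])
    fix s assume s: "t1 \<le> s" "y s = \<eta>"
    then have "s \<ge> T" using t1 by simp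
    from T(2)[OF this] s \<open>\<eta> > 0\<close> have "y s + \<delta> s > 0" unfolding abs_less_iff by linarith
    then show "\<exists>D<0. (y has_real_derivative D) (at s)"
      using \<open>s \<ge> T\<close> T g(2) by (intro exI[of _ "- g (y s + \<delta> s)"]) (auto intro!: der)
  qed
  then show ?thesis unfolding eventually_at_top_linorder by blast
qed

text \<open>Were the lower limit smaller than the upper limit, a level strictly between them and outside the finite
exceptional set would be crossed infinitely often in both directions.\<close>

lemma ereal_tendsto_of_one_way_crossings:
  fixes z :: "real \<Rightarrow> real"
  assumes "finite A"
    and crossing: "\<And>c. c \<notin> A \<Longrightarrow> (\<forall>\<^sub>F t in at_top. z t \<ge> c) \<or> (\<forall>\<^sub>F t in at_top. z t \<le> c)"
  shows "\<exists>L. ((\<lambda>t. ereal (z t)) \<longlongrightarrow> L) at_top"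
proof -
  define lo hi where "lo = Liminf at_top (\<lambda>t. ereal (z t))" and "hi = Limsup at_top (\<lambda>t. ereal (z t))"
  have "lo \<le> hi" unfolding lo_def hi_def by (rule Liminf_le_Limsup) simp
  moreover have "\<not> lo < hi"
  proof
    assume "lo < hi"
    then obtain a where a: "lo < ereal a" "ereal a < hi" using ereal_dense2 by blast
    then obtain b where b: "ereal a < ereal b" "ereal b < hi" using ereal_dense2 by blast
    have "infinite {a<..<b}" using b by simp
    then have "\<not> {a<..<b} \<subseteq> A" using \<open>finite A\<close> finite_subset by blast
    then obtain c where c: "a < c" "c < b" "c \<notin> A" by (auto simp: subset_eq)
    have "ereal a < ereal c" "ereal c < ereal b" using c by simp_all
    then have lc: "lo < ereal c" "ereal c < hi" using a b less_trans by blast+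
    from crossing[OF c(3)] show False
    proof
      assume "\<forall>\<^sub>F t in at_top. z t \<ge> c"
      then have "ereal c \<le> lo" unfolding lo_def by (intro Liminf_bounded) simp
      with lc show False by simp
    next
      assume "\<forall>\<^sub>F t in at_top. z t \<le> c"
      then have "hi \<le> ereal c" unfolding hi_def by (intro Limsup_bounded) simp
      with lc show False by simp
    qed
  qed
  ultimately have "lo = hi" by simp
  then show ?thesis using tendsto_iff_Liminf_eq_Limsup[of at_top "\<lambda>t. ereal (z t)" hi]
    unfolding lo_def hi_def by auto
qed

context decay_rate
begin

lemma rate_tendsto_0: "(rate \<longlongrightarrow> 0) at_top"
  using rate_at_right_0 by (simp add: filterlim_at)

text \<open>The lower bound is the upper bound for the reflected equation, with \<open>- f(- x)\<close> in place of \<open>f\<close>.\<close>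

lemma perturbed_ode_tendsto_0:
  assumes der: "\<And>t. t > 0 \<Longrightarrow> (y has_real_derivative - f (y t + \<delta> t)) (at t)"
    and \<delta>: "(\<delta> \<longlongrightarrow> 0) at_top"
  shows "(y \<longlongrightarrow> 0) at_top"
proof -
  have upper: "\<forall>\<^sub>F t in at_top. y t \<le> \<eta>" if "\<eta> > 0" for \<eta>
    by (rule perturbed_ode_eventually_below[OF continuous f_pos der \<delta> that])
  have lower: "\<forall>\<^sub>F t in at_top. - y t \<le> \<eta>" if "\<eta> > 0" for \<eta>
  proof (rule perturbed_ode_eventually_below[where g = "\<lambda>x. - f (- x)" and \<delta> = "\<lambda>t. - \<delta> t", OF _ _ _ _ that])
    show "continuous_on UNIV (\<lambda>x. - f (- x))"
      by (intro continuous_intros continuous_on_compose2[OF continuous]) auto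
    show "- f (- x) > 0" if "x > 0" for x
      using sign[of "- x"] that by (simp add: mult_less_0_iff)
    show "((\<lambda>t. - y t) has_real_derivative - (- f (- (- y t + - \<delta> t)))) (at t)" if "t > 0" for t
      using DERIV_minus[OF der[OF that]] by (simp add: add.commute)
    show "((\<lambda>t. - \<delta> t) \<longlongrightarrow> 0) at_top" using tendsto_minus[OF \<delta>] by simp
  qed
  show ?thesis
  proof (rule tendstoI)
    fix e :: real assume "e > 0"
    then have "e / 2 > 0" by simp
    from upper[OF this] lower[OF this] show "\<forall>\<^sub>F t in at_top. dist (y t) 0 < e"
      by eventually_elim (use \<open>e > 0\<close> in \<open>simp add: dist_real_def abs_less_iff\<close>)
  qed
qed

text \<open>The ratio \<open>z\<close> of the solution to the rate solves \<open>z' = w (z - \<kappa>)\<close> with a positive weight \<open>w\<close> whose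
integral diverges, and \<open>\<kappa>\<close> behaves like \<open>spow z\<close>. The limit of \<open>z\<close> exists since the field \<open>c - spow c\<close>
vanishes only at \<open>-1, 0, 1\<close>, and any limit is one of these zeros.\<close>

lemma perturbed_ode_ratio_limit:
  assumes der: "\<And>t. t > 0 \<Longrightarrow> (y has_real_derivative - f (y t + \<delta> t)) (at t)"
    and \<delta>: "((\<lambda>t. \<delta> t / rate t) \<longlongrightarrow> 0) at_top"
  shows "\<exists>l\<in>{-1, 0, 1}. ((\<lambda>t. y t / rate t) \<longlongrightarrow> l) at_top"
proof -
  define z where "z t = y t / rate t" for t
  define \<rho> where "\<rho> t = \<delta> t / rate t" for t
  define \<kappa> where "\<kappa> t = f (y t + \<delta> t) / f (rate t)" for t
  define w where "w t = f (rate t) / rate t" for t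
  have \<rho>: "(\<rho> \<longlongrightarrow> 0) at_top" using \<delta> by (simp add: \<rho>_def[abs_def])
  have pos: "\<forall>\<^sub>F t in at_top. t > (0::real)" by (rule eventually_gt_at_top)
  have \<delta>0: "(\<delta> \<longlongrightarrow> 0) at_top"
  proof (rule Lim_transform_eventually)
    show "((\<lambda>t. \<rho> t * rate t) \<longlongrightarrow> 0) at_top" using tendsto_mult[OF \<rho> rate_tendsto_0] by simp
    show "\<forall>\<^sub>F t in at_top. \<rho> t * rate t = \<delta> t"
      using pos
    proof eventually_elim
      case (elim t)
      then show ?case using rate_pos[of t] by (simp add: \<rho>_def)
    qed
  qed
  have w_pos: "w t > 0" if "t > 0" for t using that rate_pos[of t] f_pos[of "rate t"] by (simp add: w_def)
  have z_der: "(z has_real_derivative w t * (z t - \<kappa> t)) (at t)" if "t > 0" for t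
  proof -
    have r: "rate t > 0" "f (rate t) > 0" using that rate_pos[of t] f_pos[of "rate t"] by auto
    have "(z has_real_derivative (- f (y t + \<delta> t) * rate t - y t * - f (rate t)) / (rate t * rate t)) (at t)"
      unfolding z_def[abs_def] using r by (intro DERIV_divide der rate_deriv that) auto
    also have "(- f (y t + \<delta> t) * rate t - y t * - f (rate t)) / (rate t * rate t) = w t * (z t - \<kappa> t)"
      using r by (simp add: w_def z_def \<kappa>_def field_simps)
    finally show ?thesis .
  qed
  have expand: "y t + \<delta> t = rate t * (z t + \<rho> t)" if "t > 0" for t
    using rate_pos[of t] that by (simp add: z_def \<rho>_def field_simps)
  have crossing: "(\<forall>\<^sub>F t in at_top. z t \<ge> c) \<or> (\<forall>\<^sub>F t in at_top. z t \<le> c)" if "c \<notin> {-1, 0, 1}" for c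
  proof -
    have "spow c \<noteq> c" using that spow_eq_iff by blast
    have "((\<lambda>t. c + \<rho> t) \<longlongrightarrow> c + 0) at_top" by (intro tendsto_intros \<rho>)
    then have "((\<lambda>t. c - f (rate t * (c + \<rho> t)) / f (rate t)) \<longlongrightarrow> c - spow c) at_top"
      by (intro tendsto_diff tendsto_const f_ratio_tendsto rate_at_right_0) simp
    then have "\<forall>\<^sub>F t in at_top. sgn (c - f (rate t * (c + \<rho> t)) / f (rate t)) = sgn (c - spow c)"
      using \<open>spow c \<noteq> c\<close> order_tendstoD[of _ "c - spow c" at_top 0]
      by (cases "c - spow c" "0 :: real" rule: linorder_cases) (force elim: eventually_mono)+
    with pos obtain T where T: "\<And>t. t \<ge> T \<Longrightarrow> t > 0 \<and> sgn (c - f (rate t * (c + \<rho> t)) / f (rate t)) = sgn (c - spow c)"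
      unfolding eventually_at_top_linorder by (metis linear order_trans)
    have sgn: "sgn (w t * (z t - \<kappa> t)) = sgn (c - spow c)" if "t \<ge> T" "z t = c" for t
      using T[OF that(1)] w_pos[of t] that(2) expand[of t] by (simp add: sgn_mult \<kappa>_def)
    show ?thesis
    proof (rule one_way_crossing[where z' = "\<lambda>t. w t * (z t - \<kappa> t)" and T = T])
      show "(z has_real_derivative w t * (z t - \<kappa> t)) (at t)" if "t \<ge> T" for t
        using z_der T that by blast
      show "(\<forall>t\<ge>T. z t = c \<longrightarrow> 0 < w t * (z t - \<kappa> t)) \<or> (\<forall>t\<ge>T. z t = c \<longrightarrow> w t * (z t - \<kappa> t) < 0)"
      proof (cases "c - spow c > 0")
        case True
        then have "\<forall>t\<ge>T. z t = c \<longrightarrow> 0 < w t * (z t - \<kappa> t)" using sgn by (metis sgn_1_pos)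
        then show ?thesis by blast
      next
        case False
        then have "sgn (c - spow c) = -1" using \<open>spow c \<noteq> c\<close> by (simp add: sgn_1_neg)
        then have "\<forall>t\<ge>T. z t = c \<longrightarrow> w t * (z t - \<kappa> t) < 0" using sgn by (metis sgn_1_neg)
        then show ?thesis by blast
      qed
    qed
  qed
  \<comment> \<open>Far out the restoring term dominates: \<kappa> has the sign of z and exceeds it in absolute value.\<close>
  have no_inf: "\<not> filterlim (\<lambda>t. s * z t) at_top at_top" if s: "s \<in> {-1, 1}" for s :: real
  proof
    assume lim: "filterlim (\<lambda>t. s * z t) at_top at_top"
    obtain x0 K where K: "x0 > 0" "K > 0"
      "\<And>a v. a > 0 \<Longrightarrow> \<bar>v\<bar> \<ge> K \<Longrightarrow> a * \<bar>v\<bar> < x0 \<Longrightarrow> f (a * v) / f a * sgn v \<ge> 4 * \<bar>v\<bar>"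
      using f_ratio_superlinear by metis
    have y0: "((\<lambda>t. y t + \<delta> t) \<longlongrightarrow> 0 + 0) at_top"
      by (intro tendsto_add perturbed_ode_tendsto_0[OF der \<delta>0] \<delta>0)
    have "\<forall>\<^sub>F t in at_top. \<bar>y t + \<delta> t\<bar> < x0" using tendstoD[OF y0 \<open>x0 > 0\<close>] by (simp add: dist_real_def)
    moreover have "\<forall>\<^sub>F t in at_top. \<bar>\<rho> t\<bar> < 1" using tendstoD[OF \<rho>, of 1] by (simp add: dist_real_def)
    moreover have "\<forall>\<^sub>F t in at_top. s * z t \<ge> K + 2" using lim by (simp add: filterlim_at_top)
    ultimately have "\<forall>\<^sub>F t in at_top. t > 0 \<and> s * (z t - \<kappa> t) \<le> 0"
      using pos
    proof eventually_elim
      case (elim t)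
      define v where "v = z t + \<rho> t"
      have "s * v \<ge> s * z t - 1" using elim s by (auto simp: v_def abs_less_iff)
      then have sv: "s * v \<ge> K + 1" "s * v > 0" using elim K(2) by auto
      then have abs: "\<bar>v\<bar> = s * v" "sgn v = s" using s by (auto simp: sgn_if)
      have "rate t * \<bar>v\<bar> < x0" using expand[of t] elim rate_pos[of t] by (simp add: v_def abs_mult)
      then have "4 * \<bar>v\<bar> \<le> f (rate t * v) / f (rate t) * sgn v"
        using abs sv elim rate_pos[of t] by (intro K(3)) auto
      then have "4 * (s * v) \<le> s * \<kappa> t"
        using expand[of t] elim by (simp only: abs) (simp add: \<kappa>_def v_def mult.commute)
      then show ?case using \<open>s * v \<ge> s * z t - 1\<close> elim K(2) by (simp add: algebra_simps)
    qed
    then obtain T where T: "\<And>t. t \<ge> T \<Longrightarrow> t > 0 \<and> s * (z t - \<kappa> t) \<le> 0"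
      unfolding eventually_at_top_linorder by blast
    have bounded: "s * z t \<le> s * z T" if "t \<ge> T" for t
    proof (rule DERIV_nonpos_imp_nonincreasing[OF that])
      fix u assume u: "T \<le> u"
      have "((\<lambda>t. s * z t) has_real_derivative s * (w u * (z u - \<kappa> u))) (at u)"
        using T u by (intro DERIV_cmult z_der) auto
      moreover have "s * (w u * (z u - \<kappa> u)) = w u * (s * (z u - \<kappa> u))" by simp
      moreover have "w u * (s * (z u - \<kappa> u)) \<le> 0" using T[OF u] w_pos[of u] by (simp add: mult_nonneg_nonpos)
      ultimately show "\<exists>D. ((\<lambda>t. s * z t) has_real_derivative D) (at u) \<and> D \<le> 0" by auto
    qed
    have "\<forall>\<^sub>F t in at_top. s * z t \<ge> s * z T + 1" using lim by (simp add: filterlim_at_top)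
    then obtain T' where "\<And>t. t \<ge> T' \<Longrightarrow> s * z t \<ge> s * z T + 1" unfolding eventually_at_top_linorder by blast
    then have "s * z (max T T') \<ge> s * z T + 1" by simp
    moreover have "s * z (max T T') \<le> s * z T" by (rule bounded) simp
    ultimately show False by linarith
  qed
  \<comment> \<open>Otherwise \<open>z'\<close> is eventually bounded away from 0 relative to \<open>w\<close>, the derivative of \<open>- ln rate\<close>, and \<open>z\<close> diverges with it.\<close>
  have limit_fixed: "l \<in> {-1, 0, 1}" if lim: "(z \<longlongrightarrow> l) at_top" for l
  proof (rule ccontr)
    assume "l \<notin> {-1, 0, 1}"
    then have "l - spow l \<noteq> 0" using spow_eq_iff[of l] by simp
    define s where "s = sgn (l - spow l)"
    define g where "g = \<bar>l - spow l\<bar> / 2"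
    have g: "g > 0" "s * (l - spow l) = 2 * g" using \<open>l - spow l \<noteq> 0\<close> unfolding g_def s_def by (auto simp: sgn_if)
    have "((\<lambda>t. z t + \<rho> t) \<longlongrightarrow> l + 0) at_top" by (intro tendsto_add lim \<rho>)
    then have "((\<lambda>t. f (rate t * (z t + \<rho> t)) / f (rate t)) \<longlongrightarrow> spow l) at_top"
      by (intro f_ratio_tendsto rate_at_right_0) simp
    moreover have "\<forall>\<^sub>F t in at_top. f (rate t * (z t + \<rho> t)) / f (rate t) = \<kappa> t"
      using pos by eventually_elim (simp add: expand \<kappa>_def)
    ultimately have "(\<kappa> \<longlongrightarrow> spow l) at_top" by (rule Lim_transform_eventually)
    then have "((\<lambda>t. s * (z t - \<kappa> t)) \<longlongrightarrow> s * (l - spow l)) at_top" by (intro tendsto_intros lim)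
    then have "\<forall>\<^sub>F t in at_top. s * (z t - \<kappa> t) > g" using g by (intro order_tendstoD(1)) auto
    with pos have "\<forall>\<^sub>F t in at_top. t > 0 \<and> s * (z t - \<kappa> t) > g" by eventually_elim simp
    then obtain T where T: "\<And>t. t \<ge> T \<Longrightarrow> t > 0 \<and> s * (z t - \<kappa> t) > g"
      unfolding eventually_at_top_linorder by blast
    have grow: "s * z T + g * ln (rate T) \<le> s * z t + g * ln (rate t)" if "t \<ge> T" for t
    proof (rule DERIV_nonneg_imp_nondecreasing[OF that])
      fix u assume u: "T \<le> u"
      have "u > 0" using T u by blast
      have "((\<lambda>t. s * z t + g * ln (rate t)) has_real_derivative 
          s * (w u * (z u - \<kappa> u)) + g * (1 / rate u * - f (rate u))) (at u)"
        using \<open>u > 0\<close> rate_pos[of u]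
        by (intro DERIV_add DERIV_cmult z_der DERIV_chain2[OF DERIV_ln_divide rate_deriv]) auto
      moreover have "1 / rate u * - f (rate u) = - w u" by (simp add: w_def)
      then have "s * (w u * (z u - \<kappa> u)) + g * (1 / rate u * - f (rate u)) = w u * (s * (z u - \<kappa> u) - g)"
        by (simp only:) (simp add: algebra_simps)
      moreover have "w u * (s * (z u - \<kappa> u) - g) \<ge> 0" using T[OF u] w_pos[of u] by (simp add: less_imp_le)
      ultimately show "\<exists>D. ((\<lambda>t. s * z t + g * ln (rate t)) has_real_derivative D) (at u) \<and> 0 \<le> D" by auto
    qed
    have "filterlim (\<lambda>t. ln (rate t)) at_bot at_top" by (rule filterlim_compose[OF ln_at_0 rate_at_right_0])
    then have "\<forall>\<^sub>F t in at_top. ln (rate t) \<le> (s * z T + g * ln (rate T) - s * l - 1) / g"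
      by (simp add: filterlim_at_bot)
    moreover have "\<forall>\<^sub>F t in at_top. s * z t < s * l + 1"
      by (rule order_tendstoD(2)[of _ "s * l"]) (auto intro!: tendsto_intros lim)
    moreover have "\<forall>\<^sub>F t in at_top. t \<ge> T" by (rule eventually_ge_at_top)
    ultimately have "\<forall>\<^sub>F t :: real in at_top. t \<noteq> t"
    proof eventually_elim
      case (elim t)
      then have "g * ln (rate t) \<le> s * z T + g * ln (rate T) - s * l - 1" using g by (simp add: field_simps)
      with grow[OF elim(3)] elim(2) show ?case by simp
    qed
    then show False by simp
  qed
  have "\<exists>L. ((\<lambda>t. ereal (z t)) \<longlongrightarrow> L) at_top"
    by (rule ereal_tendsto_of_one_way_crossings[of "{-1, 0, 1}"]) (simp, rule crossing)
  then obtain L where L: "((\<lambda>t. ereal (z t)) \<longlongrightarrow> L) at_top" ..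
  show ?thesis
  proof (cases L)
    case (real l)
    then have "(z \<longlongrightarrow> l) at_top" using L by simp
    with limit_fixed show ?thesis by (auto simp: z_def[abs_def])
  next
    case PInf
    then have "filterlim (\<lambda>t. 1 * z t) at_top at_top" using L by (simp add: tendsto_PInfty_eq_at_top)
    with no_inf[of 1] show ?thesis by simp
  next
    case MInf
    then have "((\<lambda>t. - ereal (z t)) \<longlongrightarrow> - (-\<infinity>)) at_top" using L by (intro tendsto_uminus_ereal) simp
    then have "filterlim (\<lambda>t. (-1) * z t) at_top at_top" by (simp add: tendsto_PInfty_eq_at_top)
    with no_inf[of "-1"] show ?thesis by simp
  qed
qed

end

section \<open>Paths driven by a noise of small oscillation\<close>

context decay_rate
begin

definition small_oscillation :: "real \<Rightarrow> (real \<Rightarrow> real) \<Rightarrow> bool" where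
  "small_oscillation h j \<longleftrightarrow> (\<forall>\<epsilon>>0. \<forall>\<^sub>F n in sequentially. \<forall>s\<in>{real n * h..(real n + 1) * h}.
     \<bar>j s - j (real n * h)\<bar> \<le> \<epsilon> * f (rate (real n * h)))"

lemma grid_floor:
  assumes "h > 0"
  shows "filterlim (\<lambda>t. nat \<lfloor>t / h\<rfloor>) sequentially at_top"
    and "\<And>t. t \<ge> 0 \<Longrightarrow> real (nat \<lfloor>t / h\<rfloor>) * h \<le> t \<and> t \<le> (real (nat \<lfloor>t / h\<rfloor>) + 1) * h"
proof -
  show "filterlim (\<lambda>t. nat \<lfloor>t / h\<rfloor>) sequentially at_top" using assms by real_asymp
  fix t :: real assume "t \<ge> 0"
  then have "real (nat \<lfloor>t / h\<rfloor>) \<le> t / h" "t / h \<le> real (nat \<lfloor>t / h\<rfloor>) + 1" using assms by auto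
  then show "real (nat \<lfloor>t / h\<rfloor>) * h \<le> t \<and> t \<le> (real (nat \<lfloor>t / h\<rfloor>) + 1) * h"
    using assms by (simp add: field_simps)
qed

lemma grid_at_top: "h > 0 \<Longrightarrow> filterlim (\<lambda>n. real n * h) at_top sequentially"
  by real_asymp

text \<open>The mean value theorem on one time step, with the factor 2 absorbing the change of \<open>f \<circ> rate\<close> during the
step. It lets sums of \<open>f(rate(n h))\<close> telescope.\<close>

lemma rate_step_lower:
  assumes "h > 0"
  shows "\<forall>\<^sub>F n in sequentially. h * f (rate (real n * h)) \<le> 2 * (rate (real n * h) - rate (real (Suc n) * h))"
proof -
  have "\<exists>s. real n * h \<le> s \<and> s \<le> real n * h + h \<and> rate (real n * h) - rate (real (Suc n) * h) = h * f (rate s)"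
    if "n > 0" for n
  proof -
    have pos: "real n * h > 0" using that assms by simp
    have lt: "real n * h < real (Suc n) * h" using assms by simp
    have "\<exists>z>real n * h. z < real (Suc n) * h \<and>
        rate (real (Suc n) * h) - rate (real n * h) = (real (Suc n) * h - real n * h) * - f (rate z)"
      using pos by (intro MVT2[OF lt] rate_deriv) auto
    then obtain z where "real n * h < z" "z < real (Suc n) * h"
        "rate (real (Suc n) * h) - rate (real n * h) = (real (Suc n) * h - real n * h) * - f (rate z)" by blast
    moreover have "real (Suc n) * h - real n * h = h" by (simp add: algebra_simps)
    ultimately show ?thesis by (intro exI[of _ z]) (simp add: algebra_simps)
  qed
  then obtain s where s: "\<And>n. n > 0 \<Longrightarrow> real n * h \<le> s n \<and> s n \<le> real n * h + h \<and>
      rate (real n * h) - rate (real (Suc n) * h) = h * f (rate (s n))"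
    by metis
  have "\<forall>\<^sub>F n in sequentially. \<bar>s n - real n * h\<bar> \<le> h"
    using eventually_gt_at_top[of 0]
  proof eventually_elim
    case (elim n)
    then show ?case using s[of n] by simp
  qed
  from f_rate_ratio_tendsto_1[OF grid_at_top[OF assms] this]
  have "\<forall>\<^sub>F n in sequentially. 1 / 2 < f (rate (s n)) / f (rate (real n * h))"
    by (rule order_tendstoD) simp
  then show ?thesis using eventually_gt_at_top[of 0]
  proof eventually_elim
    case (elim n)
    have "f (rate (real n * h)) > 0" using assms by (intro f_pos rate_pos) simp
    then have "f (rate (real n * h)) \<le> 2 * f (rate (s n))" using elim by (simp add: field_simps)
    then have "h * f (rate (real n * h)) \<le> h * (2 * f (rate (s n)))" using assms by (intro mult_left_mono) auto
    then show ?case using s[OF elim(2)] by simp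
  qed
qed

text \<open>From time \<open>n h\<close> on, the total variation of \<open>j\<close> along the grid is at most \<open>\<epsilon>\<close> times the sum of the remaining
\<open>f(rate(k h))\<close>, which is of the order of \<open>rate(n h)\<close>. So \<open>j\<close> converges, with an error of
smaller order than the rate.\<close>

lemma noise_limit:
  assumes "h > 0" and osc: "small_oscillation h j"
  shows "\<exists>l. ((\<lambda>t. (j t - l) / rate t) \<longlongrightarrow> 0) at_top"
proof -
  define u where "u n = j (real n * h)" for n
  define a where "a n = rate (real n * h)" for n
  have a_pos: "a n > 0" for n using assms by (simp add: a_def rate_pos)
  have a0: "a \<longlonglongrightarrow> 0"
    unfolding a_def by (rule filterlim_compose[OF rate_tendsto_0 grid_at_top[OF \<open>h > 0\<close>]])
  have tail: "\<exists>N. \<forall>m\<ge>N. \<forall>n. \<bar>u (m + n) - u m\<bar> \<le> 2 * \<epsilon> / h * (a m - a (m + n))" if "\<epsilon> > 0" for \<epsilon>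
  proof -
    have "\<forall>\<^sub>F n in sequentially. \<bar>u (Suc n) - u n\<bar> \<le> 2 * \<epsilon> / h * (a n - a (Suc n))"
      using osc[unfolded small_oscillation_def, rule_format, OF that] rate_step_lower[OF \<open>h > 0\<close>]
    proof eventually_elim
      case (elim n)
      have "\<bar>u (Suc n) - u n\<bar> \<le> \<epsilon> * f (a n)"
        using elim(1)[rule_format, of "real (Suc n) * h"] \<open>h > 0\<close> by (simp add: u_def a_def algebra_simps)
      also have "\<dots> = \<epsilon> / h * (h * f (a n))" using \<open>h > 0\<close> by simp
      also have "\<dots> \<le> \<epsilon> / h * (2 * (a n - a (Suc n)))" 
        using elim(2) that \<open>h > 0\<close> unfolding a_def by (intro mult_left_mono) auto
      finally show ?case by (simp add: right_diff_distrib diff_divide_distrib mult_ac)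
    qed
    then obtain N where N: "\<And>n. n \<ge> N \<Longrightarrow> \<bar>u (Suc n) - u n\<bar> \<le> 2 * \<epsilon> / h * (a n - a (Suc n))"
      unfolding eventually_sequentially by blast
    have "\<bar>u (m + n) - u m\<bar> \<le> 2 * \<epsilon> / h * (a m - a (m + n))" if "m \<ge> N" for m n
    proof (induction n)
      case (Suc n)
      have "\<bar>u (m + Suc n) - u m\<bar> \<le> \<bar>u (Suc (m + n)) - u (m + n)\<bar> + \<bar>u (m + n) - u m\<bar>" by simp
      also have "\<dots> \<le> 2 * \<epsilon> / h * (a (m + n) - a (Suc (m + n))) + 2 * \<epsilon> / h * (a m - a (m + n))"
        using N[of "m + n"] that Suc by (intro add_mono) auto
      also have "\<dots> = 2 * \<epsilon> / h * (a m - a (m + Suc n))"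
        by (simp only: distrib_left[symmetric]) simp
      finally show ?case .
    qed simp
    then show ?thesis by blast
  qed
  have tail': "\<exists>N. \<forall>m\<ge>N. \<forall>n. \<bar>u (m + n) - u m\<bar> \<le> 2 * \<epsilon> / h * a m" if "\<epsilon> > 0" for \<epsilon>
  proof -
    have "2 * \<epsilon> / h * (a m - a (m + n)) \<le> 2 * \<epsilon> / h * a m" for m n
      using a_pos[of "m + n"] that \<open>h > 0\<close> by (intro mult_left_mono) auto
    then show ?thesis using tail[OF that] by (meson order_trans)
  qed
  have "Cauchy u"
  proof (rule CauchyI')
    fix e :: real assume "e > 0"
    obtain N where N: "\<And>m n. m \<ge> N \<Longrightarrow> \<bar>u (m + n) - u m\<bar> \<le> 2 * 1 / h * a m" using tail'[of 1] by auto
    have "(\<lambda>m. 2 * 1 / h * a m) \<longlonglongrightarrow> 2 * 1 / h * 0" by (intro tendsto_intros a0)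
    then have "\<forall>\<^sub>F m in sequentially. 2 * 1 / h * a m < e" using \<open>e > 0\<close> by (intro order_tendstoD(2)) auto
    then obtain N' where N': "\<And>m. m \<ge> N' \<Longrightarrow> 2 * 1 / h * a m < e" unfolding eventually_sequentially by blast
    have "dist (u m) (u n) < e" if "m \<ge> max N N'" "n > m" for m n
      using N[of m "n - m"] N'[of m] that by (simp add: dist_real_def abs_minus_commute)
    then show "\<exists>M. \<forall>m\<ge>M. \<forall>n>m. dist (u m) (u n) < e" by blast
  qed
  then obtain l where l: "u \<longlonglongrightarrow> l" using Cauchy_convergent convergent_def by blast
  have close: "\<forall>\<^sub>F n in sequentially. \<bar>u n - l\<bar> \<le> 2 * \<epsilon> / h * a n" if "\<epsilon> > 0" for \<epsilon>
  proof -
    obtain N where N: "\<And>m n. m \<ge> N \<Longrightarrow> \<bar>u (m + n) - u m\<bar> \<le> 2 * \<epsilon> / h * a m" using tail'[OF \<open>\<epsilon> > 0\<close>] by auto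
    have "\<bar>l - u m\<bar> \<le> 2 * \<epsilon> / h * a m" if "m \<ge> N" for m
    proof (rule LIMSEQ_le_const2)
      show "(\<lambda>n. \<bar>u (n + m) - u m\<bar>) \<longlonglongrightarrow> \<bar>l - u m\<bar>"
        by (intro tendsto_intros LIMSEQ_ignore_initial_segment l)
      show "\<exists>K. \<forall>n\<ge>K. \<bar>u (n + m) - u m\<bar> \<le> 2 * \<epsilon> / h * a m" using N[OF that] by (auto simp: add.commute)
    qed
    then show ?thesis unfolding eventually_sequentially by (metis abs_minus_commute)
  qed
  have "((\<lambda>t. (j t - l) / rate t) \<longlongrightarrow> 0) at_top"
  proof (rule tendstoI)
    fix e :: real assume "e > 0"
    define \<epsilon> where "\<epsilon> = e / (4 * (1 + 2 / h))"
    have C: "1 + 2 / h > 0" using \<open>h > 0\<close> by (simp add: add_pos_pos)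
    have "\<epsilon> > 0" using \<open>e > 0\<close> C by (simp add: \<epsilon>_def)
    define N where "N t = nat \<lfloor>t / h\<rfloor>" for t
    have N: "filterlim N sequentially at_top" unfolding N_def by (rule grid_floor[OF \<open>h > 0\<close>])
    have "\<forall>\<^sub>F t in at_top. \<bar>real (N t) * h - t\<bar> \<le> h"
      using eventually_ge_at_top[of "0 :: real"]
    proof eventually_elim
      case (elim t)
      then show ?case using grid_floor(2)[OF \<open>h > 0\<close>, of t] unfolding N_def[symmetric] by (simp add: algebra_simps abs_le_iff)
    qed
    from rate_ratio_tendsto_1[OF filterlim_ident this]
    have "((\<lambda>t. a (N t) / rate t) \<longlongrightarrow> 1) at_top" by (simp add: a_def)
    then have r2: "\<forall>\<^sub>F t in at_top. a (N t) / rate t < 2" by (rule order_tendstoD(2)) simp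
    have "((\<lambda>n. f (a n) / a n) \<longlonglongrightarrow> 0)"
      unfolding a_def by (rule filterlim_compose[OF rate_log_deriv_tendsto grid_at_top[OF \<open>h > 0\<close>]])
    then have "\<forall>\<^sub>F n in sequentially. f (a n) / a n < 1" by (rule order_tendstoD(2)) simp
    with close[OF \<open>\<epsilon> > 0\<close>] osc[unfolded small_oscillation_def, rule_format, OF \<open>\<epsilon> > 0\<close>]
    have "\<forall>\<^sub>F n in sequentially. \<forall>s\<in>{real n * h..(real n + 1) * h}. \<bar>j s - l\<bar> \<le> \<epsilon> * (1 + 2 / h) * a n"
    proof eventually_elim
      case (elim n)
      show ?case
      proof
        fix s assume "s \<in> {real n * h..(real n + 1) * h}"
        then have "\<bar>j s - u n\<bar> \<le> \<epsilon> * f (a n)" using elim(2) by (simp add: u_def a_def)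
        also have "\<dots> \<le> \<epsilon> * a n" using elim(3) a_pos[of n] \<open>\<epsilon> > 0\<close> by (simp add: field_simps)
        finally have "\<bar>j s - l\<bar> \<le> \<epsilon> * a n + 2 * \<epsilon> / h * a n" using elim(1) by linarith
        then show "\<bar>j s - l\<bar> \<le> \<epsilon> * (1 + 2 / h) * a n" by (simp add: algebra_simps)
      qed
    qed
    from eventually_compose_filterlim[OF this N] r2 eventually_ge_at_top[of "0 :: real"]
    show "\<forall>\<^sub>F t in at_top. dist ((j t - l) / rate t) 0 < e"
    proof eventually_elim
      case (elim t)
      have "t \<in> {real (N t) * h..(real (N t) + 1) * h}"
        using grid_floor(2)[OF \<open>h > 0\<close> elim(3)] unfolding N_def[symmetric] by simp
      then have "\<bar>j t - l\<bar> \<le> \<epsilon> * (1 + 2 / h) * a (N t)" using elim(1) by blast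
      then have "\<bar>j t - l\<bar> / rate t \<le> \<epsilon> * (1 + 2 / h) * (a (N t) / rate t)"
        using rate_pos[OF elim(3)] by (simp add: divide_right_mono)
      also have "\<dots> \<le> \<epsilon> * (1 + 2 / h) * 2"
        using elim(2) \<open>\<epsilon> > 0\<close> C by (intro mult_left_mono) auto
      also have "\<dots> = e / 2"
      proof -
        have "e / (4 * c) * c * 2 = e / 2" if "c > 0" for c :: real using that by (simp add: field_simps)
        then show ?thesis unfolding \<epsilon>_def using C by blast
      qed
      also have "\<dots> < e" using \<open>e > 0\<close> by simp
      finally show ?case using rate_pos[OF elim(3)] by (simp add: dist_real_def abs_divide)
    qed
  qed
  then show ?thesis by blast
qed

lemma small_oscillation_increment:
  assumes "h > 0" and osc: "small_oscillation h j"
  shows "((\<lambda>t. (j (t + h) - j t) / f (rate t)) \<longlongrightarrow> 0) at_top"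
proof (rule tendstoI)
  fix e :: real assume "e > 0"
  define \<epsilon> where "\<epsilon> = e / 7"
  have "\<epsilon> > 0" using \<open>e > 0\<close> by (simp add: \<epsilon>_def)
  define N where "N t = nat \<lfloor>t / h\<rfloor>" for t
  have N: "filterlim N sequentially at_top" unfolding N_def by (rule grid_floor[OF \<open>h > 0\<close>])
  have NS: "filterlim (\<lambda>t. Suc (N t)) sequentially at_top" by (rule filterlim_compose[OF filterlim_Suc N])
  have near: "\<forall>\<^sub>F t in at_top. \<bar>real (N t) * h - t\<bar> \<le> h \<and> \<bar>real (Suc (N t)) * h - t\<bar> \<le> h"
    using eventually_ge_at_top[of "0 :: real"]
  proof eventually_elim
    case (elim t)
    then show ?case using grid_floor(2)[OF \<open>h > 0\<close>, of t] unfolding N_def[symmetric] by (simp add: algebra_simps abs_le_iff)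
  qed
  have "((\<lambda>t. f (rate (real (N t) * h)) / f (rate t)) \<longlongrightarrow> 1) at_top"
    by (rule f_rate_ratio_tendsto_1[OF filterlim_ident]) (use near in \<open>auto elim: eventually_mono\<close>)
  then have r1: "\<forall>\<^sub>F t in at_top. f (rate (real (N t) * h)) / f (rate t) < 2" by (rule order_tendstoD(2)) simp
  have "((\<lambda>t. f (rate (real (Suc (N t)) * h)) / f (rate t)) \<longlongrightarrow> 1) at_top"
    by (rule f_rate_ratio_tendsto_1[OF filterlim_ident]) (use near in \<open>auto elim: eventually_mono\<close>)
  then have r2: "\<forall>\<^sub>F t in at_top. f (rate (real (Suc (N t)) * h)) / f (rate t) < 2" by (rule order_tendstoD(2)) simp
  note o = osc[unfolded small_oscillation_def, rule_format, OF \<open>\<epsilon> > 0\<close>]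
  show "\<forall>\<^sub>F t in at_top. dist ((j (t + h) - j t) / f (rate t)) 0 < e"
    using eventually_compose_filterlim[OF o N] eventually_compose_filterlim[OF o NS] r1 r2 eventually_ge_at_top[of "0 :: real"]
  proof eventually_elim
    case (elim t)
    have fp: "f (rate t) > 0" using elim by (intro f_pos rate_pos)
    have t: "real (N t) * h \<le> t" "t \<le> (real (N t) + 1) * h"
      using grid_floor(2)[OF \<open>h > 0\<close> elim(5)] unfolding N_def[symmetric] by simp_all
    define p where "p = real (N t) * h"
    define q where "q = real (Suc (N t)) * h"
    have pq: "q = (real (N t) + 1) * h" "(real (Suc (N t)) + 1) * h = q + h" "q = p + h" 
      by (simp_all add: p_def q_def algebra_simps)
    have 1: "\<bar>j s - j p\<bar> \<le> \<epsilon> * f (rate p)" if "s \<in> {p..q}" for s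
      using elim(1) that by (simp add: p_def[symmetric] pq(1)[symmetric])
    have 2: "\<bar>j s - j q\<bar> \<le> \<epsilon> * f (rate q)" if "s \<in> {q..q + h}" for s
      using elim(2) that unfolding q_def[symmetric] pq(2) by blast
    have t: "p \<le> t" "t \<le> q"
      using grid_floor(2)[OF \<open>h > 0\<close> elim(5)] unfolding N_def[symmetric] by (simp_all add: p_def pq(1))
    have "\<bar>j t - j p\<bar> \<le> \<epsilon> * f (rate p)" "\<bar>j q - j p\<bar> \<le> \<epsilon> * f (rate p)"
      using t by (auto intro!: 1)
    moreover have "\<bar>j (t + h) - j q\<bar> \<le> \<epsilon> * f (rate q)" using t pq(3) by (intro 2) auto
    moreover have "\<epsilon> * f (rate p) \<le> \<epsilon> * (2 * f (rate t))"
      using elim(3) fp \<open>\<epsilon> > 0\<close> unfolding p_def by (intro mult_left_mono) (auto simp: field_simps)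
    moreover have "\<epsilon> * f (rate q) \<le> \<epsilon> * (2 * f (rate t))"
      using elim(4) fp \<open>\<epsilon> > 0\<close> unfolding q_def by (intro mult_left_mono) (auto simp: field_simps)
    ultimately have "\<bar>j (t + h) - j t\<bar> \<le> 6 * (\<epsilon> * f (rate t))" by linarith
    also have "\<dots> < e * f (rate t)" using fp \<open>e > 0\<close> by (simp add: \<epsilon>_def)
    finally show ?case using fp by (simp add: dist_real_def abs_divide field_simps)
  qed
qed

definition integral_path :: "real \<Rightarrow> (real \<Rightarrow> real) \<Rightarrow> (real \<Rightarrow> real) \<Rightarrow> bool" where
  "integral_path \<xi> x j \<longleftrightarrow> continuous_on {0..} x \<and>
     (\<forall>t\<ge>0. x t = \<xi> - integral {0..t} (\<lambda>s. f (x s)) + j t)"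

lemma integral_path_deriv:
  assumes "integral_path \<xi> x j" "t > 0"
  shows "((\<lambda>t. \<xi> - integral {0..t} (\<lambda>s. f (x s))) has_real_derivative - f (x t)) (at t)"
proof -
  have x: "continuous_on {0..} x" using assms by (simp add: integral_path_def)
  have "((\<lambda>t. integral {0..t} (\<lambda>s. f (x s))) has_real_derivative f (x t)) (at t within {0..t + 1})"
    using \<open>t > 0\<close> by (intro integral_has_real_derivative continuous_on_compose2[OF continuous] continuous_on_subset[OF x]) auto
  then have "((\<lambda>t. integral {0..t} (\<lambda>s. f (x s))) has_real_derivative f (x t)) (at t)"
    using \<open>t > 0\<close> by (simp add: at_within_Icc_at)
  then show ?thesis by (auto intro!: derivative_eq_intros)
qed

lemma integral_path_increment:
  assumes path: "integral_path \<xi> x j" and "h > 0"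
  obtains s where "\<And>t. t > 0 \<Longrightarrow> t \<le> s t \<and> s t \<le> t + h \<and> x (t + h) - x t = - h * f (x (s t)) + (j (t + h) - j t)"
proof -
  have "\<exists>s. t \<le> s \<and> s \<le> t + h \<and> x (t + h) - x t = - h * f (x s) + (j (t + h) - j t)" if "t > 0" for t
  proof -
    define y where "y t = \<xi> - integral {0..t} (\<lambda>s. f (x s))" for t
    have "\<exists>z>t. z < t + h \<and> y (t + h) - y t = (t + h - t) * - f (x z)"
      unfolding y_def using that \<open>h > 0\<close> by (intro MVT2 integral_path_deriv[OF path]) auto
    then obtain z where z: "t < z" "z < t + h" "y (t + h) - y t = (t + h - t) * - f (x z)" by blast
    moreover have "x (t + h) = y (t + h) + j (t + h)" "x t = y t + j t"
      using path that \<open>h > 0\<close> by (auto simp: integral_path_def y_def)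
    then have "x (t + h) - x t = (y (t + h) - y t) + (j (t + h) - j t)" by simp
    ultimately show ?thesis by (intro exI[of _ z]) simp
  qed
  then show thesis using that by metis
qed

text \<open>The drift contribution to the difference quotient: by the mean value theorem it is \<open>- f\<close> of the path at some
time of the interval, for which \<open>f_along_rate\<close> gives the limit.\<close>

lemma integral_path_ratio:
  assumes path: "integral_path \<xi> x j" and "h > 0"
    and ratio: "((\<lambda>t. x t / rate t) \<longlongrightarrow> l) at_top" and l: "l \<in> {-1, 0, 1}"
  shows "((\<lambda>t. (x (t + h) - x t) / h / f (rate t) - (j (t + h) - j t) / h / f (rate t)) \<longlongrightarrow> - l) at_top"
proof -
  obtain s where s: "\<And>t. t > 0 \<Longrightarrow> t \<le> s t \<and> s t \<le> t + h \<and> x (t + h) - x t = - h * f (x (s t)) + (j (t + h) - j t)"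
    using integral_path_increment[OF assms(1,2)] by metis
  have "\<forall>\<^sub>F t in at_top. \<bar>s t - t\<bar> \<le> h"
    using eventually_gt_at_top[of "0 :: real"]
  proof eventually_elim
    case (elim t)
    then show ?case using s[of t] by simp
  qed
  from tendsto_minus[OF f_along_rate[OF ratio filterlim_ident this]]
  have "((\<lambda>t. - (f (x (s t)) / f (rate t))) \<longlongrightarrow> - l) at_top" using spow_fixed[OF l] by simp
  moreover have "\<forall>\<^sub>F t in at_top. - (f (x (s t)) / f (rate t)) 
      = (x (t + h) - x t) / h / f (rate t) - (j (t + h) - j t) / h / f (rate t)"
    using eventually_gt_at_top[of "0 :: real"]
  proof eventually_elim
    case (elim t)
    have "f (rate t) > 0" using elim by (intro f_pos rate_pos) simp
    have "(x (t + h) - x t) / h / f (rate t) - (j (t + h) - j t) / h / f (rate t)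
      = ((x (t + h) - x t) - (j (t + h) - j t)) / h / f (rate t)" by (simp add: diff_divide_distrib)
    also have "(x (t + h) - x t) - (j (t + h) - j t) = - h * f (x (s t))" using s[OF elim] by simp
    finally show ?case using \<open>h > 0\<close> by simp
  qed
  ultimately show ?thesis by (rule Lim_transform_eventually)
qed

text \<open>Subtracting the vanishing part \<open>j - m\<close> of the noise from the path leaves a differentiable solution of the
perturbed equation.\<close>

lemma integral_path_asymptotics:
  assumes path: "integral_path \<xi> x j" and "h > 0" and osc: "small_oscillation h j"
  shows "\<exists>l\<in>{-1, 0, 1}. ((\<lambda>t. x t / rate t) \<longlongrightarrow> l) at_top \<and>
    ((\<lambda>t. (x (t + h) - x t) / h / f (rate t)) \<longlongrightarrow> - l) at_top"
proof -
  obtain m where m: "((\<lambda>t. (j t - m) / rate t) \<longlongrightarrow> 0) at_top" using noise_limit[OF \<open>h > 0\<close> osc] by blast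
  define y where "y t = (\<xi> + m) - integral {0..t} (\<lambda>s. f (x s))" for t
  have xy: "x t = y t + (j t - m)" if "t \<ge> 0" for t using path that by (simp add: integral_path_def y_def)
  have "(y has_real_derivative - f (y t + (j t - m))) (at t)" if "t > 0" for t
  proof -
    have "((\<lambda>t. m + (\<xi> - integral {0..t} (\<lambda>s. f (x s)))) has_real_derivative 0 + - f (x t)) (at t)"
      by (intro DERIV_add DERIV_const integral_path_deriv[OF path that])
    then show ?thesis using xy[of t] that by (simp add: y_def[abs_def] algebra_simps)
  qed
  from perturbed_ode_ratio_limit[OF this m] obtain l where l: "l \<in> {-1, 0, 1}" 
    "((\<lambda>t. y t / rate t) \<longlongrightarrow> l) at_top" by blast
  have "((\<lambda>t. y t / rate t + (j t - m) / rate t) \<longlongrightarrow> l) at_top" using tendsto_add[OF l(2) m] by simp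
  then have "((\<lambda>t. x t / rate t) \<longlongrightarrow> l) at_top"
  proof (rule Lim_transform_eventually)
    show "\<forall>\<^sub>F t in at_top. y t / rate t + (j t - m) / rate t = x t / rate t"
      using eventually_ge_at_top[of "0 :: real"] by eventually_elim (simp add: xy add_divide_distrib)
  qed
  note ratio = this
  from integral_path_ratio[OF path \<open>h > 0\<close> ratio l(1)]
  have "((\<lambda>t. ((x (t + h) - x t) / h / f (rate t) - (j (t + h) - j t) / h / f (rate t))
      + (j (t + h) - j t) / f (rate t) * (1 / h)) \<longlongrightarrow> - l + 0 * (1 / h)) at_top"
    by (intro tendsto_add tendsto_mult small_oscillation_increment[OF \<open>h > 0\<close> osc] tendsto_const)
  moreover have "((x (t + h) - x t) / h / f (rate t) - (j (t + h) - j t) / h / f (rate t))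
      + (j (t + h) - j t) / f (rate t) * (1 / h) = (x (t + h) - x t) / h / f (rate t)" for t
    by (simp add: mult.commute)
  ultimately have "((\<lambda>t. (x (t + h) - x t) / h / f (rate t)) \<longlongrightarrow> - l) at_top" by (simp only: mult_zero_left add_0_right)
  with ratio l(1) show ?thesis by blast
qed

lemma integral_path_noise_increment:
  assumes path: "integral_path \<xi> x j" and "h > 0" and l: "l \<in> {-1, 0, 1}"
    and ratio: "((\<lambda>t. x t / rate t) \<longlongrightarrow> l) at_top"
    and quot: "((\<lambda>t. (x (t + h) - x t) / h / f (rate t)) \<longlongrightarrow> - l) at_top"
  shows "((\<lambda>t. (j (t + h) - j t) / f (rate t)) \<longlongrightarrow> 0) at_top"
proof -
  have "((\<lambda>t. ((x (t + h) - x t) / h / f (rate t) - 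
     ((x (t + h) - x t) / h / f (rate t) - (j (t + h) - j t) / h / f (rate t))) * h) \<longlongrightarrow> (- l - - l) * h) at_top"
    by (intro tendsto_intros quot integral_path_ratio[OF path \<open>h > 0\<close> ratio l])
  then show ?thesis using \<open>h > 0\<close> by simp
qed

end

section \<open>Brownian increments and the isometry for step processes\<close>

locale brownian = prob_space M for M :: "'a measure" +
  fixes B :: "real \<Rightarrow> 'a \<Rightarrow> real"
  assumes brownian: "brownian_motion M B"
begin

abbreviation "history \<equiv> completed_filtration M B"

lemma B_measurable [measurable]: "t \<ge> 0 \<Longrightarrow> B t \<in> borel_measurable M"
  using brownian by (simp add: brownian_motion_def)

lemma sets_natural_filtration:
  "sets (natural_filtration M B t) =
    sigma_sets (space M) {B s -` U \<inter> space M | s U. 0 \<le> s \<and> s \<le> t \<and> U \<in> sets borel}"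
  unfolding natural_filtration_def by (rule sets_measure_of) auto

lemma space_natural_filtration: "space (natural_filtration M B t) = space M"
  unfolding natural_filtration_def by (rule space_measure_of_conv)

lemma natural_filtration_subset: "sets (natural_filtration M B t) \<subseteq> events"
  unfolding sets_natural_filtration by (rule sets.sigma_sets_subset) auto

lemma sets_history: "sets (history t) = sigma_sets (space M) (sets (natural_filtration M B t) \<union> null_sets M)"
  unfolding completed_filtration_def
  using natural_filtration_subset[of t] by (intro sets_measure_of) (auto dest: sets.sets_into_space)

lemma space_history [simp]: "space (history t) = space M"
  unfolding completed_filtration_def by (rule space_measure_of_conv)

lemma history_subset: "sets (history t) \<subseteq> events"
  unfolding sets_history using natural_filtration_subset by (intro sets.sigma_sets_subset) auto

lemma history_mono: "s \<le> t \<Longrightarrow> sets (history s) \<subseteq> sets (history t)"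
  unfolding sets_history sets_natural_filtration
  by (intro sigma_sets_mono' Un_mono order_refl) force

lemma measurable_history_mono: "s \<le> t \<Longrightarrow> Z \<in> measurable (history s) N \<Longrightarrow> Z \<in> measurable (history t) N"
  using measurable_mono[of N N "history s" "history t"] history_mono by auto

lemma measurable_history: "Z \<in> measurable (history t) N \<Longrightarrow> Z \<in> measurable M N"
  using measurable_mono[of N N "history t" M] history_subset by auto

lemma null_sets_history: "N \<in> null_sets M \<Longrightarrow> N \<in> sets (history t)"
  unfolding sets_history by (rule sigma_sets.Basic) auto

lemma B_history: 
  assumes "0 \<le> s" "s \<le> t" shows "B s \<in> borel_measurable (history t)"
proof (rule measurableI)
  fix U :: "real set" assume "U \<in> sets borel"
  then have "B s -` U \<inter> space M \<in> sets (natural_filtration M B t)"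
    unfolding sets_natural_filtration using assms by (intro sigma_sets.Basic) auto
  then show "B s -` U \<inter> space (history t) \<in> sets (history t)"
    unfolding sets_history by (auto intro: sigma_sets.Basic)
qed simp

text \<open>Independence of Brownian increments is given for the natural filtration only. It passes to the completion
because completed events differ from natural ones by null sets.\<close>

lemma history_approx:
  assumes "A \<in> sets (history t)"
  shows "\<exists>A'\<in>sets (natural_filtration M B t). \<exists>N\<in>null_sets M. A - N = A' - N"
  using assms unfolding sets_history
proof (induction rule: sigma_sets.induct)
  case (Basic a)
  then show ?case
  proof
    assume "a \<in> null_sets M"
    then show ?thesis by (intro bexI[of _ "{}"] bexI[of _ a]) auto
  next
    assume "a \<in> sets (natural_filtration M B t)"
    then show ?thesis by (intro bexI[of _ a] bexI[of _ "{}"]) auto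
  qed
next
  case Empty
  then show ?case by (intro bexI[of _ "{}"]) auto
next
  case (Compl a)
  then obtain A' N where A': "A' \<in> sets (natural_filtration M B t)" "N \<in> null_sets M" "a - N = A' - N" by blast
  then have "space M - A' \<in> sets (natural_filtration M B t)"
    using sets.compl_sets[of A' "natural_filtration M B t"] by (simp add: space_natural_filtration)
  moreover have "(space M - a) - N = (space M - A') - N" using A'(3) by blast
  ultimately show ?case using A'(2) by blast
next
  case (Union a)
  then obtain A' N where A': "\<And>i. A' i \<in> sets (natural_filtration M B t)" "\<And>i. N i \<in> null_sets M" 
      "\<And>i. a i - N i = A' i - N i" by metis
  have "\<Union>(range a) - \<Union>(range N) = \<Union>(range A') - \<Union>(range N)"
    using A'(3) by (auto 4 3 simp: set_eq_iff)
  moreover have "\<Union>(range A') \<in> sets (natural_filtration M B t)" "\<Union>(range N) \<in> null_sets M"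
    using A' by (auto intro: sets.countable_UN null_sets_UN)
  ultimately show ?case by blast
qed

lemma increment_indep:
  assumes "0 \<le> s" "s < t" "A \<in> sets (history s)" "U \<in> sets borel"
  shows "prob (A \<inter> ((\<lambda>\<omega>. B t \<omega> - B s \<omega>) -` U \<inter> space M)) =
    prob A * prob ((\<lambda>\<omega>. B t \<omega> - B s \<omega>) -` U \<inter> space M)"
proof -
  let ?D = "(\<lambda>\<omega>. B t \<omega> - B s \<omega>) -` U \<inter> space M"
  have ind: "indep_set (sets (natural_filtration M B s)) {(\<lambda>\<omega>. B t \<omega> - B s \<omega>) -` U \<inter> space M | U. U \<in> sets borel}"
    using brownian assms by (auto simp: brownian_motion_def)
  obtain A' N where A': "A' \<in> sets (natural_filtration M B s)" "N \<in> null_sets M" "A - N = A' - N"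
    using history_approx[OF assms(3)] by blast
  have [measurable]: "B s \<in> borel_measurable M" "B t \<in> borel_measurable M" using assms by auto
  have [measurable]: "A \<in> events" "A' \<in> events"
    using A'(1) assms(3) history_subset[of s] natural_filtration_subset[of s] by auto
  have [measurable]: "?D \<in> events" using assms(4) by measurable
  have ae: "AE \<omega> in M. \<omega> \<in> A \<longleftrightarrow> \<omega> \<in> A'"
    using AE_not_in[OF A'(2)] by eventually_elim (use A'(3) in blast)
  have "prob (A \<inter> ?D) = prob (A' \<inter> ?D)"
    by (rule finite_measure_eq_AE) (use ae in \<open>auto elim: eventually_mono\<close>)
  also have "\<dots> = prob A' * prob ?D" 
    using A' assms by (intro indep_setD[OF ind]) auto
  also have "prob A' = prob A" by (rule finite_measure_eq_AE) (use ae in \<open>auto elim: eventually_mono\<close>)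
  finally show ?thesis .
qed

text \<open>The function \<open>g\<close> of the increment allows for targets other than the reals, in particular for complex
exponentials.\<close>

lemma increment_indep_var:
  assumes st: "0 \<le> s" "s < t" and Z: "Z \<in> measurable (history s) N" and g: "g \<in> measurable borel K"
  shows "indep_var N Z K (\<lambda>\<omega>. g (B t \<omega> - B s \<omega>))"
proof -
  let ?D = "{(\<lambda>\<omega>. B t \<omega> - B s \<omega>) -` U \<inter> space M |U. U \<in> sets borel}"
  have [measurable]: "B s \<in> borel_measurable M" "B t \<in> borel_measurable M" using st by auto
  have D: "(\<lambda>\<omega>. B t \<omega> - B s \<omega>) \<in> borel_measurable M" by measurable
  have 1: "sigma_sets (space M) {Z -` A \<inter> space M |A. A \<in> sets N} \<subseteq> sets (history s)"
    using measurable_sets[OF Z] by (intro sets.sigma_sets_subset[of _ "history s", simplified]) auto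
  have "sigma_sets (space M) {(\<lambda>\<omega>. g (B t \<omega> - B s \<omega>)) -` A \<inter> space M |A. A \<in> sets K} \<subseteq> sigma_sets (space M) ?D"
  proof (rule sigma_sets_mono')
    show "{(\<lambda>\<omega>. g (B t \<omega> - B s \<omega>)) -` A \<inter> space M |A. A \<in> sets K} \<subseteq> ?D"
    proof clarify
      fix A assume "A \<in> sets K"
      then have "g -` A \<in> sets borel" using measurable_sets[OF g, of A] by simp
      then show "\<exists>U. (\<lambda>\<omega>. g (B t \<omega> - B s \<omega>)) -` A \<inter> space M = (\<lambda>\<omega>. B t \<omega> - B s \<omega>) -` U \<inter> space M \<and> U \<in> sets borel"
        by (intro exI[of _ "g -` A"]) auto
    qed
  qed
  also have "sigma_sets (space M) ?D = ?D"
    using sigma_sets_vimage_commute[of "\<lambda>\<omega>. B t \<omega> - B s \<omega>" "space M" UNIV "sets borel"]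
      sets.sigma_sets_eq[of "borel :: real measure"] by simp
  finally have 2: "sigma_sets (space M) {(\<lambda>\<omega>. g (B t \<omega> - B s \<omega>)) -` A \<inter> space M |A. A \<in> sets K} \<subseteq> ?D" .
  show ?thesis
    unfolding indep_var_eq
  proof (intro conjI indep_setI)
    show "sigma_sets (space M) {Z -` A \<inter> space M |A. A \<in> sets N} \<subseteq> events"
      using 1 history_subset by blast
    show "sigma_sets (space M) {(\<lambda>\<omega>. g (B t \<omega> - B s \<omega>)) -` A \<inter> space M |A. A \<in> sets K} \<subseteq> events"
      using 2 measurable_sets[OF D] by auto
    fix a b assume a: "a \<in> sigma_sets (space M) {Z -` A \<inter> space M |A. A \<in> sets N}"
      and "b \<in> sigma_sets (space M) {(\<lambda>\<omega>. g (B t \<omega> - B s \<omega>)) -` A \<inter> space M |A. A \<in> sets K}"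
    then obtain U where "U \<in> sets borel" "b = (\<lambda>\<omega>. B t \<omega> - B s \<omega>) -` U \<inter> space M" using 2 by blast
    then show "prob (a \<inter> b) = prob a * prob b" using a 1 increment_indep[OF st, of a U] by auto
  qed (use measurable_history[OF Z] measurable_compose[OF D g] in auto)
qed

lemma increment_distributed:
  "0 \<le> s \<Longrightarrow> s < t \<Longrightarrow> distributed M lborel (\<lambda>\<omega>. B t \<omega> - B s \<omega>) (normal_density 0 (sqrt (t - s)))"
  using brownian by (simp add: brownian_motion_def)

lemma increment_moments:
  assumes "0 \<le> s" "s \<le> t"
  shows "integrable M (\<lambda>\<omega>. B t \<omega> - B s \<omega>)" "expectation (\<lambda>\<omega>. B t \<omega> - B s \<omega>) = 0"
    "integrable M (\<lambda>\<omega>. (B t \<omega> - B s \<omega>)\<^sup>2)" "expectation (\<lambda>\<omega>. (B t \<omega> - B s \<omega>)\<^sup>2) = t - s"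
proof -
  have "integrable M (\<lambda>\<omega>. B t \<omega> - B s \<omega>) \<and> expectation (\<lambda>\<omega>. B t \<omega> - B s \<omega>) = 0 \<and>
    integrable M (\<lambda>\<omega>. (B t \<omega> - B s \<omega>)\<^sup>2) \<and> expectation (\<lambda>\<omega>. (B t \<omega> - B s \<omega>)\<^sup>2) = t - s"
  proof (cases "s = t")
    case False
    define d where "d = sqrt (t - s)"
    have d: "d > 0" using False assms by (simp add: d_def)
    note D = increment_distributed[OF assms(1), of t, folded d_def]
    have st: "s < t" using False assms by simp
    note i1 = distributed_integrable[OF D[OF st], of "\<lambda>x. x"] and i2 = distributed_integrable[OF D[OF st], of "\<lambda>x. x\<^sup>2"]
    note e1 = distributed_integral[OF D[OF st], of "\<lambda>x. x"] and e2 = distributed_integral[OF D[OF st], of "\<lambda>x. x\<^sup>2"]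
    have "(\<integral>x. normal_density 0 d x * (x - 0) ^ (2 * 1) \<partial>lborel) = fact (2 * 1) / ((2 / d\<^sup>2) ^ 1 * fact 1)"
      by (rule integral_normal_moment_even[OF d])
    then have "(\<integral>x. normal_density 0 d x * x\<^sup>2 \<partial>lborel) = t - s" using d assms by (simp add: d_def)
    moreover have "(\<integral>x. normal_density 0 d x * x \<partial>lborel) = 0"
      using integral_normal_moment_odd[OF d, of 0 0] by simp
    moreover have "integrable lborel (\<lambda>x. normal_density 0 d x * x)" "integrable lborel (\<lambda>x. normal_density 0 d x * x\<^sup>2)"
      using integrable_normal_moment[OF d, of 0 1] integrable_normal_moment[OF d, of 0 2] by simp_all
    ultimately show ?thesis using i1 e1 i2 e2 by simp
  qed simp
  then show "integrable M (\<lambda>\<omega>. B t \<omega> - B s \<omega>)" "expectation (\<lambda>\<omega>. B t \<omega> - B s \<omega>) = 0"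
    "integrable M (\<lambda>\<omega>. (B t \<omega> - B s \<omega>)\<^sup>2)" "expectation (\<lambda>\<omega>. (B t \<omega> - B s \<omega>)\<^sup>2) = t - s" by auto
qed

lemma increment_martingale:
  fixes Z :: "'a \<Rightarrow> real"
  assumes st: "0 \<le> s" "s \<le> t" and Z: "Z \<in> borel_measurable (history s)" "integrable M Z"
  shows "has_bochner_integral M (\<lambda>\<omega>. Z \<omega> * (B t \<omega> - B s \<omega>)) 0"
    "has_bochner_integral M (\<lambda>\<omega>. Z \<omega> * (B t \<omega> - B s \<omega>)\<^sup>2) (expectation Z * (t - s))"
proof -
  have "has_bochner_integral M (\<lambda>\<omega>. Z \<omega> * (B t \<omega> - B s \<omega>)) 0 \<and>
    has_bochner_integral M (\<lambda>\<omega>. Z \<omega> * (B t \<omega> - B s \<omega>)\<^sup>2) (expectation Z * (t - s))"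
  proof (cases "s = t")
    case False
    then have "s < t" using st by simp
    then have ind: "indep_var borel Z borel (\<lambda>\<omega>. B t \<omega> - B s \<omega>)"
      and ind2: "indep_var borel Z borel (\<lambda>\<omega>. (B t \<omega> - B s \<omega>)\<^sup>2)"
      by (intro increment_indep_var[OF st(1) _ Z(1)]; simp)+
    note m = increment_moments[OF st]
    show ?thesis
      using indep_var_integrable[OF ind Z(2) m(1)] indep_var_lebesgue_integral[OF ind Z(2) m(1)]
        indep_var_integrable[OF ind2 Z(2) m(3)] indep_var_lebesgue_integral[OF ind2 Z(2) m(3)] m
      by (simp add: has_bochner_integral_iff)
  qed (simp add: has_bochner_integral_zero)
  then show "has_bochner_integral M (\<lambda>\<omega>. Z \<omega> * (B t \<omega> - B s \<omega>)) 0"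
    "has_bochner_integral M (\<lambda>\<omega>. Z \<omega> * (B t \<omega> - B s \<omega>)\<^sup>2) (expectation Z * (t - s))" by auto
qed

definition bounded_history :: "real \<Rightarrow> ('a \<Rightarrow> real) \<Rightarrow> bool" where
  "bounded_history s Z \<longleftrightarrow> Z \<in> borel_measurable (history s) \<and> (\<exists>K. \<forall>\<omega>\<in>space M. \<bar>Z \<omega>\<bar> \<le> K)"

lemma bounded_history_integrable:
  assumes "bounded_history s Z" "integrable M Y"
  shows "integrable M (\<lambda>\<omega>. Z \<omega> * Y \<omega>)"
proof -
  obtain K where K: "\<And>\<omega>. \<omega> \<in> space M \<Longrightarrow> \<bar>Z \<omega>\<bar> \<le> K" using assms by (auto simp: bounded_history_def)
  have mm: "Z \<in> borel_measurable M" "Y \<in> borel_measurable M"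
    using assms by (auto simp: bounded_history_def intro: measurable_history)
  have "AE \<omega> in M. norm (Z \<omega> * Y \<omega>) \<le> norm (K * Y \<omega>)"
  proof (rule AE_I2)
    fix \<omega> assume "\<omega> \<in> space M"
    then have "\<bar>Z \<omega>\<bar> \<le> \<bar>K\<bar>" using K[of \<omega>] by simp
    then show "norm (Z \<omega> * Y \<omega>) \<le> norm (K * Y \<omega>)" by (simp add: abs_mult mult_right_mono)
  qed
  then show ?thesis
    using assms(2) by (intro Bochner_Integration.integrable_bound[of M "\<lambda>\<omega>. K * Y \<omega>" "\<lambda>\<omega>. Z \<omega> * Y \<omega>"]
      integrable_mult_right borel_measurable_times) (simp_all add: mm)
qed

lemma bounded_history_mult:
  assumes "bounded_history r Z" "bounded_history s Y" "r \<le> t" "s \<le> t"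
  shows "bounded_history t (\<lambda>\<omega>. Z \<omega> * Y \<omega>)"
proof -
  obtain K L where "\<And>\<omega>. \<omega> \<in> space M \<Longrightarrow> \<bar>Z \<omega>\<bar> \<le> K" "\<And>\<omega>. \<omega> \<in> space M \<Longrightarrow> \<bar>Y \<omega>\<bar> \<le> L"
    using assms by (auto simp: bounded_history_def)
  then have "\<bar>Z \<omega> * Y \<omega>\<bar> \<le> \<bar>K\<bar> * \<bar>L\<bar>" if "\<omega> \<in> space M" for \<omega>
    using that unfolding abs_mult by (intro mult_mono) (auto intro: order_trans[OF _ abs_ge_self])
  then show ?thesis
    using assms unfolding bounded_history_def
    by (auto intro!: borel_measurable_times intro: measurable_history_mono)
qed

text \<open>Split the two increments at the end points of the common part of their intervals. Every product of
increments over disjoint intervals has mean zero, since the later one is independent of the rest, and only the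
square over the common part remains.\<close>

lemma increment_product:
  assumes ab: "0 \<le> a" "a \<le> b" "0 \<le> a'" "a' \<le> b'" "a \<le> a'"
    and K: "bounded_history a' K"
  shows "has_bochner_integral M (\<lambda>\<omega>. K \<omega> * ((B b \<omega> - B a \<omega>) * (B b' \<omega> - B a' \<omega>)))
    (expectation K * measure lborel ({a<..b} \<inter> {a'<..b'}))"
proof -
  have Km: "K \<in> borel_measurable (history a')" using K by (simp add: bounded_history_def)
  have Dm: "(\<lambda>\<omega>. B v \<omega> - B u \<omega>) \<in> borel_measurable (history t)" if "0 \<le> u" "0 \<le> v" "u \<le> t" "v \<le> t" for u v t
    using that by (intro borel_measurable_diff B_history) auto
  have KD: "(\<lambda>\<omega>. K \<omega> * (B v \<omega> - B u \<omega>)) \<in> borel_measurable (history t)" "integrable M (\<lambda>\<omega>. K \<omega> * (B v \<omega> - B u \<omega>))"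
    if "0 \<le> u" "u \<le> v" "v \<le> t" "a' \<le> t" for u v t
  proof -
    show "(\<lambda>\<omega>. K \<omega> * (B v \<omega> - B u \<omega>)) \<in> borel_measurable (history t)"
      using that by (intro borel_measurable_times Dm measurable_history_mono[OF _ Km]) auto
    show "integrable M (\<lambda>\<omega>. K \<omega> * (B v \<omega> - B u \<omega>))"
      using that by (intro bounded_history_integrable[OF K] increment_moments)
  qed
  have Kint: "integrable M K" using bounded_history_integrable[OF K, of "\<lambda>_. 1"] by simp
  show ?thesis
  proof (cases "b \<le> a'")
    case True
    have e: "{a<..b} \<inter> {a'<..b'} = {}" using True by auto
    moreover have "has_bochner_integral M (\<lambda>\<omega>. K \<omega> * (B b \<omega> - B a \<omega>) * (B b' \<omega> - B a' \<omega>)) 0"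
      using ab True by (intro increment_martingale KD) auto
    ultimately show ?thesis unfolding e by (simp add: mult.assoc)
  next
    case False
    define m where "m = min b b'"
    have m: "a' \<le> m" "m \<le> b" "m \<le> b'" "0 \<le> m" "m = b \<or> m = b'" using False ab by (auto simp: m_def)
    have "{a<..b} \<inter> {a'<..b'} = {a'<..m}" using ab by (auto simp: m_def)
    then have meas: "measure lborel ({a<..b} \<inter> {a'<..b'}) = m - a'" using m by simp
    have "has_bochner_integral M (\<lambda>\<omega>. K \<omega> * (B a' \<omega> - B a \<omega>) * (B b' \<omega> - B a' \<omega>) + K \<omega> * (B m \<omega> - B a' \<omega>)\<^sup>2
       + K \<omega> * (B m \<omega> - B a' \<omega>) * (B b' \<omega> - B m \<omega>) + K \<omega> * (B m \<omega> - B a' \<omega>) * (B b \<omega> - B m \<omega>))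
       (0 + expectation K * (m - a') + 0 + 0)"
      using ab m by (intro has_bochner_integral_add increment_martingale KD Km Kint) auto
    moreover have "K \<omega> * (B a' \<omega> - B a \<omega>) * (B b' \<omega> - B a' \<omega>) + K \<omega> * (B m \<omega> - B a' \<omega>)\<^sup>2
       + K \<omega> * (B m \<omega> - B a' \<omega>) * (B b' \<omega> - B m \<omega>) + K \<omega> * (B m \<omega> - B a' \<omega>) * (B b \<omega> - B m \<omega>)
       = K \<omega> * ((B b \<omega> - B a \<omega>) * (B b' \<omega> - B a' \<omega>))" for \<omega>
      using m(5) by (auto simp: power2_eq_square algebra_simps)
    ultimately show ?thesis unfolding meas by simp
  qed
qed

lemma step_product:
  assumes "0 \<le> a" "a \<le> b" "0 \<le> a'" "a' \<le> b'" "bounded_history a c" "bounded_history a' c'"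
  shows "has_bochner_integral M (\<lambda>\<omega>. (c \<omega> * (B b \<omega> - B a \<omega>)) * (c' \<omega> * (B b' \<omega> - B a' \<omega>)))
    (expectation (\<lambda>\<omega>. c \<omega> * c' \<omega>) * measure lborel ({a<..b} \<inter> {a'<..b'}))"
proof (cases "a \<le> a'")
  case True
  have "bounded_history a' (\<lambda>\<omega>. c \<omega> * c' \<omega>)" using bounded_history_mult[OF assms(5,6) True order_refl] .
  from increment_product[OF assms(1-4) True this] show ?thesis by (simp add: mult_ac)
next
  case False
  then have "a' \<le> a" by simp
  have "bounded_history a (\<lambda>\<omega>. c \<omega> * c' \<omega>)" using bounded_history_mult[OF assms(5,6) order_refl \<open>a' \<le> a\<close>] .
  from increment_product[OF assms(3,4,1,2) \<open>a' \<le> a\<close> this] show ?thesis by (simp add: mult_ac Int_commute)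
qed

text \<open>The intervals may overlap, so that differences of step processes over different partitions are covered
without passing to a common refinement.\<close>

lemma ito_isometry:
  assumes I: "finite I" and ab: "\<And>i. i \<in> I \<Longrightarrow> 0 \<le> a i \<and> a i \<le> b i"
    and c: "\<And>i. i \<in> I \<Longrightarrow> bounded_history (a i) (c i)"
  shows "(\<integral>\<^sup>+\<omega>. ennreal ((\<Sum>i\<in>I. c i \<omega> * (B (b i) \<omega> - B (a i) \<omega>))\<^sup>2) \<partial>M) =
    (\<integral>\<^sup>+\<omega>. (\<integral>\<^sup>+s. ennreal ((\<Sum>i\<in>I. c i \<omega> * indicator {a i<..b i} s)\<^sup>2) \<partial>lborel) \<partial>M)"
proof -
  let ?m = "\<lambda>i j. measure lborel ({a i<..b i} \<inter> {a j<..b j})"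
  have sq: "(\<Sum>i\<in>I. x i)\<^sup>2 = (\<Sum>i\<in>I. \<Sum>j\<in>I. x i * x j)" for x :: "'b \<Rightarrow> real"
    by (simp add: power2_eq_square sum_product)
  have cc: "integrable M (\<lambda>\<omega>. c i \<omega> * c j \<omega>)" if "i \<in> I" "j \<in> I" for i j
    using bounded_history_integrable[OF c[OF that(1)], of "c j"] bounded_history_integrable[OF c[OF that(2)], of "\<lambda>_. 1"]
    by simp
  have inner: "(\<integral>\<^sup>+s. ennreal ((\<Sum>i\<in>I. c i \<omega> * indicator {a i<..b i} s)\<^sup>2) \<partial>lborel)
      = ennreal (\<Sum>i\<in>I. \<Sum>j\<in>I. c i \<omega> * c j \<omega> * ?m i j)"
    and nonneg: "0 \<le> (\<Sum>i\<in>I. \<Sum>j\<in>I. c i \<omega> * c j \<omega> * ?m i j)" for \<omega>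
  proof -
    have "has_bochner_integral lborel (\<lambda>s. indicator ({a i<..b i} \<inter> {a j<..b j}) s :: real) (?m i j)" for i j
    proof (rule has_bochner_integral_real_indicator)
      have "emeasure lborel ({a i<..b i} \<inter> {a j<..b j}) \<le> emeasure lborel {a i..b i}"
        by (intro emeasure_mono) auto
      then show "emeasure lborel ({a i<..b i} \<inter> {a j<..b j}) < \<infinity>" by (auto simp: emeasure_lborel_Icc_eq intro: le_less_trans split: if_splits)
    qed auto
    then have "has_bochner_integral lborel (\<lambda>s. \<Sum>i\<in>I. \<Sum>j\<in>I. c i \<omega> * c j \<omega> * indicator ({a i<..b i} \<inter> {a j<..b j}) s)
        (\<Sum>i\<in>I. \<Sum>j\<in>I. c i \<omega> * c j \<omega> * ?m i j)"
      by (intro has_bochner_integral_sum has_bochner_integral_mult_right) auto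
    moreover have "(\<Sum>i\<in>I. \<Sum>j\<in>I. c i \<omega> * c j \<omega> * indicator ({a i<..b i} \<inter> {a j<..b j}) s)
        = (\<Sum>i\<in>I. c i \<omega> * indicator {a i<..b i} s)\<^sup>2" for s
      unfolding sq by (intro sum.cong refl) (simp only: indicator_inter_arith mult_ac)
    ultimately have *: "has_bochner_integral lborel (\<lambda>s. (\<Sum>i\<in>I. c i \<omega> * indicator {a i<..b i} s)\<^sup>2)
        (\<Sum>i\<in>I. \<Sum>j\<in>I. c i \<omega> * c j \<omega> * ?m i j)" by simp
    then show "(\<integral>\<^sup>+s. ennreal ((\<Sum>i\<in>I. c i \<omega> * indicator {a i<..b i} s)\<^sup>2) \<partial>lborel)
      = ennreal (\<Sum>i\<in>I. \<Sum>j\<in>I. c i \<omega> * c j \<omega> * ?m i j)"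
      by (subst nn_integral_eq_integral) (auto simp: has_bochner_integral_iff)
    show "0 \<le> (\<Sum>i\<in>I. \<Sum>j\<in>I. c i \<omega> * c j \<omega> * ?m i j)"
      unfolding has_bochner_integral_integral_eq[OF *, symmetric] by (rule Bochner_Integration.integral_nonneg) simp
  qed
  have outer: "has_bochner_integral M (\<lambda>\<omega>. \<Sum>i\<in>I. \<Sum>j\<in>I. c i \<omega> * c j \<omega> * ?m i j)
      (\<Sum>i\<in>I. \<Sum>j\<in>I. expectation (\<lambda>\<omega>. c i \<omega> * c j \<omega>) * ?m i j)"
    using cc by (intro has_bochner_integral_sum has_bochner_integral_mult_left) (auto simp: has_bochner_integral_iff)
  have "has_bochner_integral M (\<lambda>\<omega>. \<Sum>i\<in>I. \<Sum>j\<in>I. (c i \<omega> * (B (b i) \<omega> - B (a i) \<omega>)) * (c j \<omega> * (B (b j) \<omega> - B (a j) \<omega>)))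
      (\<Sum>i\<in>I. \<Sum>j\<in>I. expectation (\<lambda>\<omega>. c i \<omega> * c j \<omega>) * ?m i j)"
    using ab c by (intro has_bochner_integral_sum step_product) auto
  then have lhs: "has_bochner_integral M (\<lambda>\<omega>. (\<Sum>i\<in>I. c i \<omega> * (B (b i) \<omega> - B (a i) \<omega>))\<^sup>2)
      (\<Sum>i\<in>I. \<Sum>j\<in>I. expectation (\<lambda>\<omega>. c i \<omega> * c j \<omega>) * ?m i j)" by (simp add: sq)
  have "(\<integral>\<^sup>+\<omega>. ennreal ((\<Sum>i\<in>I. c i \<omega> * (B (b i) \<omega> - B (a i) \<omega>))\<^sup>2) \<partial>M) 
      = ennreal (\<Sum>i\<in>I. \<Sum>j\<in>I. expectation (\<lambda>\<omega>. c i \<omega> * c j \<omega>) * ?m i j)"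
    using lhs by (subst nn_integral_eq_integral) (auto simp: has_bochner_integral_iff)
  moreover have "(\<integral>\<^sup>+\<omega>. ennreal (\<Sum>i\<in>I. \<Sum>j\<in>I. c i \<omega> * c j \<omega> * ?m i j) \<partial>M) 
      = ennreal (\<Sum>i\<in>I. \<Sum>j\<in>I. expectation (\<lambda>\<omega>. c i \<omega> * c j \<omega>) * ?m i j)"
    using outer nonneg by (subst nn_integral_eq_integral) (auto simp: has_bochner_integral_iff)
  ultimately show ?thesis by (simp add: inner)
qed

end

section \<open>Integrals of deterministic functions as limits of sums\<close>

lemma square_diff_le:
  fixes x y z :: real
  shows "ennreal ((x - z)\<^sup>2) \<le> 2 * ennreal ((x - y)\<^sup>2) + 2 * ennreal ((y - z)\<^sup>2)"
proof -
  have "(x - z)\<^sup>2 \<le> 2 * (x - y)\<^sup>2 + 2 * (y - z)\<^sup>2"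
    using sum_squares_ge_zero[of "x - y - (y - z)" 0] by (simp add: power2_eq_square algebra_simps)
  then have "ennreal ((x - z)\<^sup>2) \<le> ennreal (2 * (x - y)\<^sup>2 + 2 * (y - z)\<^sup>2)" by (rule ennreal_leI)
  also have "\<dots> = 2 * ennreal ((x - y)\<^sup>2) + 2 * ennreal ((y - z)\<^sup>2)"
    by (simp add: ennreal_plus ennreal_mult)
  finally show ?thesis .
qed

lemma L2_triangle:
  fixes X Y Z :: "'b \<Rightarrow> real"
  assumes [measurable]: "X \<in> borel_measurable N" "Y \<in> borel_measurable N" "Z \<in> borel_measurable N"
  shows "(\<integral>\<^sup>+\<omega>. ennreal ((X \<omega> - Z \<omega>)\<^sup>2) \<partial>N) \<le>
    2 * (\<integral>\<^sup>+\<omega>. ennreal ((X \<omega> - Y \<omega>)\<^sup>2) \<partial>N) + 2 * (\<integral>\<^sup>+\<omega>. ennreal ((Y \<omega> - Z \<omega>)\<^sup>2) \<partial>N)"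
proof -
  have "(\<integral>\<^sup>+\<omega>. ennreal ((X \<omega> - Z \<omega>)\<^sup>2) \<partial>N) \<le> (\<integral>\<^sup>+\<omega>. 2 * ennreal ((X \<omega> - Y \<omega>)\<^sup>2) + 2 * ennreal ((Y \<omega> - Z \<omega>)\<^sup>2) \<partial>N)"
    by (intro nn_integral_mono square_diff_le)
  also have "\<dots> = 2 * (\<integral>\<^sup>+\<omega>. ennreal ((X \<omega> - Y \<omega>)\<^sup>2) \<partial>N) + 2 * (\<integral>\<^sup>+\<omega>. ennreal ((Y \<omega> - Z \<omega>)\<^sup>2) \<partial>N)"
    by (simp add: nn_integral_add nn_integral_cmult)
  finally show ?thesis .
qed

lemma tendsto_0_le_double_sum:
  fixes f g h :: "nat \<Rightarrow> ennreal"
  assumes "\<And>k. f k \<le> 2 * g k + 2 * h k" "g \<longlonglongrightarrow> 0" "h \<longlonglongrightarrow> 0"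
  shows "f \<longlonglongrightarrow> 0"
proof -
  have "(\<lambda>k. 2 * g k + 2 * h k) \<longlonglongrightarrow> 2 * 0 + 2 * 0"
    by (intro tendsto_add ennreal_tendsto_cmult assms) auto
  then have "(\<lambda>k. 2 * g k + 2 * h k) \<longlonglongrightarrow> 0" by simp
  then show ?thesis
    by (intro tendsto_sandwich[of "\<lambda>_. 0" f sequentially "\<lambda>k. 2 * g k + 2 * h k" 0]) (simp_all add: assms(1))
qed

lemma L2_AE_subseq:
  fixes U :: "nat \<Rightarrow> 'b \<Rightarrow> real"
  assumes [measurable]: "\<And>k. U k \<in> borel_measurable N" 
    and lim: "(\<lambda>k. \<integral>\<^sup>+\<omega>. ennreal ((U k \<omega>)\<^sup>2) \<partial>N) \<longlonglongrightarrow> 0"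
  shows "\<exists>r. strict_mono r \<and> (AE \<omega> in N. (\<lambda>k. U (r k) \<omega>) \<longlonglongrightarrow> 0)"
proof -
  have "\<forall>\<^sub>F k in sequentially. (\<integral>\<^sup>+\<omega>. ennreal ((U k \<omega>)\<^sup>2) \<partial>N) < 1"
    using lim by (rule order_tendstoD) simp
  then obtain K where K: "\<And>k. k \<ge> K \<Longrightarrow> (\<integral>\<^sup>+\<omega>. ennreal ((U k \<omega>)\<^sup>2) \<partial>N) < 1"
    unfolding eventually_sequentially by blast
  have int: "integrable N (\<lambda>\<omega>. (U (k + K) \<omega>)\<^sup>2)" for k
    using K[of "k + K"] by (intro integrableI_nonneg) (auto intro: less_trans)
  have "(\<lambda>k. \<integral>\<^sup>+\<omega>. ennreal ((U (k + K) \<omega>)\<^sup>2) \<partial>N) \<longlonglongrightarrow> ennreal 0"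
    using LIMSEQ_ignore_initial_segment[OF lim, of K] by simp
  from tendsto_enn2real[OF this order_refl] have "(\<lambda>k. \<integral>\<omega>. norm ((U (k + K) \<omega>)\<^sup>2) \<partial>N) \<longlonglongrightarrow> 0"
    by (simp add: integral_eq_nn_integral)
  from tendsto_L1_AE_subseq[OF int this] obtain r where r: "strict_mono r" 
    "AE \<omega> in N. (\<lambda>k. (U (r k + K) \<omega>)\<^sup>2) \<longlonglongrightarrow> 0" by blast
  have "AE \<omega> in N. (\<lambda>k. U (r k + K) \<omega>) \<longlonglongrightarrow> 0"
    using r(2)
  proof eventually_elim
    case (elim \<omega>)
    then have "(\<lambda>k. sqrt ((U (r k + K) \<omega>)\<^sup>2)) \<longlonglongrightarrow> sqrt 0" by (rule tendsto_real_sqrt)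
    then show ?case by (simp add: tendsto_rabs_zero_iff)
  qed
  then show ?thesis using r(1) by (intro exI[of _ "\<lambda>k. r k + K"]) (auto simp: strict_mono_def)
qed

locale fine_partitions =
  fixes p :: "nat \<Rightarrow> nat \<Rightarrow> real" and n :: "nat \<Rightarrow> nat" and t :: real
  assumes mono_p: "\<And>k. incseq (p k)"
    and start: "\<And>k. p k 0 = 0" and stop: "\<And>k. p k (n k) = t"
    and mesh: "\<And>d. d > 0 \<Longrightarrow> \<forall>\<^sub>F k in sequentially. \<forall>i<n k. p k (Suc i) - p k i < d"
begin

lemma p_range: "i \<le> n k \<Longrightarrow> 0 \<le> p k i \<and> p k i \<le> t"
  using incseqD[OF mono_p[of k], of 0 i] incseqD[OF mono_p[of k], of i "n k"] by (simp add: start stop)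

lemma uniform_on_pieces:
  fixes g :: "real \<Rightarrow> real"
  assumes "continuous_on {0..t} g" "\<epsilon> > 0"
  shows "\<forall>\<^sub>F k in sequentially. \<forall>i<n k. \<forall>r\<in>{p k i..p k (Suc i)}. \<bar>g (p k i) - g r\<bar> < \<epsilon>"
proof -
  have "uniformly_continuous_on {0..t} g" using assms(1) by (rule compact_uniformly_continuous) simp
  then obtain d where d: "d > 0" "\<And>x y. x \<in> {0..t} \<Longrightarrow> y \<in> {0..t} \<Longrightarrow> dist x y < d \<Longrightarrow> dist (g x) (g y) < \<epsilon>"
    using \<open>\<epsilon> > 0\<close> unfolding uniformly_continuous_on_def by metis
  from mesh[OF d(1)] show ?thesis
  proof eventually_elim
    case (elim k)
    show ?case
    proof (intro allI impI ballI)
      fix i r assume i: "i < n k" and r: "r \<in> {p k i..p k (Suc i)}"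
      then have "p k (Suc i) - p k i < d" using elim by blast
      then have "dist (p k i) r < d" using r by (auto simp: dist_real_def)
      moreover have "p k i \<in> {0..t}" "r \<in> {0..t}" using p_range[of i k] p_range[of "Suc i" k] i r by auto
      ultimately show "\<bar>g (p k i) - g r\<bar> < \<epsilon>" using d(2)[of "p k i" r] by (simp add: dist_real_def)
    qed
  qed
qed

definition step :: "(real \<Rightarrow> real) \<Rightarrow> nat \<Rightarrow> real \<Rightarrow> real" where
  "step g k r = (\<Sum>i<n k. g (p k i) * indicator {p k i<..p k (Suc i)} r)"

lemma step_value:
  assumes "0 < r" "r \<le> t"
  shows "\<exists>i<n k. r \<in> {p k i..p k (Suc i)} \<and> step g k r = g (p k i)"
proof -
  define i where "i = (LEAST j. r \<le> p k (Suc j))"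
  have "n k \<noteq> 0" using start[of k] stop[of k] assms by (metis leD)
  then have ex: "r \<le> p k (Suc (n k - 1))" using assms stop[of k] by simp
  have i: "r \<le> p k (Suc i)" unfolding i_def by (rule LeastI[of "\<lambda>j. r \<le> p k (Suc j)", OF ex])
  have "i \<le> n k - 1" unfolding i_def by (rule Least_le[of "\<lambda>j. r \<le> p k (Suc j)", OF ex])
  then have "i < n k" using \<open>n k \<noteq> 0\<close> by simp
  have pi: "p k i < r"
  proof (cases i)
    case 0 then show ?thesis using start assms by simp
  next
    case (Suc j)
    then have "\<not> r \<le> p k (Suc j)" using not_less_Least[of j "\<lambda>j. r \<le> p k (Suc j)"] by (simp add: i_def)
    then show ?thesis using Suc by simp
  qed
  have "indicator {p k j<..p k (Suc j)} r = (if j = i then 1 else 0 :: real)" for j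
  proof (cases j i rule: linorder_cases)
    case less
    then have "p k (Suc j) \<le> p k i" by (intro incseqD[OF mono_p]) simp
    then show ?thesis using pi less by auto
  next
    case greater
    then have "p k (Suc i) \<le> p k j" by (intro incseqD[OF mono_p]) simp
    then show ?thesis using i greater by auto
  qed (use pi i in auto)
  then have "step g k r = (\<Sum>j<n k. if j = i then g (p k i) else 0)"
    unfolding step_def by (intro sum.cong) auto
  also have "\<dots> = g (p k i)" using \<open>i < n k\<close> by simp
  finally show ?thesis using \<open>i < n k\<close> pi i by auto
qed

lemma step_L2:
  fixes g :: "real \<Rightarrow> real"
  assumes "continuous_on {0..t} g" "t \<ge> 0"
  shows "(\<lambda>k. \<integral>\<^sup>+r\<in>{0..t}. ennreal ((step g k r - g r)\<^sup>2) \<partial>lborel) \<longlonglongrightarrow> 0"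
proof (rule tendsto_zero_ennreal)
  fix e' :: real assume "e' > 0"
  define e'' where "e'' = e' / 2"
  have e': "e'' > 0" "e'' < e'" using \<open>e' > 0\<close> by (auto simp: e''_def)
  define \<epsilon> where "\<epsilon> = sqrt (e'' / (t + 1))"
  have \<epsilon>: "\<epsilon> > 0" "\<epsilon>\<^sup>2 * t \<le> e''" using e' assms by (auto simp: \<epsilon>_def field_simps)
  show "\<forall>\<^sub>F k in sequentially. (\<integral>\<^sup>+r\<in>{0..t}. ennreal ((step g k r - g r)\<^sup>2) \<partial>lborel) < ennreal e'"
    using uniform_on_pieces[OF assms(1) \<epsilon>(1)]
  proof eventually_elim
    case (elim k)
    have "(\<integral>\<^sup>+r\<in>{0..t}. ennreal ((step g k r - g r)\<^sup>2) \<partial>lborel) \<le> (\<integral>\<^sup>+r. ennreal (\<epsilon>\<^sup>2) * indicator {0..t} r \<partial>lborel)"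
    proof (intro nn_integral_mono_AE)
      show "AE r in lborel. ennreal ((step g k r - g r)\<^sup>2) * indicator {0..t} r \<le> ennreal (\<epsilon>\<^sup>2) * indicator {0..t} r"
        using AE_lborel_singleton[of 0]
      proof eventually_elim
        case (elim r)
        show ?case
        proof (cases "r \<in> {0..t}")
          case True
          then obtain i where "i < n k" "r \<in> {p k i..p k (Suc i)}" "step g k r = g (p k i)"
            using step_value[of r k g] elim by auto
          then have "\<bar>step g k r - g r\<bar> < \<epsilon>" 
            using \<open>\<forall>i<n k. \<forall>r\<in>{p k i..p k (Suc i)}. \<bar>g (p k i) - g r\<bar> < \<epsilon>\<close> by simp
          then have "(step g k r - g r)\<^sup>2 \<le> \<epsilon>\<^sup>2" by (simp add: abs_le_square_iff[symmetric])
          then show ?thesis by (intro mult_right_mono ennreal_leI) auto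
        qed simp
      qed
    qed
    also have "\<dots> = ennreal (\<epsilon>\<^sup>2 * t)" using assms(2) by (simp add: nn_integral_cmult ennreal_mult)
    also have "\<dots> \<le> ennreal e''" using \<epsilon> by (intro ennreal_leI)
    also have "\<dots> < ennreal e'" using e' by (simp add: ennreal_less_iff)
    finally show ?case .
  qed
qed

lemma riemann_sum:
  fixes g :: "real \<Rightarrow> real"
  assumes g: "continuous_on {0..t} g" and m: "\<And>k. m k \<le> n k" "\<And>k. p k (m k) = s"
  shows "(\<lambda>k. \<Sum>i\<in>{m k..<n k}. g (p k i) * (p k (Suc i) - p k i)) \<longlonglongrightarrow> integral {s..t} g"
proof (rule tendstoI)
  fix e :: real assume "e > 0"
  have st: "0 \<le> s" "s \<le> t" using p_range[OF m(1)[of 0]] m(2)[of 0] by auto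
  have int: "g integrable_on {a..b}" if "0 \<le> a" "b \<le> t" for a b
    by (rule integrable_continuous_real) (use that in \<open>auto intro: continuous_on_subset[OF g]\<close>)
  define \<epsilon> where "\<epsilon> = e / (t - s + 1)"
  have \<epsilon>: "\<epsilon> > 0" "\<epsilon> * (t - s) < e" using \<open>e > 0\<close> st by (auto simp: \<epsilon>_def field_simps)
  show "\<forall>\<^sub>F k in sequentially. dist (\<Sum>i\<in>{m k..<n k}. g (p k i) * (p k (Suc i) - p k i)) (integral {s..t} g) < e"
    using uniform_on_pieces[OF g \<epsilon>(1)]
  proof eventually_elim
    case (elim k)
    have piece: "\<bar>g (p k i) * (p k (Suc i) - p k i) - integral {p k i..p k (Suc i)} g\<bar> \<le> \<epsilon> * (p k (Suc i) - p k i)"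
      if "i < n k" for i
    proof -
      have le: "p k i \<le> p k (Suc i)" by (intro incseqD[OF mono_p]) simp
      have rng: "0 \<le> p k i" "p k (Suc i) \<le> t" using p_range[of i k] p_range[of "Suc i" k] that by auto
      have "g (p k i) * (p k (Suc i) - p k i) - integral {p k i..p k (Suc i)} g 
          = integral {p k i..p k (Suc i)} (\<lambda>r. g (p k i) - g r)"
        using int[OF rng] le by (subst integral_diff) auto
      also have "norm \<dots> \<le> \<epsilon> * (p k (Suc i) - p k i)"
        using elim that by (intro integral_bound le continuous_intros continuous_on_subset[OF g])
          (use rng in \<open>auto intro: less_imp_le\<close>)
      finally show ?thesis by simp
    qed
    have tele: "(\<Sum>i\<in>{m k..<j}. integral {p k i..p k (Suc i)} g) = integral {s..p k j} g \<and>
        (\<Sum>i\<in>{m k..<j}. p k (Suc i) - p k i) = p k j - s" if "m k \<le> j" "j \<le> n k" for j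
      using that
    proof (induction j rule: dec_induct)
      case base
      then show ?case by (simp add: m)
    next
      case (step j)
      have "s \<le> p k j" "p k j \<le> p k (Suc j)" 
        using step incseqD[OF mono_p[of k], of "m k" j] m(2)[of k] incseqD[OF mono_p[of k], of j "Suc j"] by auto
      then have "integral {s..p k j} g + integral {p k j..p k (Suc j)} g = integral {s..p k (Suc j)} g"
        using step p_range[of "Suc j" k] st by (intro Henstock_Kurzweil_Integration.integral_combine int) auto
      then show ?case using step by simp
    qed
    have "\<bar>(\<Sum>i\<in>{m k..<n k}. g (p k i) * (p k (Suc i) - p k i)) - integral {s..t} g\<bar> 
        = \<bar>\<Sum>i\<in>{m k..<n k}. g (p k i) * (p k (Suc i) - p k i) - integral {p k i..p k (Suc i)} g\<bar>"
      using tele[OF m(1) order_refl] by (simp add: sum_subtractf stop)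
    also have "\<dots> \<le> (\<Sum>i\<in>{m k..<n k}. \<epsilon> * (p k (Suc i) - p k i))"
      by (intro order_trans[OF sum_abs] sum_mono piece) auto
    also have "\<dots> = \<epsilon> * (t - s)" using tele[OF m(1) order_refl] by (simp add: sum_distrib_left[symmetric] stop)
    finally show ?case using \<epsilon> by (simp add: dist_real_def)
  qed
qed

end

text \<open>Partitions of \<open>[0, t]\<close> that start with a partition of \<open>[0, s]\<close>: the integral over \<open>[s, t]\<close> is then
approximated by the second half of the sum for \<open>[0, t]\<close>.\<close>

lemma split_partitions:
  assumes "0 \<le> s" "s \<le> t"
  defines "p \<equiv> \<lambda>k i. if i \<le> Suc k then real i * s / real (Suc k) else s + real (i - Suc k) * (t - s) / real (Suc k)"
  shows "fine_partitions p (\<lambda>k. 2 * Suc k) t" "fine_partitions p Suc s" "\<And>k. p k (Suc k) = s"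
proof -
  have step: "0 \<le> p k (Suc i) - p k i \<and> p k (Suc i) - p k i \<le> t / real (Suc k)" for k i
  proof (cases "Suc i \<le> Suc k")
    case True
    then have "p k (Suc i) - p k i = (real (Suc i) * s - real i * s) / real (Suc k)"
      by (simp add: p_def diff_divide_distrib)
    also have "real (Suc i) * s - real i * s = s" by (simp add: algebra_simps)
    finally have "p k (Suc i) - p k i = s / real (Suc k)" .
    then show ?thesis using assms(1,2) by (simp add: divide_right_mono)
  next
    case False
    have "p k (Suc i) - p k i = (t - s) / real (Suc k)"
    proof (cases "i = Suc k")
      case True then show ?thesis by (simp add: p_def)
    next
      case False
      with \<open>\<not> Suc i \<le> Suc k\<close> have "i > Suc k" by simp
      then have e: "real (Suc i - Suc k) = real (i - Suc k) + 1" by (simp add: of_nat_diff)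
      have "p k (Suc i) - p k i = (real (Suc i - Suc k) * (t - s) - real (i - Suc k) * (t - s)) / real (Suc k)"
        using \<open>i > Suc k\<close> by (simp add: p_def diff_divide_distrib)
      also have "real (Suc i - Suc k) * (t - s) - real (i - Suc k) * (t - s) = t - s" unfolding e by (simp add: algebra_simps)
      finally show ?thesis .
    qed
    then show ?thesis using assms(1,2) by (simp add: divide_right_mono)
  qed
  have lim: "(\<lambda>k. t / real (Suc k)) \<longlonglongrightarrow> 0"
    using LIMSEQ_Suc[OF lim_const_over_n[of t]] by simp
  have mesh: "\<forall>\<^sub>F k in sequentially. \<forall>i<j k. p k (Suc i) - p k i < d" if "d > 0" for d and j :: "nat \<Rightarrow> nat"
    using order_tendstoD(2)[OF lim that]
  proof eventually_elim
    case (elim k)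
    then show ?case using step[of k] by (meson le_less_trans)
  qed
  have mono: "incseq (p k)" for k by (rule incseq_SucI) (use step[of k] in auto)
  show mid: "p k (Suc k) = s" for k by (simp add: p_def)
  have top: "p k (2 * Suc k) = t" for k by (simp add: p_def)
  have bot: "p k 0 = 0" for k by (simp add: p_def)
  show "fine_partitions p (\<lambda>k. 2 * Suc k) t" by unfold_locales (use mono top bot mesh in auto)
  show "fine_partitions p Suc s" by unfold_locales (use mono mid bot mesh in auto)
qed

locale wiener_integral = brownian +
  fixes \<sigma> :: "real \<Rightarrow> real" and J :: "real \<Rightarrow> 'a \<Rightarrow> real"
  assumes continuous_\<sigma>: "continuous_on {0..} \<sigma>"
    and ito: "\<And>t. t \<ge> 0 \<Longrightarrow> is_ito_integral M history B (\<lambda>s \<omega>. \<sigma> s) t (J t)"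
begin

lemma J_measurable [measurable]: "t \<ge> 0 \<Longrightarrow> J t \<in> borel_measurable M"
  using ito by (simp add: is_ito_integral_def)

definition increment_sum :: "(nat \<Rightarrow> real) \<Rightarrow> nat \<Rightarrow> nat \<Rightarrow> 'a \<Rightarrow> real" where
  "increment_sum p m n \<omega> = (\<Sum>i\<in>{m..<n}. \<sigma> (p i) * (B (p (Suc i)) \<omega> - B (p i) \<omega>))"

lemma increment_sum_history:
  assumes "incseq p" "0 \<le> p m" 
  shows "increment_sum p m n \<in> borel_measurable (history (p n))"
  unfolding increment_sum_def
proof (intro borel_measurable_sum borel_measurable_times borel_measurable_diff borel_measurable_const B_history)
  fix i assume "i \<in> {m..<n}"
  then show "0 \<le> p i" "0 \<le> p (Suc i)" "p i \<le> p n" "p (Suc i) \<le> p n"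
    using assms(2) incseqD[OF assms(1), of m i] incseqD[OF assms(1), of m "Suc i"] 
      incseqD[OF assms(1), of i n] incseqD[OF assms(1), of "Suc i" n] by auto
qed

lemma simple_process_times_nonneg:
  assumes "simple_process M G m q c" "i \<le> m"
  shows "0 \<le> q i"
  using assms(2)
proof (induction i)
  case 0
  then show ?case using assms(1) by (simp add: simple_process_def)
next
  case (Suc i)
  then have "q i < q (Suc i)" using assms(1) by (simp add: simple_process_def)
  with Suc show ?case by simp
qed

text \<open>The isometry for the difference of a deterministic step function and an arbitrary simple process, cut off
at \<open>t\<close>. The disjoint sum of the two index sets turns the difference into one step process; pieces starting
after \<open>t\<close> have to be left out, as their coefficients need not be known at time \<open>t\<close>.\<close>

lemma simple_process_isometry:
  assumes t: "t \<ge> 0" and C: "simple_process M history m q c"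
    and p: "incseq p" "p 0 = 0" "p n = t"
  shows "(\<integral>\<^sup>+\<omega>. ennreal ((increment_sum p 0 n \<omega> - simple_integral B m q c t \<omega>)\<^sup>2) \<partial>M) =
    (\<integral>\<^sup>+\<omega>. (\<integral>\<^sup>+s. ennreal (((\<Sum>i<n. \<sigma> (p i) * indicator {p i<..p (Suc i)} s) - simple_value m q c s \<omega>)\<^sup>2) * 
      indicator {0..t} s \<partial>lborel) \<partial>M)"
proof -
  define I where "I = {..<n} <+> {i. i < m \<and> q i \<le> t}"
  define a where "a = case_sum p q"
  define b where "b = case_sum (\<lambda>i. p (Suc i)) (\<lambda>i. min (q (Suc i)) t)"
  define d where "d = case_sum (\<lambda>i \<omega>. \<sigma> (p i)) (\<lambda>i \<omega>. - c i \<omega>)"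
  note q_mono = simple_process_times_nonneg[OF C]
  have finI: "finite I" by (simp add: I_def)
  have ab: "0 \<le> a i \<and> a i \<le> b i" if "i \<in> I" for i
  proof (cases i)
    case (Inl j)
    then show ?thesis using incseqD[OF p(1), of 0 j] incseqD[OF p(1), of j "Suc j"] p(2) by (simp add: a_def b_def)
  next
    case (Inr j)
    then have "j < m" "q j \<le> t" using that by (auto simp: I_def)
    then show ?thesis using Inr q_mono[of j] C by (auto simp: a_def b_def simple_process_def less_imp_le)
  qed
  have bd: "bounded_history (a i) (d i)" if "i \<in> I" for i
  proof (cases i)
    case (Inl j)
    then show ?thesis by (auto simp: bounded_history_def d_def)
  next
    case (Inr j)
    then have "j < m" using that by (auto simp: I_def)
    then show ?thesis using Inr C by (auto simp: bounded_history_def d_def a_def simple_process_def)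
  qed
  have sumI: "(\<Sum>i\<in>I. g i) = (\<Sum>i<n. g (Inl i)) + (\<Sum>i | i < m \<and> q i \<le> t. g (Inr i))" for g :: "nat + nat \<Rightarrow> real"
    unfolding I_def by (subst sum.Plus) auto
  have X: "(\<Sum>i\<in>I. d i \<omega> * (B (b i) \<omega> - B (a i) \<omega>)) = increment_sum p 0 n \<omega> - simple_integral B m q c t \<omega>" for \<omega>
  proof -
    have "(\<Sum>i<m. c i \<omega> * (B (min (q (Suc i)) t) \<omega> - B (min (q i) t) \<omega>)) 
        = (\<Sum>i | i < m \<and> q i \<le> t. c i \<omega> * (B (min (q (Suc i)) t) \<omega> - B (q i) \<omega>))"
    proof (rule sum.mono_neutral_cong_right)
      show "\<forall>i\<in>{..<m} - {i. i < m \<and> q i \<le> t}. c i \<omega> * (B (min (q (Suc i)) t) \<omega> - B (min (q i) t) \<omega>) = 0"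
      proof
        fix i assume i: "i \<in> {..<m} - {i. i < m \<and> q i \<le> t}"
        then have "q i < q (Suc i)" "t < q i" using C by (auto simp: simple_process_def)
        then show "c i \<omega> * (B (min (q (Suc i)) t) \<omega> - B (min (q i) t) \<omega>) = 0" by simp
      qed
    qed (auto simp: min_def)
    then show ?thesis
      unfolding sumI increment_sum_def simple_integral_def
      by (simp add: a_def b_def d_def atLeast0LessThan sum_negf)
  qed
  have Y: "ennreal ((\<Sum>i\<in>I. d i \<omega> * indicator {a i<..b i} s)\<^sup>2) = 
      ennreal (((\<Sum>i<n. \<sigma> (p i) * indicator {p i<..p (Suc i)} s) - simple_value m q c s \<omega>)\<^sup>2) * indicator {0..t} s" for s \<omega>
  proof (cases "s \<in> {0..t}")
    case True
    have "(\<Sum>i<m. c i \<omega> * indicator {q i<..q (Suc i)} s) 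
        = (\<Sum>i | i < m \<and> q i \<le> t. c i \<omega> * indicator {q i<..min (q (Suc i)) t} s)"
      using True by (intro sum.mono_neutral_cong_right) (auto simp: indicator_def)
    then show ?thesis using True unfolding sumI simple_value_def
      by (simp add: a_def b_def d_def sum_negf)
  next
    case False
    have "indicator {a i<..b i} s = (0 :: real)" if "i \<in> I" for i
    proof (cases i)
      case (Inl j)
      then have "j < n" using that by (auto simp: I_def)
      then have "p (Suc j) \<le> t" using incseqD[OF p(1), of "Suc j" n] p(3) by simp
      then show ?thesis using ab[OF that] False Inl by (auto simp: a_def b_def indicator_def)
    next
      case (Inr j)
      then show ?thesis using ab[OF that] False by (auto simp: a_def b_def indicator_def)
    qed
    then show ?thesis using False by simp
  qed
  have "(\<integral>\<^sup>+\<omega>. ennreal ((\<Sum>i\<in>I. d i \<omega> * (B (b i) \<omega> - B (a i) \<omega>))\<^sup>2) \<partial>M) =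
    (\<integral>\<^sup>+\<omega>. (\<integral>\<^sup>+s. ennreal ((\<Sum>i\<in>I. d i \<omega> * indicator {a i<..b i} s)\<^sup>2) \<partial>lborel) \<partial>M)"
    by (intro ito_isometry finI ab bd)
  then show ?thesis unfolding X Y .
qed

text \<open>The simple processes that define the integral may be random, but they converge to the same integrand as
the deterministic step functions, so by the isometry both have the same limit.\<close>

lemma increment_sum_L2:
  assumes t: "t \<ge> 0" and p: "fine_partitions p n t"
  shows "(\<lambda>k. \<integral>\<^sup>+\<omega>. ennreal ((increment_sum (p k) 0 (n k) \<omega> - J t \<omega>)\<^sup>2) \<partial>M) \<longlonglongrightarrow> 0"
proof -
  interpret fine_partitions p n t by fact
  interpret P: pair_sigma_finite lborel M by unfold_locales
  let ?I = "indicator {0..t} :: real \<Rightarrow> real"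
  have \<sigma>c: "continuous_on {0..t} \<sigma>" by (rule continuous_on_subset[OF continuous_\<sigma>]) auto
  have [measurable]: "(\<lambda>s. ?I s * \<sigma> s) \<in> borel_measurable borel"
    using borel_measurable_continuous_on_indicator[OF _ \<sigma>c] by simp
  obtain m q c where C: "\<And>k. simple_process M history (m k) (q k) (c k)"
    and E1: "(\<lambda>k. \<integral>\<^sup>+\<omega>. (\<integral>\<^sup>+s\<in>{0..t}. ennreal ((simple_value (m k) (q k) (c k) s \<omega> - \<sigma> s)\<^sup>2) \<partial>lborel) \<partial>M) \<longlonglongrightarrow> 0"
    and E3: "(\<lambda>k. \<integral>\<^sup>+\<omega>. ennreal ((simple_integral B (m k) (q k) (c k) t \<omega> - J t \<omega>)\<^sup>2) \<partial>M) \<longlonglongrightarrow> 0"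
    using ito[OF t] unfolding is_ito_integral_def by auto
  let ?Y = "\<lambda>k. simple_integral B (m k) (q k) (c k) t"
  define v where "v k s \<omega> = simple_value (m k) (q k) (c k) s \<omega>" for k s \<omega>
  have c_meas: "c k i \<in> borel_measurable M" if "i < m k" for k i
    using C[of k] that by (auto simp: simple_process_def intro: measurable_history)
  have [measurable]: "(\<lambda>x. v k (fst x) (snd x)) \<in> borel_measurable (lborel \<Otimes>\<^sub>M M)" for k
    unfolding v_def simple_value_def
  proof (intro borel_measurable_sum borel_measurable_times)
    fix i assume "i \<in> {..<m k}"
    then have [measurable]: "c k i \<in> borel_measurable M" using c_meas by simp
    show "(\<lambda>x. c k i (snd x)) \<in> borel_measurable (lborel \<Otimes>\<^sub>M M)" by measurable
    show "(\<lambda>x. indicat_real {q k i<..q k (Suc i)} (fst x)) \<in> borel_measurable (lborel \<Otimes>\<^sub>M M)" by measurable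
  qed
  have [measurable]: "?Y k \<in> borel_measurable M" for k
    unfolding simple_integral_def
  proof (intro borel_measurable_sum borel_measurable_times borel_measurable_diff)
    fix i assume "i \<in> {..<m k}"
    then show "c k i \<in> borel_measurable M" "B (min (q k (Suc i)) t) \<in> borel_measurable M" "B (min (q k i) t) \<in> borel_measurable M"
      using c_meas simple_process_times_nonneg[OF C] t by auto
  qed
  have [measurable]: "increment_sum (p k) 0 (n k) \<in> borel_measurable M" for k
    by (rule measurable_history[OF increment_sum_history]) (use mono_p start in auto)
  have [measurable]: "step \<sigma> k \<in> borel_measurable borel" for k unfolding step_def[abs_def] by measurable
  have cut: "ennreal ((?I s * x - ?I s * y)\<^sup>2) = ennreal ((x - y)\<^sup>2) * indicator {0..t} s" for s x y
    by (simp split: split_indicator)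
  \<comment> \<open>Mean square distances of processes on [0, t] as iterated integrals.\<close>
  have iter: "(\<integral>\<^sup>+x. ennreal ((?I (fst x) * F (fst x) (snd x) - ?I (fst x) * G (fst x) (snd x))\<^sup>2) \<partial>(lborel \<Otimes>\<^sub>M M)) =
      (\<integral>\<^sup>+\<omega>. (\<integral>\<^sup>+s\<in>{0..t}. ennreal ((F s \<omega> - G s \<omega>)\<^sup>2) \<partial>lborel) \<partial>M)"
    if [measurable]: "(\<lambda>x. ?I (fst x) * F (fst x) (snd x)) \<in> borel_measurable (lborel \<Otimes>\<^sub>M M)"
      "(\<lambda>x. ?I (fst x) * G (fst x) (snd x)) \<in> borel_measurable (lborel \<Otimes>\<^sub>M M)" for F G
  proof -
    have "(\<lambda>x. ennreal ((?I (fst x) * F (fst x) (snd x) - ?I (fst x) * G (fst x) (snd x))\<^sup>2)) \<in> borel_measurable (lborel \<Otimes>\<^sub>M M)"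
      by measurable
    from P.nn_integral_snd[OF this] show ?thesis by (simp add: cut)
  qed
  have "(\<lambda>k. \<integral>\<^sup>+\<omega>. ennreal ((increment_sum (p k) 0 (n k) \<omega> - ?Y k \<omega>)\<^sup>2) \<partial>M) \<longlonglongrightarrow> 0"
  proof (rule tendsto_0_le_double_sum)
    show "(\<lambda>k. \<integral>\<^sup>+r\<in>{0..t}. ennreal ((step \<sigma> k r - \<sigma> r)\<^sup>2) \<partial>lborel) \<longlonglongrightarrow> 0" by (rule step_L2[OF \<sigma>c t])
    show "(\<lambda>k. \<integral>\<^sup>+\<omega>. (\<integral>\<^sup>+s\<in>{0..t}. ennreal ((\<sigma> s - v k s \<omega>)\<^sup>2) \<partial>lborel) \<partial>M) \<longlonglongrightarrow> 0"
      using E1 by (simp add: v_def power2_commute[of "\<sigma> _"])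
    fix k
    have "(\<integral>\<^sup>+\<omega>. ennreal ((increment_sum (p k) 0 (n k) \<omega> - ?Y k \<omega>)\<^sup>2) \<partial>M) =
      (\<integral>\<^sup>+\<omega>. (\<integral>\<^sup>+s\<in>{0..t}. ennreal ((step \<sigma> k s - v k s \<omega>)\<^sup>2) \<partial>lborel) \<partial>M)"
      unfolding step_def v_def by (intro simple_process_isometry t C mono_p start stop)
    also have "\<dots> \<le> 2 * (\<integral>\<^sup>+\<omega>. (\<integral>\<^sup>+s\<in>{0..t}. ennreal ((step \<sigma> k s - \<sigma> s)\<^sup>2) \<partial>lborel) \<partial>M)
        + 2 * (\<integral>\<^sup>+\<omega>. (\<integral>\<^sup>+s\<in>{0..t}. ennreal ((\<sigma> s - v k s \<omega>)\<^sup>2) \<partial>lborel) \<partial>M)"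
      by (subst (1 2 3) iter[symmetric], measurable, rule L2_triangle) measurable
    also have "(\<integral>\<^sup>+\<omega>. (\<integral>\<^sup>+s\<in>{0..t}. ennreal ((step \<sigma> k s - \<sigma> s)\<^sup>2) \<partial>lborel) \<partial>M) 
        = (\<integral>\<^sup>+r\<in>{0..t}. ennreal ((step \<sigma> k r - \<sigma> r)\<^sup>2) \<partial>lborel)"
      by (simp add: emeasure_space_1)
    finally show "(\<integral>\<^sup>+\<omega>. ennreal ((increment_sum (p k) 0 (n k) \<omega> - ?Y k \<omega>)\<^sup>2) \<partial>M)
      \<le> 2 * (\<integral>\<^sup>+r\<in>{0..t}. ennreal ((step \<sigma> k r - \<sigma> r)\<^sup>2) \<partial>lborel)
        + 2 * (\<integral>\<^sup>+\<omega>. (\<integral>\<^sup>+s\<in>{0..t}. ennreal ((\<sigma> s - v k s \<omega>)\<^sup>2) \<partial>lborel) \<partial>M)" .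
  qed
  from tendsto_0_le_double_sum[OF L2_triangle this E3] show ?thesis using t by simp
qed

end

section \<open>The law of the increments of the integral\<close>

context brownian
begin

lemma increment_char:
  assumes "0 \<le> s" "s \<le> t"
  shows "(CLINT \<omega>|M. iexp (u * (B t \<omega> - B s \<omega>))) = exp (- (u\<^sup>2 * (t - s)) / 2)"
proof (cases "s = t")
  case True
  then show ?thesis by (simp add: prob_space)
next
  case False
  define d where "d = sqrt (t - s)"
  have d: "d > 0" "d\<^sup>2 = t - s" using False assms by (auto simp: d_def)
  have D: "distributed M lborel (\<lambda>\<omega>. B t \<omega> - B s \<omega>) (normal_density 0 d)"
    using increment_distributed[of s t] assms False by (simp add: d_def)
  then have N: "distributed M lborel (\<lambda>\<omega>. (B t \<omega> - B s \<omega>) / d) std_normal_density"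
    using normal_standard_normal_convert[OF d(1), of "\<lambda>\<omega>. B t \<omega> - B s \<omega>" 0] by simp
  then have [measurable]: "(\<lambda>\<omega>. (B t \<omega> - B s \<omega>) / d) \<in> borel_measurable M"
    by (auto dest: distributed_measurable)
  have "distr M lborel (\<lambda>\<omega>. (B t \<omega> - B s \<omega>) / d) = std_normal_distribution"
    using N by (rule distributed_distr_eq_density)
  then have "char (distr M lborel (\<lambda>\<omega>. (B t \<omega> - B s \<omega>) / d)) (u * d) = exp (- ((u * d)\<^sup>2) / 2)"
    by (simp add: char_std_normal_distribution)
  moreover have "char (distr M lborel (\<lambda>\<omega>. (B t \<omega> - B s \<omega>) / d)) (u * d) 
      = (CLINT \<omega>|M. iexp (u * d * ((B t \<omega> - B s \<omega>) / d)))"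
    unfolding char_def by (subst integral_distr) auto
  moreover have "(CLINT \<omega>|M. iexp (u * d * ((B t \<omega> - B s \<omega>) / d))) = (CLINT \<omega>|M. iexp (u * (B t \<omega> - B s \<omega>)))"
    using d by simp
  ultimately show ?thesis using d by (simp add: power_mult_distrib)
qed

end

context wiener_integral
begin

definition energy :: "real \<Rightarrow> real \<Rightarrow> real" where
  "energy s t = integral {s..t} (\<lambda>r. (\<sigma> r)\<^sup>2)"

text \<open>Peel off the last increment, which is independent of the event and of all earlier increments.\<close>

lemma increment_sum_char:
  assumes p: "incseq p" "0 \<le> p m" and E: "E \<in> sets (history (p m))" and "m \<le> n"
  shows "(CLINT \<omega>|M. indicator E \<omega> * iexp (u * increment_sum p m n \<omega>)) =
    prob E * exp (- (u\<^sup>2 * (\<Sum>i\<in>{m..<n}. (\<sigma> (p i))\<^sup>2 * (p (Suc i) - p i))) / 2)"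
  using \<open>m \<le> n\<close>
proof (induction n rule: dec_induct)
  case base
  have [measurable]: "E \<in> events" using E history_subset by auto
  have "(CLINT \<omega>|M. indicator E \<omega> * iexp (u * increment_sum p m m \<omega>)) = (CLINT \<omega>|M. complex_of_real (indicator E \<omega>))"
    by (intro Bochner_Integration.integral_cong) (auto simp: increment_sum_def indicator_def)
  also have "\<dots> = prob E" by (subst integral_complex_of_real) simp
  finally show ?case by simp
next
  case (step n)
  have pn: "0 \<le> p n" "p m \<le> p n" "p n \<le> p (Suc n)" 
    using p(2) incseqD[OF p(1), of m n] incseqD[OF p(1), of n "Suc n"] step by auto
  define Z where "Z \<omega> = indicator E \<omega> * iexp (u * increment_sum p m n \<omega>)" for \<omega>
  define X where "X \<omega> = iexp (u * \<sigma> (p n) * (B (p (Suc n)) \<omega> - B (p n) \<omega>))" for \<omega>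
  have ZX: "indicator E \<omega> * iexp (u * increment_sum p m (Suc n) \<omega>) = Z \<omega> * X \<omega>" for \<omega>
    using step by (simp add: Z_def X_def increment_sum_def exp_add[symmetric] algebra_simps)
  have [measurable]: "B (p n) \<in> borel_measurable M" "B (p (Suc n)) \<in> borel_measurable M" using pn by auto
  have EX: "expectation X = exp (- ((u * \<sigma> (p n))\<^sup>2 * (p (Suc n) - p n)) / 2)"
    unfolding X_def using increment_char[OF pn(1,3), of "u * \<sigma> (p n)"] by simp
  have [measurable]: "increment_sum p m n \<in> borel_measurable (history (p n))"
    by (rule increment_sum_history[OF p])
  have [measurable]: "E \<in> sets (history (p n))" using E history_mono[OF pn(2)] by auto
  have Zm: "Z \<in> borel_measurable (history (p n))" unfolding Z_def by measurable
  have Zint: "integrable M Z"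
  proof (rule integrable_const_bound[where B = 1])
    show "AE \<omega> in M. norm (Z \<omega>) \<le> 1" by (auto simp: Z_def norm_mult indicator_def)
  qed (rule measurable_history[OF Zm])
  have Xint: "integrable M X"
  proof (rule integrable_const_bound[where B = 1])
    show "X \<in> borel_measurable M" unfolding X_def by measurable
  qed (auto simp: X_def)
  have "expectation (\<lambda>\<omega>. Z \<omega> * X \<omega>) = expectation Z * expectation X"
  proof (cases "p n = p (Suc n)")
    case True
    then have "X = (\<lambda>_. 1)" by (simp add: X_def[abs_def])
    then show ?thesis by (simp add: prob_space)
  next
    case False
    then have "p n < p (Suc n)" using pn by simp
    then have "indep_var borel Z borel X"
      unfolding X_def by (intro increment_indep_var[where g = "\<lambda>x. iexp (u * \<sigma> (p n) * x)"] pn(1) Zm) measurable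
    then show ?thesis using Zint Xint by (rule indep_var_lebesgue_integral)
  qed
  also have "expectation Z = prob E * exp (- (u\<^sup>2 * (\<Sum>i\<in>{m..<n}. (\<sigma> (p i))\<^sup>2 * (p (Suc i) - p i))) / 2)"
    using step unfolding Z_def[abs_def] by simp
  finally have calc: "expectation (\<lambda>\<omega>. Z \<omega> * X \<omega>) = complex_of_real (prob E *
      (exp (- (u\<^sup>2 * (\<Sum>i\<in>{m..<n}. (\<sigma> (p i))\<^sup>2 * (p (Suc i) - p i))) / 2) *
       exp (- ((u * \<sigma> (p n))\<^sup>2 * (p (Suc n) - p n)) / 2)))"
    unfolding EX by simp
  have "- (u\<^sup>2 * S) / 2 + - ((u * v)\<^sup>2 * d) / 2 = - (u\<^sup>2 * (S + v\<^sup>2 * d)) / 2" for S v d :: real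
    by (simp add: power_mult_distrib algebra_simps)
  then show ?case
    unfolding ZX calc exp_add[symmetric] using step by simp
qed

text \<open>The integral is an almost sure limit of adapted sums, and the completed filtration contains the exceptional
null set.\<close>

lemma J_history:
  assumes "t \<ge> 0"
  shows "J t \<in> borel_measurable (history t)"
proof -
  define p where "p = (\<lambda>k i. if i \<le> Suc k then real i * t / real (Suc k) else t + real (i - Suc k) * (t - t) / real (Suc k))"
  have fine: "fine_partitions p Suc t" 
    using split_partitions(2)[of t t] assms by (simp add: p_def)
  then interpret fine_partitions p Suc t .
  have inc: "increment_sum (p k) 0 (Suc k) \<in> borel_measurable (history t)" for k
    using increment_sum_history[of "p k" 0 "Suc k"] mono_p start stop by simp
  then have [measurable]: "increment_sum (p k) 0 (Suc k) \<in> borel_measurable M" for k by (rule measurable_history)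
  have [measurable]: "J t \<in> borel_measurable M" using assms by simp
  have "\<exists>r. strict_mono r \<and> (AE \<omega> in M. (\<lambda>k. increment_sum (p (r k)) 0 (Suc (r k)) \<omega> - J t \<omega>) \<longlonglongrightarrow> 0)"
    by (rule L2_AE_subseq[OF _ increment_sum_L2[OF assms fine]]) measurable
  then obtain r where r: "AE \<omega> in M. (\<lambda>k. increment_sum (p (r k)) 0 (Suc (r k)) \<omega> - J t \<omega>) \<longlonglongrightarrow> 0" by blast
  define L where "L \<omega> = lim (\<lambda>k. increment_sum (p (r k)) 0 (Suc (r k)) \<omega>)" for \<omega>
  have Lm: "L \<in> borel_measurable (history t)" unfolding L_def by (intro borel_measurable_lim_metric inc)
  have "AE \<omega> in M. L \<omega> = J t \<omega>" using r
  proof eventually_elim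
    case (elim \<omega>)
    then have "(\<lambda>k. increment_sum (p (r k)) 0 (Suc (r k)) \<omega>) \<longlonglongrightarrow> J t \<omega>" by (rule Lim_null[THEN iffD2])
    then show ?case unfolding L_def by (rule limI)
  qed
  then obtain N where N: "N \<in> null_sets M" "{\<omega> \<in> space M. L \<omega> \<noteq> J t \<omega>} \<subseteq> N"
    by (auto simp: eventually_ae_filter)
  show ?thesis
  proof (rule measurableI)
    fix U :: "real set" assume U: "U \<in> sets borel"
    have eq: "J t -` U \<inter> space M = ((L -` U \<inter> space M) - N) \<union> ((J t -` U \<inter> space M) \<inter> N)"
      using N(2) by auto
    have "(J t -` U \<inter> space M) \<inter> N \<in> null_sets M"
      using N(1) U assms by (intro null_set_Int1 measurable_sets[OF J_measurable]) auto
    then have "((L -` U \<inter> space M) - N) \<union> ((J t -` U \<inter> space M) \<inter> N) \<in> sets (history t)"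
      using measurable_sets[OF Lm U] null_sets_history N(1) by (intro sets.Un sets.Diff) auto
    then show "J t -` U \<inter> space (history t) \<in> sets (history t)" unfolding eq[symmetric] by simp
  qed simp
qed

lemma J_increment_char:
  assumes st: "0 \<le> s" "s \<le> t" and E: "E \<in> sets (history s)"
  shows "(CLINT \<omega>|M. indicator E \<omega> * iexp (u * (J t \<omega> - J s \<omega>))) = prob E * exp (- (u\<^sup>2 * energy s t) / 2)"
proof -
  define p where "p = (\<lambda>k i. if i \<le> Suc k then real i * s / real (Suc k) else s + real (i - Suc k) * (t - s) / real (Suc k))"
  have fine: "fine_partitions p (\<lambda>k. 2 * Suc k) t" "fine_partitions p Suc s" and mid: "\<And>k. p k (Suc k) = s"
    using split_partitions[OF st] by (simp_all add: p_def)
  interpret fine_partitions p "\<lambda>k. 2 * Suc k" t by fact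
  define V where "V k = increment_sum (p k) (Suc k) (2 * Suc k)" for k
  have [measurable]: "J t \<in> borel_measurable M" "J s \<in> borel_measurable M" using st by auto
  have incm[measurable]: "increment_sum (p k) i j \<in> borel_measurable M" if "i \<le> 2 * Suc k" for i j k
    using p_range[OF that] by (intro measurable_history[OF increment_sum_history] mono_p) auto
  have Vm[measurable]: "V k \<in> borel_measurable M" for k unfolding V_def by (rule incm) simp
  have i0[measurable]: "increment_sum (p k) 0 j \<in> borel_measurable M" for j k by (rule incm) simp
  have [measurable]: "E \<in> events" using E history_subset by auto
  have split: "V k \<omega> = increment_sum (p k) 0 (2 * Suc k) \<omega> - increment_sum (p k) 0 (Suc k) \<omega>" for k \<omega>
  proof -
    have "sum g {0..<Suc k} + sum g {Suc k..<2 * Suc k} = sum g {0..<2 * Suc k}" for g :: "nat \<Rightarrow> real"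
      by (rule sum.atLeastLessThan_concat) auto
    from this[of "\<lambda>i. \<sigma> (p k i) * (B (p k (Suc i)) \<omega> - B (p k i) \<omega>)"] show ?thesis
      unfolding V_def increment_sum_def by linarith
  qed
  have "(\<lambda>k. \<integral>\<^sup>+\<omega>. ennreal ((V k \<omega> - (J t \<omega> - J s \<omega>))\<^sup>2) \<partial>M) \<longlonglongrightarrow> 0"
  proof (rule tendsto_0_le_double_sum)
    show "(\<lambda>k. \<integral>\<^sup>+\<omega>. ennreal ((increment_sum (p k) 0 (2 * Suc k) \<omega> - J t \<omega>)\<^sup>2) \<partial>M) \<longlonglongrightarrow> 0"
      using st by (intro increment_sum_L2 fine) simp
    show "(\<lambda>k. \<integral>\<^sup>+\<omega>. ennreal ((increment_sum (p k) 0 (Suc k) \<omega> - J s \<omega>)\<^sup>2) \<partial>M) \<longlonglongrightarrow> 0"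
      using st by (intro increment_sum_L2 fine)
    fix k
    have "(\<integral>\<^sup>+\<omega>. ennreal (((increment_sum (p k) 0 (2 * Suc k) \<omega> - J t \<omega>) - (increment_sum (p k) 0 (Suc k) \<omega> - J s \<omega>))\<^sup>2) \<partial>M)
      \<le> 2 * (\<integral>\<^sup>+\<omega>. ennreal (((increment_sum (p k) 0 (2 * Suc k) \<omega> - J t \<omega>) - 0)\<^sup>2) \<partial>M)
        + 2 * (\<integral>\<^sup>+\<omega>. ennreal ((0 - (increment_sum (p k) 0 (Suc k) \<omega> - J s \<omega>))\<^sup>2) \<partial>M)"
      by (rule L2_triangle) measurable
    note tri = this
    have eq: "(increment_sum (p k) 0 (2 * Suc k) \<omega> - J t \<omega>) - (increment_sum (p k) 0 (Suc k) \<omega> - J s \<omega>)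
        = V k \<omega> - (J t \<omega> - J s \<omega>)" for \<omega> by (simp add: split)
    show "(\<integral>\<^sup>+\<omega>. ennreal ((V k \<omega> - (J t \<omega> - J s \<omega>))\<^sup>2) \<partial>M)
      \<le> 2 * (\<integral>\<^sup>+\<omega>. ennreal ((increment_sum (p k) 0 (2 * Suc k) \<omega> - J t \<omega>)\<^sup>2) \<partial>M)
        + 2 * (\<integral>\<^sup>+\<omega>. ennreal ((increment_sum (p k) 0 (Suc k) \<omega> - J s \<omega>)\<^sup>2) \<partial>M)"
      using tri unfolding eq by (simp add: power2_commute[of "J s _"])
  qed
  then have "\<exists>r. strict_mono r \<and> (AE \<omega> in M. (\<lambda>k. V (r k) \<omega> - (J t \<omega> - J s \<omega>)) \<longlonglongrightarrow> 0)"
    by (rule L2_AE_subseq[rotated]) measurable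
  then obtain r where r: "strict_mono r" "AE \<omega> in M. (\<lambda>k. V (r k) \<omega> - (J t \<omega> - J s \<omega>)) \<longlonglongrightarrow> 0" by blast
  have "(\<lambda>k. CLINT \<omega>|M. indicator E \<omega> * iexp (u * V (r k) \<omega>)) \<longlonglongrightarrow> (CLINT \<omega>|M. indicator E \<omega> * iexp (u * (J t \<omega> - J s \<omega>)))"
  proof (rule integral_dominated_convergence[where w = "\<lambda>_. 1"])
    show "AE \<omega> in M. (\<lambda>k. indicator E \<omega> * iexp (u * V (r k) \<omega>)) \<longlonglongrightarrow> indicator E \<omega> * iexp (u * (J t \<omega> - J s \<omega>))"
      using r(2)
    proof eventually_elim
      case (elim \<omega>)
      then have "(\<lambda>k. V (r k) \<omega>) \<longlonglongrightarrow> J t \<omega> - J s \<omega>" by (rule Lim_null[THEN iffD2])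
      then show ?case by (intro tendsto_intros isCont_tendsto_compose[OF isCont_iexp])
    qed
    show "AE \<omega> in M. norm (indicator E \<omega> * iexp (u * V (r k) \<omega>)) \<le> 1" for k
      by (auto simp: norm_mult indicator_def)
  qed auto
  moreover have "(\<lambda>k. CLINT \<omega>|M. indicator E \<omega> * iexp (u * V (r k) \<omega>)) \<longlonglongrightarrow> prob E * exp (- (u\<^sup>2 * energy s t) / 2)"
  proof -
    have "(\<lambda>k. \<Sum>i\<in>{Suc k..<2 * Suc k}. (\<sigma> (p k i))\<^sup>2 * (p k (Suc i) - p k i)) \<longlonglongrightarrow> integral {s..t} (\<lambda>r. (\<sigma> r)\<^sup>2)"
      by (intro riemann_sum[where g = "\<lambda>r. (\<sigma> r)\<^sup>2"] mid continuous_intros continuous_on_subset[OF continuous_\<sigma>]) auto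
    then have "(\<lambda>k. prob E * exp (- (u\<^sup>2 * (\<Sum>i\<in>{Suc k..<2 * Suc k}. (\<sigma> (p k i))\<^sup>2 * (p k (Suc i) - p k i))) / 2))
        \<longlonglongrightarrow> prob E * exp (- (u\<^sup>2 * energy s t) / 2)" unfolding energy_def by (intro tendsto_intros) auto
    then have "(\<lambda>k. complex_of_real (prob E * exp (- (u\<^sup>2 * (\<Sum>i\<in>{Suc k..<2 * Suc k}. (\<sigma> (p k i))\<^sup>2 * (p k (Suc i) - p k i))) / 2)))
        \<longlonglongrightarrow> complex_of_real (prob E * exp (- (u\<^sup>2 * energy s t) / 2))" by (rule tendsto_of_real)
    moreover have "complex_of_real (prob E * exp (- (u\<^sup>2 * (\<Sum>i\<in>{Suc k..<2 * Suc k}. (\<sigma> (p k i))\<^sup>2 * (p k (Suc i) - p k i))) / 2))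
       = (CLINT \<omega>|M. indicator E \<omega> * iexp (u * V k \<omega>))" for k
      unfolding V_def using mono_p[of k] mid[of k] st E by (subst increment_sum_char) auto
    ultimately have "(\<lambda>k. CLINT \<omega>|M. indicator E \<omega> * iexp (u * V k \<omega>)) \<longlonglongrightarrow> prob E * exp (- (u\<^sup>2 * energy s t) / 2)" by simp
    from LIMSEQ_subseq_LIMSEQ[OF this r(1)] show ?thesis by (simp add: comp_def)
  qed
  ultimately show ?thesis by (rule LIMSEQ_unique)
qed

text \<open>Scaling the standard normal law, rather than using a density, includes the variance zero.\<close>

definition normal_law :: "real \<Rightarrow> real measure" where
  "normal_law v = distr std_normal_distribution borel (\<lambda>x. sqrt v * x)"

lemma real_distribution_normal_law: "real_distribution (normal_law v)"
proof -
  interpret N: real_distribution std_normal_distribution by (rule real_dist_normal_dist)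
  show ?thesis unfolding normal_law_def by (rule N.real_distribution_distr) simp
qed

lemma char_normal_law: "v \<ge> 0 \<Longrightarrow> char (normal_law v) u = exp (- (u\<^sup>2 * v) / 2)"
proof -
  assume v: "v \<ge> 0"
  have "char (normal_law v) u = char std_normal_distribution (u * sqrt v)"
    unfolding normal_law_def char_def by (subst integral_distr) (auto simp: mult_ac)
  then show ?thesis using v by (simp add: char_std_normal_distribution power_mult_distrib)
qed

lemma energy_nonneg: "0 \<le> energy s t"
  unfolding energy_def
  by (cases "(\<lambda>r. (\<sigma> r)\<^sup>2) integrable_on {s..t}") (auto intro: Henstock_Kurzweil_Integration.integral_nonneg simp: not_integrable_integral)

text \<open>Independence and normality at once: under the measure conditioned on a past event, the increment has the
characteristic function of the normal law, whatever the event.\<close>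

lemma J_increment_law:
  assumes st: "0 \<le> s" "s \<le> t" and E: "E \<in> sets (history s)" and U: "U \<in> sets borel"
  shows "prob (E \<inter> {\<omega> \<in> space M. J t \<omega> - J s \<omega> \<in> U}) = prob E * measure (normal_law (energy s t)) U"
proof (cases "prob E = 0")
  case True
  have [measurable]: "E \<in> events" using E history_subset by auto
  have "prob (E \<inter> {\<omega> \<in> space M. J t \<omega> - J s \<omega> \<in> U}) \<le> prob E" by (intro finite_measure_mono) auto
  then show ?thesis using True measure_nonneg[of M] by (simp add: order_antisym)
next
  case False
  have [measurable]: "E \<in> events" using E history_subset by auto
  have [measurable]: "J t \<in> borel_measurable M" "J s \<in> borel_measurable M" using st by auto
  have pE: "prob E > 0" using False by (simp add: zero_less_measure_iff measure_eq_0_null_sets less_le)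
  define W where "W \<omega> = J t \<omega> - J s \<omega>" for \<omega>
  have [measurable]: "W \<in> borel_measurable M" unfolding W_def by measurable
  define Q where "Q = uniform_measure M E"
  have eE: "emeasure M E \<noteq> 0" "emeasure M E \<noteq> \<infinity>" using False by (auto simp: emeasure_eq_measure)
  interpret Q: prob_space Q unfolding Q_def by (rule prob_space_uniform_measure[OF eE])
  have [measurable]: "W \<in> borel_measurable Q" unfolding Q_def by simp
  have Qdens: "Q = density M (\<lambda>\<omega>. ennreal (indicator E \<omega> / prob E))"
    unfolding Q_def uniform_measure_def using pE
    by (intro arg_cong[where f = "density M"] ext) (simp add: emeasure_eq_measure divide_ennreal[symmetric] ennreal_indicator)
  have "distr Q borel W = normal_law (energy s t)"
  proof (rule Levy_uniqueness)
    show "real_distribution (distr Q borel W)" by (rule Q.real_distribution_distr) simp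
    show "char (distr Q borel W) = char (normal_law (energy s t))"
    proof
      fix u
      have "char (distr Q borel W) u = (CLINT \<omega>|Q. iexp (u * W \<omega>))"
        unfolding char_def by (subst integral_distr) auto
      also have "\<dots> = (CLINT \<omega>|M. (indicator E \<omega> / prob E) *\<^sub>R iexp (u * W \<omega>))"
        unfolding Qdens by (subst integral_density) auto
      also have "\<dots> = (CLINT \<omega>|M. (1 / prob E) *\<^sub>R (indicator E \<omega> * iexp (u * W \<omega>)))"
        by (intro Bochner_Integration.integral_cong) (auto simp: indicator_def scaleR_conv_of_real)
      also have "\<dots> = (1 / prob E) *\<^sub>R (CLINT \<omega>|M. indicator E \<omega> * iexp (u * W \<omega>))"
        by (rule integral_scaleR_right)
      also have "\<dots> = exp (- (u\<^sup>2 * energy s t) / 2)"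
        unfolding W_def J_increment_char[OF st E] using pE by (simp add: scaleR_conv_of_real)
      finally show "char (distr Q borel W) u = char (normal_law (energy s t)) u"
        by (simp add: char_normal_law energy_nonneg)
    qed
  qed (rule real_distribution_normal_law)
  then have "measure (normal_law (energy s t)) U = measure Q (W -` U \<inter> space M)"
    using U by (subst (asm) eq_commute) (simp add: measure_distr Q_def)
  also have "\<dots> = prob (E \<inter> (W -` U \<inter> space M)) / prob E"
    unfolding Q_def using U by (intro measure_uniform_measure eE) auto
  also have "W -` U \<inter> space M = {\<omega> \<in> space M. J t \<omega> - J s \<omega> \<in> U}" by (auto simp: W_def)
  finally show ?thesis using pE by (simp add: field_simps)
qed

end

section \<open>Maximal inequality and Borel-Cantelli arguments\<close>

lemma measure_std_normal_atLeast: "measure std_normal_distribution {x..} = Psi x"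
proof -
  interpret N: real_distribution std_normal_distribution by (rule real_dist_normal_dist)
  have "measure std_normal_distribution {x..} = (\<integral>y. indicator {x..} y \<partial>std_normal_distribution)" by simp
  also have "\<dots> = (\<integral>y. std_normal_density y *\<^sub>R indicator {x..} y \<partial>lborel)"
    by (subst integral_density) auto
  also have "\<dots> = (\<integral>y. 1 / sqrt (2 * pi) * (indicator {x..} y *\<^sub>R exp (- (y\<^sup>2) / 2)) \<partial>lborel)"
    by (intro Bochner_Integration.integral_cong) (auto simp: std_normal_density_def indicator_def)
  also have "\<dots> = Psi x" unfolding Psi_def set_lebesgue_integral_def by (rule integral_mult_right_zero)
  finally show ?thesis .
qed

lemma distr_uminus_std_normal: "distr std_normal_distribution borel uminus = std_normal_distribution"
proof (rule Levy_uniqueness)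
  interpret N: real_distribution std_normal_distribution by (rule real_dist_normal_dist)
  show "real_distribution (distr std_normal_distribution borel uminus)" by (rule N.real_distribution_distr) simp
  show "char (distr std_normal_distribution borel uminus) = char std_normal_distribution"
  proof
    fix u
    have "char (distr std_normal_distribution borel uminus) u = char std_normal_distribution (- u)"
      unfolding char_def by (subst integral_distr) auto
    then show "char (distr std_normal_distribution borel uminus) u = char std_normal_distribution u"
      by (simp add: char_std_normal_distribution)
  qed
qed (rule real_dist_normal_dist)

context wiener_integral
begin

lemma sets_normal_law [simp]: "sets (normal_law v) = sets borel"
  and space_normal_law [simp]: "space (normal_law v) = UNIV"
  by (simp_all add: normal_law_def)

lemma normal_law_symmetric: "measure (normal_law v) (uminus -` U) = measure (normal_law v) U" if U: "U \<in> sets borel"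
proof -
  have [measurable]: "U \<in> sets borel" by fact
  have "measure (normal_law v) U = measure (distr std_normal_distribution borel uminus) ((\<lambda>x. sqrt v * x) -` U)"
    unfolding distr_uminus_std_normal normal_law_def by (subst measure_distr) auto
  also have "\<dots> = measure std_normal_distribution ((\<lambda>x. - (sqrt v * x)) -` U)"
    by (subst measure_distr) (auto simp: vimage_def)
  also have "\<dots> = measure (normal_law v) (uminus -` U)"
    unfolding normal_law_def by (subst measure_distr) (auto simp: vimage_def)
  finally show ?thesis ..
qed

lemma normal_law_half: "measure (normal_law v) {0..} \<ge> 1 / 2"
proof -
  interpret N: real_distribution "normal_law v" by (rule real_distribution_normal_law)
  have "measure (normal_law v) {..0} = measure (normal_law v) {0..}"
    using normal_law_symmetric[of "{0..}" v] by (simp add: vimage_def atMost_def)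
  moreover have "1 \<le> measure (normal_law v) {..0} + measure (normal_law v) {0..}"
  proof -
    have "{..0} \<union> {0..} = (UNIV :: real set)" by auto
    then have "1 = measure (normal_law v) ({..0} \<union> {0..})" using N.prob_space by simp
    also have "\<dots> \<le> measure (normal_law v) {..0} + measure (normal_law v) {0..}"
      by (rule measure_Un_le) auto
    finally show ?thesis .
  qed
  ultimately show ?thesis by simp
qed

lemma normal_law_tail:
  assumes "v \<ge> 0" "e > 0"
  shows "measure (normal_law v) {e..} = (if v = 0 then 0 else Psi (e / sqrt v))"
proof -
  have "measure (normal_law v) {e..} = measure std_normal_distribution ((\<lambda>x. sqrt v * x) -` {e..})"
    unfolding normal_law_def by (subst measure_distr) auto
  moreover have "(\<lambda>x. sqrt v * x) -` {e..} = (if v = 0 then {} else {e / sqrt v..})"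
    using assms by (auto simp: field_simps)
  ultimately show ?thesis by (simp add: measure_std_normal_atLeast)
qed

text \<open>Upward and downward excursions are treated together by means of the sign \<open>c\<close>.\<close>

lemma J_increment_signed:
  assumes c: "c \<in> {-1, 1 :: real}" and st: "0 \<le> s" "s \<le> t" and E: "E \<in> sets (history s)" and U: "U \<in> sets borel"
  shows "prob (E \<inter> {\<omega> \<in> space M. c * (J t \<omega> - J s \<omega>) \<in> U}) = prob E * measure (normal_law (energy s t)) U"
proof (cases "c = 1")
  case True
  then show ?thesis using J_increment_law[OF st E U] by simp
next
  case False
  have "uminus -` U \<in> sets borel" using U measurable_sets[of uminus borel borel U] by simp
  from J_increment_law[OF st E this] show ?thesis using False c normal_law_symmetric[OF U] by simp
qed

lemma J_increment_tail:
  assumes c: "c \<in> {-1, 1 :: real}" and st: "0 \<le> s" "s \<le> t"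
  shows "prob {\<omega> \<in> space M. c * (J t \<omega> - J s \<omega>) \<ge> e} = measure (normal_law (energy s t)) {e..}"
proof -
  have "space M \<in> sets (history s)" using sets.top[of "history s"] by simp
  moreover have "space M \<inter> {\<omega> \<in> space M. c * (J t \<omega> - J s \<omega>) \<in> {e..}} = {\<omega> \<in> space M. c * (J t \<omega> - J s \<omega>) \<ge> e}" by auto
  ultimately show ?thesis using J_increment_signed[OF c st, of "space M" "{e..}"] by (simp add: prob_space)
qed

text \<open>Levy's inequality. When the level is first reached at the \<open>i\<close>-th time, the remaining increment is
independent of this event and nonnegative with probability at least one half, in which case the final value
exceeds the level, too.\<close>

lemma levy_maximal_finite:
  assumes c: "c \<in> {-1, 1 :: real}" and \<tau>: "incseq \<tau>" "\<tau> 0 = s" "\<tau> n = t" and s: "0 \<le> s"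
  shows "prob {\<omega> \<in> space M. \<exists>i\<le>n. c * (J (\<tau> i) \<omega> - J s \<omega>) \<ge> e} \<le> 2 * prob {\<omega> \<in> space M. c * (J t \<omega> - J s \<omega>) \<ge> e}"
proof -
  let ?x = "\<lambda>i \<omega>. c * (J (\<tau> i) \<omega> - J s \<omega>)"
  have \<tau>s: "s \<le> \<tau> i" "0 \<le> \<tau> i" for i using incseqD[OF \<tau>(1), of 0 i] \<tau>(2) s by auto
  have \<tau>t: "\<tau> i \<le> t" if "i \<le> n" for i using incseqD[OF \<tau>(1) that] \<tau>(3) by simp
  have [measurable]: "J (\<tau> i) \<in> borel_measurable M" "J s \<in> borel_measurable M" "J t \<in> borel_measurable M" for i
    using \<tau>s \<tau>t[of 0] s \<tau>(2) by auto
  define T where "T i = {\<omega> \<in> space M. ?x i \<omega> \<ge> e \<and> (\<forall>j<i. ?x j \<omega> < e)}" for i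
  define R where "R i = T i \<inter> {\<omega> \<in> space M. c * (J t \<omega> - J (\<tau> i) \<omega>) \<in> {0..}}" for i
  have T_hist: "T i \<in> sets (history (\<tau> i))" for i
  proof -
    have m: "J (\<tau> j) \<in> borel_measurable (history (\<tau> i))" if "j \<le> i" for j
      using that by (intro measurable_history_mono[OF incseqD[OF \<tau>(1)] J_history] \<tau>s)
    have m0: "J s \<in> borel_measurable (history (\<tau> i))"
      using m[of 0] \<tau>(2) by simp
    have 1: "{\<omega> \<in> space (history (\<tau> i)). ?x i \<omega> \<ge> e} \<in> sets (history (\<tau> i))"
      using m[of i] m0 by measurable
    have 2: "{\<omega> \<in> space (history (\<tau> i)). ?x j \<omega> < e} \<in> sets (history (\<tau> i))" if "j < i" for j
      using m[OF less_imp_le[OF that]] m0 by measurable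
    have "T i = {\<omega> \<in> space (history (\<tau> i)). ?x i \<omega> \<ge> e} \<inter> 
        {\<omega> \<in> space (history (\<tau> i)). \<forall>j\<in>{..<i}. ?x j \<omega> < e}" by (auto simp: T_def)
    also have "\<dots> \<in> sets (history (\<tau> i))"
      using 1 2 by (intro sets.Int sets.sets_Collect_finite_All) auto
    finally show ?thesis .
  qed
  have [measurable]: "T i \<in> events" for i using T_hist history_subset by auto
  have [measurable]: "R i \<in> events" for i unfolding R_def by measurable
  have disj: "disjoint_family_on T {..n}" "disjoint_family_on R {..n}"
    unfolding disjoint_family_on_def R_def T_def by (auto, (meson leD linorder_neqE_nat)+)
  have "{\<omega> \<in> space M. \<exists>i\<le>n. ?x i \<omega> \<ge> e} \<subseteq> (\<Union>i\<in>{..n}. T i)"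
  proof clarify
    fix \<omega> i assume i: "\<omega> \<in> space M" "i \<le> n" "?x i \<omega> \<ge> e"
    define k where "k = (LEAST i. ?x i \<omega> \<ge> e)"
    have "?x k \<omega> \<ge> e" unfolding k_def 
      by (rule LeastI[of "\<lambda>i. ?x i \<omega> \<ge> e", OF i(3)])
    moreover have "k \<le> i" unfolding k_def 
      by (rule Least_le[of "\<lambda>i. ?x i \<omega> \<ge> e", OF i(3)])
    moreover have "?x j \<omega> < e" if "j < k" for j
      using not_less_Least[of j "\<lambda>i. ?x i \<omega> \<ge> e"] that by (simp add: k_def)
    ultimately show "\<omega> \<in> (\<Union>i\<in>{..n}. T i)" using i by (auto simp: T_def intro!: bexI[of _ k])
  qed
  then have "prob {\<omega> \<in> space M. \<exists>i\<le>n. ?x i \<omega> \<ge> e} \<le> prob (\<Union>i\<in>{..n}. T i)"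
    by (intro finite_measure_mono) auto
  also have "\<dots> = (\<Sum>i\<in>{..n}. prob (T i))"
    by (intro finite_measure_finite_Union disj) auto
  also have "\<dots> \<le> (\<Sum>i\<in>{..n}. 2 * prob (R i))"
  proof (rule sum_mono)
    fix i assume "i \<in> {..n}"
    then have "prob (R i) = prob (T i) * measure (normal_law (energy (\<tau> i) t)) {0..}"
      unfolding R_def by (intro J_increment_signed[OF c] \<tau>s \<tau>t T_hist) auto
    also have "\<dots> \<ge> prob (T i) * (1 / 2)" by (intro mult_left_mono normal_law_half) auto
    finally show "prob (T i) \<le> 2 * prob (R i)" by simp
  qed
  also have "\<dots> = 2 * prob (\<Union>i\<in>{..n}. R i)"
    unfolding sum_distrib_left[symmetric] by (subst finite_measure_finite_Union) (use disj in auto)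
  also have "\<dots> \<le> 2 * prob {\<omega> \<in> space M. c * (J t \<omega> - J s \<omega>) \<ge> e}"
  proof -
    have "(\<Union>i\<in>{..n}. R i) \<subseteq> {\<omega> \<in> space M. c * (J t \<omega> - J s \<omega>) \<ge> e}"
      by (auto simp: R_def T_def algebra_simps)
    then show ?thesis by (intro mult_left_mono finite_measure_mono) auto
  qed
  finally show ?thesis .
qed

text \<open>Dyadic points exhaust the interval by nested finite grids, which carries the finite inequality over to the
supremum along continuous paths.\<close>

definition dyadic :: "real \<Rightarrow> real \<Rightarrow> nat \<Rightarrow> nat \<Rightarrow> real" where
  "dyadic s t N i = s + (t - s) * (real i / 2 ^ N)"

definition dyadic_exceed :: "real \<Rightarrow> real \<Rightarrow> real \<Rightarrow> real \<Rightarrow> 'a set" where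
  "dyadic_exceed c s t e = {\<omega> \<in> space M. \<exists>N. \<exists>i\<le>2 ^ N. c * (J (dyadic s t N i) \<omega> - J s \<omega>) \<ge> e}"

lemma levy_maximal:
  assumes c: "c \<in> {-1, 1 :: real}" and st: "0 \<le> s" "s \<le> t"
  shows "dyadic_exceed c s t e \<in> events" (is ?meas)
    and "prob (dyadic_exceed c s t e) \<le> 2 * measure (normal_law (energy s t)) {e..}" (is ?le)
proof -
  define D where "D N = {\<omega> \<in> space M. \<exists>i\<le>2 ^ N. c * (J (dyadic s t N i) \<omega> - J s \<omega>) \<ge> e}" for N
  have nn: "0 \<le> dyadic s t N i" for N i using st by (simp add: dyadic_def)
  have [measurable]: "J (dyadic s t N i) \<in> borel_measurable M" "J s \<in> borel_measurable M" for N i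
    using nn st by auto
  have [measurable]: "D N \<in> events" for N
  proof -
    have "D N = (\<Union>i\<in>{..2 ^ N}. {\<omega> \<in> space M. c * (J (dyadic s t N i) \<omega> - J s \<omega>) \<ge> e})" by (auto simp: D_def)
    then show ?thesis by simp
  qed
  have "D N \<subseteq> D (Suc N)" for N
  proof
    fix \<omega> assume "\<omega> \<in> D N"
    then obtain i where i: "\<omega> \<in> space M" "i \<le> 2 ^ N" "c * (J (dyadic s t N i) \<omega> - J s \<omega>) \<ge> e" by (auto simp: D_def)
    moreover have "dyadic s t (Suc N) (2 * i) = dyadic s t N i" by (simp add: dyadic_def)
    ultimately show "\<omega> \<in> D (Suc N)" by (auto simp: D_def intro!: exI[of _ "2 * i"])
  qed
  then have inc: "incseq D" by (rule incseq_SucI)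
  have eq: "dyadic_exceed c s t e = (\<Union>N. D N)" by (auto simp: dyadic_exceed_def D_def)
  show ?meas unfolding eq by measurable
  have "prob (D N) \<le> 2 * measure (normal_law (energy s t)) {e..}" for N
  proof -
    have "prob (D N) \<le> 2 * prob {\<omega> \<in> space M. c * (J t \<omega> - J s \<omega>) \<ge> e}"
      unfolding D_def
    proof (rule levy_maximal_finite[OF c])
      show "incseq (dyadic s t N)"
        using st by (intro incseq_SucI) (simp add: dyadic_def mult_left_mono divide_right_mono)
    qed (use st in \<open>auto simp: dyadic_def\<close>)
    then show ?thesis using J_increment_tail[OF c st] by simp
  qed
  moreover have "(\<lambda>N. prob (D N)) \<longlonglongrightarrow> prob (\<Union>N. D N)"
    by (rule finite_Lim_measure_incseq[OF _ inc]) auto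
  ultimately show ?le unfolding eq by (intro LIMSEQ_le_const2) auto
qed

end

lemma dyadic_dense_bound:
  fixes g :: "real \<Rightarrow> real"
  assumes g: "continuous_on {s..t} g" and r: "s \<le> r" "r \<le> t"
    and bound: "\<And>N i. i \<le> 2 ^ N \<Longrightarrow> g (s + (t - s) * (real i / 2 ^ N)) \<le> e"
  shows "g r \<le> e"
proof (cases "s = t")
  case True
  then show ?thesis using bound[of 0 0] r by simp
next
  case False
  then have st: "s < t" using r by simp
  define x where "x = (r - s) / (t - s)"
  have x: "0 \<le> x" "x \<le> 1" using st r by (auto simp: x_def)
  define i where "i N = nat \<lfloor>x * 2 ^ N\<rfloor>" for N
  have i: "real (i N) \<le> x * 2 ^ N" "x * 2 ^ N < real (i N) + 1" for N
    using x by (auto simp: i_def)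
  have i_le: "i N \<le> 2 ^ N" for N
  proof -
    have "x * 2 ^ N \<le> 1 * 2 ^ N" using x by (intro mult_right_mono) auto
    then have "real (i N) \<le> 2 ^ N" using i(1)[of N] by linarith
    then show ?thesis by (metis of_nat_le_iff of_nat_numeral of_nat_power)
  qed
  define y where "y N = s + (t - s) * (real (i N) / 2 ^ N)" for N
  have "(\<lambda>N. real (i N) / 2 ^ N) \<longlonglongrightarrow> x"
  proof (rule tendsto_sandwich)
    show "\<forall>\<^sub>F N in sequentially. x - (1 / 2) ^ N \<le> real (i N) / 2 ^ N"
    proof (intro always_eventually allI)
      fix N
      have "x \<le> (real (i N) + 1) / 2 ^ N" using i(2)[of N] by (simp add: pos_le_divide_eq less_imp_le)
      also have "\<dots> = real (i N) / 2 ^ N + (1 / 2) ^ N" by (simp add: add_divide_distrib power_divide)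
      finally show "x - (1 / 2) ^ N \<le> real (i N) / 2 ^ N" by simp
    qed
    show "\<forall>\<^sub>F N in sequentially. real (i N) / 2 ^ N \<le> x"
      using i(1) by (intro always_eventually allI) (simp add: field_simps)
    show "(\<lambda>N. x - (1 / 2) ^ N) \<longlonglongrightarrow> x"
      using tendsto_diff[OF tendsto_const LIMSEQ_power_zero[of "1 / 2 :: real"], of x] by simp
  qed simp
  then have "y \<longlonglongrightarrow> s + (t - s) * x" unfolding y_def by (intro tendsto_intros)
  then have "y \<longlonglongrightarrow> r" using st by (simp add: x_def)
  moreover have "y N \<in> {s..t}" for N
  proof -
    have "0 \<le> real (i N) / 2 ^ N" "real (i N) / 2 ^ N \<le> 1" using i_le[of N] by (auto simp: divide_le_eq_1)
    then show ?thesis using st mult_left_mono[of "real (i N) / 2 ^ N" 1 "t - s"] by (simp add: y_def)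
  qed
  ultimately have "(\<lambda>N. g (y N)) \<longlonglongrightarrow> g r"
    using r by (intro continuous_on_tendsto_compose[OF g]) auto
  moreover have "g (y N) \<le> e" for N unfolding y_def by (rule bound[OF i_le])
  ultimately show ?thesis by (intro LIMSEQ_le_const2) auto
qed

context wiener_integral
begin

lemma oscillation_borel_cantelli:
  assumes h: "h > 0" and sum: "summable (\<lambda>n. measure (normal_law (energy (real n * h) ((real n + 1) * h))) {e n..})"
    and cont: "AE \<omega> in M. continuous_on {0..} (\<lambda>t. J t \<omega>)"
  shows "AE \<omega> in M. \<forall>\<^sub>F n in sequentially. \<forall>s\<in>{real n * h..(real n + 1) * h}. \<bar>J s \<omega> - J (real n * h) \<omega>\<bar> \<le> e n"
proof -
  have one_side: "AE \<omega> in M. \<forall>\<^sub>F n in sequentially. \<forall>s\<in>{real n * h..(real n + 1) * h}. c * (J s \<omega> - J (real n * h) \<omega>) \<le> e n"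
    if c: "c \<in> {-1, 1}" for c :: real
  proof -
    define D where "D n = dyadic_exceed c (real n * h) ((real n + 1) * h) (e n)" for n
    have le: "0 \<le> real n * h" "real n * h \<le> (real n + 1) * h" for n using h by auto
    note lm = levy_maximal[OF c le]
    have "summable (\<lambda>n. prob (D n))"
    proof (rule summable_comparison_test')
      show "summable (\<lambda>n. 2 * measure (normal_law (energy (real n * h) ((real n + 1) * h))) {e n..})"
        using sum by (rule summable_mult)
      show "norm (prob (D n)) \<le> 2 * measure (normal_law (energy (real n * h) ((real n + 1) * h))) {e n..}" if "n \<ge> 0" for n
        using lm(2)[of n "e n"] by (simp add: D_def)
    qed
    then have "AE \<omega> in M. \<forall>\<^sub>F n in sequentially. \<omega> \<in> space M - D n"
      using lm(1) by (intro borel_cantelli_AE1) (auto simp: D_def emeasure_eq_measure)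
    with cont show ?thesis
    proof eventually_elim
      case (elim \<omega>)
      show ?case using elim(2)
      proof eventually_elim
        case (elim n)
        show ?case
        proof
          fix s assume s: "s \<in> {real n * h..(real n + 1) * h}"
          show "c * (J s \<omega> - J (real n * h) \<omega>) \<le> e n"
          proof (rule dyadic_dense_bound[where g = "\<lambda>s. c * (J s \<omega> - J (real n * h) \<omega>)"])
            show "continuous_on {real n * h..(real n + 1) * h} (\<lambda>s. c * (J s \<omega> - J (real n * h) \<omega>))"
              by (intro continuous_intros continuous_on_subset[OF \<open>continuous_on {0..} (\<lambda>t. J t \<omega>)\<close>])
                (use le(1)[of n] in auto)
            fix N i :: nat assume "i \<le> 2 ^ N"
            then show "c * (J (real n * h + ((real n + 1) * h - real n * h) * (real i / 2 ^ N)) \<omega> - J (real n * h) \<omega>) \<le> e n"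
              using elim unfolding D_def dyadic_exceed_def dyadic_def by (force simp: not_le intro: less_imp_le)
          qed (use s in auto)
        qed
      qed
    qed
  qed
  have "AE \<omega> in M. \<forall>\<^sub>F n in sequentially. \<forall>s\<in>{real n * h..(real n + 1) * h}. 1 * (J s \<omega> - J (real n * h) \<omega>) \<le> e n"
    "AE \<omega> in M. \<forall>\<^sub>F n in sequentially. \<forall>s\<in>{real n * h..(real n + 1) * h}. -1 * (J s \<omega> - J (real n * h) \<omega>) \<le> e n"
    by (rule one_side, simp)+
  then show ?thesis
  proof eventually_elim
    case (elim \<omega>)
    from elim show ?case
    proof eventually_elim
      case (elim n)
      then show ?case by (force simp: abs_le_iff)
    qed
  qed
qed

text \<open>The second Borel-Cantelli lemma. Independence of the past gives the product of \<open>1 - q n \<le> exp (- q n)\<close>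
as a bound for the probability that no increment from the \<open>m\<close>-th on reaches its threshold.\<close>

lemma increments_infinitely_often:
  assumes h: "h > 0" and nsum: "\<not> summable (\<lambda>n. measure (normal_law (energy (real n * h) ((real n + 1) * h))) {e n..})"
  shows "AE \<omega> in M. \<exists>\<^sub>F n in sequentially. J ((real n + 1) * h) \<omega> - J (real n * h) \<omega> \<ge> e n"
proof -
  let ?N = "\<lambda>n. normal_law (energy (real n * h) ((real n + 1) * h))"
  define q where "q n = measure (?N n) {e n..}" for n
  define W where "W n \<omega> = J ((real n + 1) * h) \<omega> - J (real n * h) \<omega>" for n \<omega>
  define D where "D m k = {\<omega> \<in> space M. \<forall>n\<in>{m..<m + k}. W n \<omega> < e n}" for m k
  have le: "0 \<le> real n * h" "real n * h \<le> (real n + 1) * h" for n using h by auto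
  have Jm[measurable]: "J (real n * h) \<in> borel_measurable M" "J ((real n + 1) * h) \<in> borel_measurable M" for n
    using h by auto
  have D_hist: "D m k \<in> sets (history (real (m + k) * h))" for m k
  proof -
    have "{\<omega> \<in> space (history (real (m + k) * h)). W n \<omega> < e n} \<in> sets (history (real (m + k) * h))"
      if "n \<in> {m..<m + k}" for n
    proof -
      have "real n + 1 \<le> real (m + k)" using that by auto
      then have "(real n + 1) * h \<le> real (m + k) * h" "real n * h \<le> real (m + k) * h" using h by (auto intro: mult_right_mono)
      then have "J ((real n + 1) * h) \<in> borel_measurable (history (real (m + k) * h))" 
          "J (real n * h) \<in> borel_measurable (history (real (m + k) * h))"
        using h by (auto intro!: measurable_history_mono[OF _ J_history])
      then show ?thesis unfolding W_def by measurable
    qed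
    then have "{\<omega> \<in> space (history (real (m + k) * h)). \<forall>n\<in>{m..<m + k}. W n \<omega> < e n} \<in> sets (history (real (m + k) * h))"
      by (intro sets.sets_Collect_finite_All) auto
    then show ?thesis by (simp add: D_def)
  qed
  have D_prob: "prob (D m k) \<le> exp (- (\<Sum>n\<in>{m..<m + k}. q n))" for m k
  proof (induction k)
    case (Suc k)
    have "D m (Suc k) = D m k \<inter> {\<omega> \<in> space M. J ((real (m + k) + 1) * h) \<omega> - J (real (m + k) * h) \<omega> \<in> {..<e (m + k)}}"
    proof -
      have "{m..<m + Suc k} = insert (m + k) {m..<m + k}" by auto
      then show ?thesis unfolding D_def W_def by auto
    qed
    then have "prob (D m (Suc k)) = prob (D m k) * measure (?N (m + k)) {..<e (m + k)}"
      using J_increment_law[OF le D_hist, of "{..<e (m + k)}"] by simp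
    also have "measure (?N (m + k)) {..<e (m + k)} = 1 - q (m + k)"
    proof -
      interpret N: real_distribution "?N (m + k)"
        by (rule real_distribution_normal_law)
      have "{..<e (m + k)} = UNIV - {e (m + k)..}" by auto
      then show ?thesis using N.prob_compl[of "{e (m + k)..}"] unfolding q_def by simp
    qed
    also have "prob (D m k) * (1 - q (m + k)) \<le> exp (- (\<Sum>n\<in>{m..<m + k}. q n)) * exp (- q (m + k))"
    proof (rule mult_mono)
      show "1 - q (m + k) \<le> exp (- q (m + k))" using exp_ge_add_one_self[of "- q (m + k)"] by simp
      interpret N: real_distribution "?N (m + k)"
        by (rule real_distribution_normal_law)
      show "0 \<le> 1 - q (m + k)" unfolding q_def using N.prob_le_1 by simp
    qed (use Suc in auto)
    finally show ?case by (simp add: exp_add[symmetric])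
  qed simp
  define L where "L m = {\<omega> \<in> space M. \<forall>n\<ge>m. W n \<omega> < e n}" for m
  have L_meas[measurable]: "L m \<in> events" for m
    unfolding L_def W_def by measurable
  have "prob (L m) = 0" for m
  proof (rule ccontr)
    assume "prob (L m) \<noteq> 0"
    then have pos: "prob (L m) > 0" using measure_nonneg[of M "L m"] by linarith
    have "(\<Sum>n\<in>{m..<m + k}. q n) \<le> - ln (prob (L m))" for k
    proof -
      have "prob (L m) \<le> prob (D m k)"
        using history_subset D_hist by (intro finite_measure_mono) (auto simp: L_def D_def)
      then have "prob (L m) \<le> exp (- (\<Sum>n\<in>{m..<m + k}. q n))" using D_prob order_trans by blast
      then have "ln (prob (L m)) \<le> ln (exp (- (\<Sum>n\<in>{m..<m + k}. q n)))"
        using pos by (intro ln_le_cancel_iff[THEN iffD2]) auto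
      then show ?thesis by simp
    qed
    moreover have "(\<Sum>n<k. q n) \<le> (\<Sum>n<m. q n) + (\<Sum>n\<in>{m..<m + k}. q n)" for k
    proof -
      have "(\<Sum>n<k. q n) \<le> (\<Sum>n<m + k. q n)" by (intro sum_mono2) (auto simp: q_def)
      also have "\<dots> = (\<Sum>n<m. q n) + (\<Sum>n\<in>{m..<m + k}. q n)"
        using sum.atLeastLessThan_concat[of 0 m "m + k" q] by (simp add: atLeast0LessThan)
      finally show ?thesis .
    qed
    ultimately have "(\<Sum>n<k. q n) \<le> (\<Sum>n<m. q n) - ln (prob (L m))" for k
      by (metis add_left_mono diff_conv_add_uminus order_trans)
    then have "summable q"
      by (intro summableI_nonneg_bounded) (auto simp: q_def)
    with nsum show False by (simp add: q_def[abs_def])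
  qed
  then have "AE \<omega> in M. \<forall>m. \<omega> \<notin> L m"
    unfolding AE_all_countable using L_meas by (auto simp: prob_eq_0[symmetric])
  with AE_space show ?thesis
    by eventually_elim (auto simp: L_def W_def frequently_sequentially not_less)
qed

end

section \<open>Convergence of the sum and the asymptotic event\<close>

lemma odd_equivalent_ratio:
  fixes f \<phi> :: "real \<Rightarrow> real"
  assumes odd: "\<And>x. \<phi> (- x) = - \<phi> x" and equiv: "((\<lambda>x. f x / \<phi> x) \<longlongrightarrow> 1) (at 0)"
  shows "((\<lambda>x. f (- x) / f x) \<longlongrightarrow> -1) (at_right 0)"
proof -
  have "filterlim (\<lambda>x::real. - x) (at 0) (at_right 0)"
  proof (rule filterlim_atI)
    show "((\<lambda>x::real. - x) \<longlongrightarrow> 0) (at_right 0)" by (rule tendsto_eq_intros) (auto intro!: tendsto_intros)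
    show "\<forall>\<^sub>F x::real in at_right 0. - x \<noteq> 0" by (auto simp: eventually_at_filter)
  qed
  from filterlim_compose[OF equiv this]
  have neg: "((\<lambda>x. f (- x) / \<phi> (- x)) \<longlongrightarrow> 1) (at_right 0)" .
  have pos: "((\<lambda>x. f x / \<phi> x) \<longlongrightarrow> 1) (at_right 0)"
    using equiv by (rule filterlim_mono) (auto simp: at_within_le_at)
  have "((\<lambda>x. - ((f (- x) / \<phi> (- x)) / (f x / \<phi> x))) \<longlongrightarrow> - (1 / 1)) (at_right 0)"
    by (intro tendsto_intros neg pos) simp
  moreover have "\<forall>\<^sub>F x in at_right 0. - ((f (- x) / \<phi> (- x)) / (f x / \<phi> x)) = f (- x) / f x"
    using order_tendstoD(1)[OF pos zero_less_one] by eventually_elim (auto simp: odd)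
  ultimately show ?thesis by (simp add: Lim_transform_eventually)
qed

locale perturbed_decay = decay_rate f \<beta> + wiener_integral M B \<sigma> J
  for f \<beta> and M :: "'a measure" and B \<sigma> J +
  fixes X :: "real \<Rightarrow> 'a \<Rightarrow> real" and \<xi> h :: real
  assumes h: "h > 0"
    and paths: "AE \<omega> in M. integral_path \<xi> (\<lambda>t. X t \<omega>) (\<lambda>t. J t \<omega>)"
    and continuous_J: "AE \<omega> in M. continuous_on {0..} (\<lambda>t. J t \<omega>)"
begin

abbreviation "threshold n \<equiv> f (rate (real n * h))"

definition tail :: "real \<Rightarrow> nat \<Rightarrow> real" where
  "tail \<epsilon> n = measure (normal_law (energy (real n * h) ((real n + 1) * h))) {\<epsilon> * threshold n..}"

lemma threshold_pos: "threshold n > 0"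
  using h by (intro f_pos rate_pos) simp

lemma S_sum_tail:
  assumes "\<epsilon> > 0"
  shows "S_sum f \<sigma> \<epsilon> h = (\<Sum>n. ennreal (tail \<epsilon> n))"
proof -
  have "(if theta f \<sigma> h n = 0 then 0 else ennreal (Psi (\<epsilon> / theta f \<sigma> h n))) = ennreal (tail \<epsilon> n)" for n
  proof -
    define v where "v = energy (real n * h) ((real n + 1) * h)"
    have "theta f \<sigma> h n = sqrt v / threshold n"
      using threshold_pos[of n] by (simp add: theta_def v_def energy_def real_sqrt_divide)
    moreover have "v \<ge> 0" by (simp add: v_def energy_nonneg)
    ultimately show ?thesis
      using threshold_pos[of n] assms normal_law_tail[of v "\<epsilon> * threshold n"] by (auto simp: tail_def v_def)
  qed
  then show ?thesis by (simp add: S_sum_def)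
qed

lemma S_sum_finite_iff:
  assumes "\<epsilon> > 0" shows "S_sum f \<sigma> \<epsilon> h < \<infinity> \<longleftrightarrow> summable (tail \<epsilon>)"
proof -
  have nonneg: "0 \<le> tail \<epsilon> n" for n by (simp add: tail_def)
  have "(\<Sum>n. ennreal (tail \<epsilon> n)) \<noteq> top \<longleftrightarrow> summable (tail \<epsilon>)"
  proof
    assume "(\<Sum>n. ennreal (tail \<epsilon> n)) \<noteq> top"
    then show "summable (tail \<epsilon>)" by (rule summable_suminf_not_top[OF nonneg])
  next
    assume "summable (tail \<epsilon>)"
    then show "(\<Sum>n. ennreal (tail \<epsilon> n)) \<noteq> top" by (rule ennreal_suminf_neq_top) (rule nonneg)
  qed
  then show ?thesis unfolding S_sum_tail[OF assms] by (simp add: less_top)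
qed

text \<open>Thresholds \<open>1 / (k + 1)\<close> suffice for all \<open>\<epsilon>\<close> and cost only countably many null sets.\<close>

lemma event_A_almost_surely:
  assumes "\<And>\<epsilon>. \<epsilon> > 0 \<Longrightarrow> summable (tail \<epsilon>)"
  shows "AE \<omega> in M. \<omega> \<in> event_A M f h X"
proof -
  have "AE \<omega> in M. \<forall>\<^sub>F n in sequentially. \<forall>s\<in>{real n * h..(real n + 1) * h}.
      \<bar>J s \<omega> - J (real n * h) \<omega>\<bar> \<le> 1 / real (Suc k) * threshold n" for k
    using assms[of "1 / real (Suc k)"] unfolding tail_def[abs_def]
    by (intro oscillation_borel_cantelli h continuous_J) auto
  then have "AE \<omega> in M. \<forall>k. \<forall>\<^sub>F n in sequentially. \<forall>s\<in>{real n * h..(real n + 1) * h}.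
      \<bar>J s \<omega> - J (real n * h) \<omega>\<bar> \<le> 1 / real (Suc k) * threshold n"
    by (simp only: AE_all_countable) blast
  with paths AE_space show ?thesis
  proof eventually_elim
    case (elim \<omega>)
    have "small_oscillation h (\<lambda>t. J t \<omega>)"
      unfolding small_oscillation_def
    proof (intro allI impI)
      fix \<epsilon> :: real assume "\<epsilon> > 0"
      then obtain k where k: "1 / real (Suc k) < \<epsilon>" using nat_approx_posE by blast
      show "\<forall>\<^sub>F n in sequentially. \<forall>s\<in>{real n * h..(real n + 1) * h}. \<bar>J s \<omega> - J (real n * h) \<omega>\<bar> \<le> \<epsilon> * threshold n"
        using elim(3)[rule_format, of k]
      proof eventually_elim
        case (elim n)
        have "1 / real (Suc k) * threshold n \<le> \<epsilon> * threshold n"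
          using k threshold_pos[of n] by (intro mult_right_mono) auto
        with elim show ?case using order_trans by blast
      qed
    qed
    from integral_path_asymptotics[OF elim(1) h this] elim(2) show ?case
      unfolding event_A_def by blast
  qed
qed

text \<open>A divergent sum would force infinitely many large increments almost surely, while on the event of positive
probability the increments are of smaller order than the thresholds.\<close>

lemma summable_tail:
  assumes pos: "prob (event_A M f h X) > 0" and "\<epsilon> > 0"
  shows "summable (tail \<epsilon>)"
proof (rule ccontr)
  assume "\<not> summable (tail \<epsilon>)"
  then have "AE \<omega> in M. \<exists>\<^sub>F n in sequentially. J ((real n + 1) * h) \<omega> - J (real n * h) \<omega> \<ge> \<epsilon> * threshold n"
    unfolding tail_def[abs_def] by (rule increments_infinitely_often[OF h])
  with paths have "AE \<omega> in M. \<omega> \<notin> event_A M f h X"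
  proof eventually_elim
    case (elim \<omega>)
    show ?case
    proof
      assume "\<omega> \<in> event_A M f h X"
      then obtain l where l: "l \<in> {-1, 0, 1}" "((\<lambda>t. X t \<omega> / rate t) \<longlongrightarrow> l) at_top"
        "((\<lambda>t. (X (t + h) \<omega> - X t \<omega>) / h / f (rate t)) \<longlongrightarrow> - l) at_top" unfolding event_A_def by blast
      from filterlim_compose[OF integral_path_noise_increment[OF elim(1) h l] grid_at_top[OF h]]
      have "(\<lambda>n. (J (real n * h + h) \<omega> - J (real n * h) \<omega>) / threshold n) \<longlonglongrightarrow> 0" .
      then have "\<forall>\<^sub>F n in sequentially. (J (real n * h + h) \<omega> - J (real n * h) \<omega>) / threshold n < \<epsilon>"
        using \<open>\<epsilon> > 0\<close> by (rule order_tendstoD)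
      then have "\<forall>\<^sub>F n in sequentially. \<not> J ((real n + 1) * h) \<omega> - J (real n * h) \<omega> \<ge> \<epsilon> * threshold n"
        by eventually_elim (use threshold_pos in \<open>simp add: field_simps not_le\<close>)
      with elim(2) show False by (simp add: frequently_def)
    qed
  qed
  moreover have "event_A M f h X \<in> events" using pos measure_notin_sets by fastforce
  ultimately have "prob (event_A M f h X) = 0" by (simp add: prob_eq_0)
  with pos show False by simp
qed

end

theorem theorem15:
  fixes M :: "'a measure"
    and B X :: "real \<Rightarrow> 'a \<Rightarrow> real"
    and f \<phi> \<sigma> :: "real \<Rightarrow> real"
    and \<beta> \<xi> h :: real
  assumes "prob_space M" and "complete_measure M"
    and "brownian_motion M B"
    and "local_lipschitz (UNIV :: real set) UNIV (\<lambda>_. f)"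
    and "f 0 = 0" and "\<And>x. x \<noteq> 0 \<Longrightarrow> x * f x > 0"
    and "\<And>x. \<phi> (- x) = - \<phi> x"
    and "((\<lambda>x. f x / \<phi> x) \<longlongrightarrow> 1) (at 0)"
    and "\<beta> > 1" and "regularly_varying_0 f \<beta>"
    and "((\<lambda>x. f x / x) \<longlongrightarrow> 0) (at_right 0)"
    and "continuous_on {0..} \<sigma>"
    and "sde_solution M B f \<sigma> \<xi> X"
    and "h > 0"
  shows "((\<forall>\<epsilon>>0. S_sum f \<sigma> \<epsilon> h < \<infinity>) \<longleftrightarrow> measure M (event_A M f h X) > 0) \<and>
         (measure M (event_A M f h X) > 0 \<longleftrightarrow> measure M (event_A M f h X) = 1)"
proof -
  have cont: "continuous_on UNIV f"
    using local_lipschitz_continuous_on[OF assms(4)] by simp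
  obtain J where J: "\<And>t. t \<ge> 0 \<Longrightarrow> is_ito_integral M (completed_filtration M B) B (\<lambda>s \<omega>. \<sigma> s) t (J t)"
      "AE \<omega> in M. continuous_on {0..} (\<lambda>t. J t \<omega>)"
      "AE \<omega> in M. \<forall>t\<ge>0. X t \<omega> = \<xi> - integral {0..t} (\<lambda>s. f (X s \<omega>)) + J t \<omega>"
    using assms(13) unfolding sde_solution_def by blast
  have X: "AE \<omega> in M. continuous_on {0..} (\<lambda>t. X t \<omega>)" using assms(13) by (simp add: sde_solution_def)
  interpret decay_rate f \<beta>
  proof
    show "continuous_on {0<..} f" using cont by (rule continuous_on_subset) simp
    show "((\<lambda>x. f (- x) / f x) \<longlongrightarrow> -1) (at_right 0)" by (rule odd_equivalent_ratio) fact+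
  qed fact+
  interpret prob_space M by fact
  interpret wiener_integral M B \<sigma> J by unfold_locales (fact | rule J, assumption)+
  interpret perturbed_decay f \<beta> M B \<sigma> J X \<xi> h
  proof
    show "AE \<omega> in M. integral_path \<xi> (\<lambda>t. X t \<omega>) (\<lambda>t. J t \<omega>)"
      using X J(3) by eventually_elim (simp add: integral_path_def)
  qed (fact assms J)+
  interpret complete_measure M by fact
  let ?A = "event_A M f h X"
  have "prob ?A = 1" if "\<forall>\<epsilon>>0. S_sum f \<sigma> \<epsilon> h < \<infinity>"
  proof -
    have ae: "AE \<omega> in M. \<omega> \<in> ?A" 
      by (rule event_A_almost_surely) (use that S_sum_finite_iff in blast)
    then obtain N where N: "N \<in> null_sets M" "{\<omega> \<in> space M. \<omega> \<notin> ?A} \<subseteq> N" by (auto simp: eventually_ae_filter)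
    then have "{\<omega> \<in> space M. \<omega> \<notin> ?A} \<in> events" by (rule complete[rotated])
    moreover have "?A = space M - {\<omega> \<in> space M. \<omega> \<notin> ?A}" by (auto simp: event_A_def)
    ultimately have "?A \<in> events" by (metis sets.compl_sets)
    with ae show ?thesis by (simp add: prob_eq_1)
  qed
  moreover have "\<forall>\<epsilon>>0. S_sum f \<sigma> \<epsilon> h < \<infinity>" if "prob ?A > 0"
    using summable_tail[OF that] S_sum_finite_iff by blast
  ultimately show ?thesis by fastforce
qed

end
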